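(* Let $\delta\ge0$ and let $X$ be a $\delta$-hyperbolic geodesic semimetric space with finite base $S\subseteq X$ that satisfies (B1) and (B2) for the function $f\colon\mathbb R\to\mathbb R$. Let $\varepsilon>0$ be such that $\varepsilon'<\sqrt2$ holds for $\varepsilon':=e^{2\varepsilon(6\delta+2\delta f(\delta+1))}$. Then $d_{S,\varepsilon}$ is a visual pseudo-semimetric on $X\cup\partial X$ that satisfies $$(3-2\varepsilon')\rho_S^\varepsilon(\eta,\mu)\le d_{S,\varepsilon}(\eta,\mu)\le\rho_S^\varepsilon(\eta,\mu)$$ for all $\eta,\mu\in X\cup\partial X$.
   Context: A pseudo-semimetric on a set $X$ is a map $d\colon X\times X\to[0,\infty]$ with $d(x,x)=0$ and $d(x,y)\le d(x,z)+d(z,y)$ (no symmetry); it is a semimetric if moreover $d(x,y)=0$ implies $x=y$. Put $\mathcal B^+_r(x)=\{y: d(x,y)\le r\}$, $\mathcal B^-_r(x)=\{y: d(y,x)\le r\}$, and $\mathcal B^{\pm}_r(Y)=\bigcup_{y\in Y}\mathcal B^{\pm}_r(y)$ for $Y\subseteq X$ (or $Y$ a path, meaning its image). The forward topology is generated by the open out-balls $\{y: d(x,y)<r\}$, the backward topology by the open in-balls $\{y: d(y,x)<r\}$. A directed path from $x$ to $y$ is a map $P\colon[a,b]\to X$ ($a<b$ real) with $P(a)=x$ (starting point), $P(b)=y$ (end point) that is continuous with respect to the forward topologies and with respect to the backward topologies, where real intervals carry the semimetric $d(s,t)=t-s$ if $s\le t$ and $\infty$ otherwise. Its length is $\ell(P)=\lim_{N\to\infty}\sum_{i=1}^N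 d(P(t_{i-1}),P(t_i))$ with $t_i=a+i(b-a)/N$. It is a geodesic if $\ell(P)=d(x,y)$, and a $(\gamma,c)$-quasi-geodesic ($\gamma\ge1,c\ge0$) if $\ell(uPv)\le\gamma d(u,v)+c$ for all directed subpaths $uPv$ of $P$ from $u$ to $v$. $X$ is geodesic if there is a geodesic from $x$ to $y$ whenever $d(x,y)<\infty$. A geodesic triangle consists of three points and three geodesics (its sides), one between every two of these points (in one of the two directions). It is $\delta$-thin if for every labelling $P,Q,R$ of its sides such that the starting point of $P$ is the starting or the end point of $Q$ and the end point of $P$ is the starting or the end point of $R$, we have $P\subseteq\mathcal B^+_\delta(Q)\cup\mathcal B^-_\delta(R)$. $X$ is $\delta$-hyperbolic if all geodesic triangles are $\delta$-thin. (B1) for $f$: for all $x\in X$, $r\ge0$ and $y,z\in\mathcal B^+_r(x)$, $d(y,z)$ is either $\infty$ or at most $f(r)$. (B2) for $f$: the same with $\mathcal B^-_r(x)$ in place of $\mathcal B^+_r(x)$. A ray is a map $R\colon[0,\infty)\to X$, continuous with respect to the forward and backward topologies, such that for all $x\in X$, $r\ge0$ there is $p\ge0$ with $R([p,\infty))\cap\mathcal B^+_r(x)=\emptyset$. An anti-ray is a map $R\colon(-\infty,0]\to X$, continuous in the same sense, such that for all $x\in X$, $r\ge0$ there is $p\le0$ with $R((-\infty,p])\cap\mathcal B^-_r(x)=\emptyset$; for an anti-ray $R$ and $i>0$ write $R(i)$ for $R(-i)$. A (anti-)ray is quasi-geodesic if for some $\gamma,c$ all its finite directed subpaths are $(\gamma,c)$-quasi-geodesics.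 For quasi-geodesic rays or anti-rays $R_1,R_2$ write $R_1\le R_2$ if there is $M\ge0$ such that for every $r\ge0$ and $x\in X$ there is a directed path from a point of $R_1$ to a point of $R_2$ of length at most $M$ outside of $\mathcal B^+_r(x)\cup\mathcal B^-_r(x)$; $R_1\approx R_2$ means $R_1\le R_2\le R_1$, which under the hypotheses is an equivalence relation. The quasi-geodesic boundary $\partial X$ is the set of its classes. Let $d^{\leftrightarrow}(x,y)=\min\{d(x,y),d(y,x)\}$ and let $d^{\leftrightarrow}(s,P)$ be the infimum of $d^{\leftrightarrow}(s,p)$ over points $p$ on $P$. $S\subseteq X$ is a base of $X$ if for every $x\in X$ there is $s\in S$ with $d^{\leftrightarrow}(x,s)<\infty$. Let $\varepsilon>0$, $s\in S$, $\eta,\mu\in X\cup\partial X$. If $\eta\in X$, let the only representative of $\eta$ be the constant map $R(i)=\eta$; if $\eta\in\partial X$, its representatives are its elements. For representatives $R$ of $\eta$ and $Q$ of $\mu$ let $L_s(R,Q)=\liminf_{i,j\to\infty}\{d^{\leftrightarrow}(s,P): P\text{ an }R(i)\text{-}Q(j)\text{ geodesic}\}$, i.e. $\sup_n\inf\{d^{\leftrightarrow}(s,P): i,j\ge n,\ P\text{ an }R(i)\text{-}Q(j)\text{ geodesic}\}$, with the convention $L_s(R,Q)=-\infty$ if for some $n$ there is no such geodesic with $i,j\ge n$. Put $\rho_s(\eta,\mu)=\sup_{R,Q}L_s(R,Q)$ and $\rho^\varepsilon_s(\eta,\mu)=\inf_{R,Q}e^{-\varepsilon L_s(R,Q)}$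 (with $e^{-\infty}=0$, $e^{\infty}=\infty$), over all representatives $R$ of $\eta$, $Q$ of $\mu$, with the convention $\rho_s(x,x)=\infty$, $\rho_s^\varepsilon(x,x)=0$ for $x\in X$. Put $\rho_S(\eta,\mu)=\min_{s\in S}\rho_s(\eta,\mu)$, $\rho^\varepsilon_S(\eta,\mu)=\max_{s\in S}\rho^\varepsilon_s(\eta,\mu)$ and $$d_{S,\varepsilon}(\eta,\mu)=\inf\Big\{\sum_{i=0}^{n-1}\rho^\varepsilon_S(\eta_i,\eta_{i+1}) : n\in\mathbb N,\ \eta=\eta_0,\eta_1,\ldots,\eta_n=\mu\in X\cup\partial X\Big\}.$$ A pseudo-semimetric $d_a$ on $X\cup\partial X$ is visual (with parameter $a>1$) if there is $C>0$ with $\frac1Ca^{-\rho_S(\eta,\mu)}\le d_a(\eta,\mu)\le Ca^{-\rho_S(\eta,\mu)}$ for all $\eta,\mu\in X\cup\partial X$; $d_{S,\varepsilon}$ being visual means this for some $a>1$. *)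

theory Defs
  imports "HOL-Analysis.Analysis"
begin

section \<open>Semimetric spaces\<close>

text \<open>As for \<^locale>\<open>Metric_space\<close>, a space is a carrier set with a distance function on the whole
  type, of which only the values on the carrier matter.\<close>

definition pseudo_semimetric :: "'a set \<Rightarrow> ('a \<Rightarrow> 'a \<Rightarrow> ennreal) \<Rightarrow> bool" where
  "pseudo_semimetric X d \<longleftrightarrow>
     (\<forall>x\<in>X. d x x = 0) \<and> (\<forall>x\<in>X. \<forall>y\<in>X. \<forall>z\<in>X. d x y \<le> d x z + d z y)"

definition semimetric :: "'a set \<Rightarrow> ('a \<Rightarrow> 'a \<Rightarrow> ennreal) \<Rightarrow> bool" where
  "semimetric X d \<longleftrightarrow> pseudo_semimetric X d \<and> (\<forall>x\<in>X. \<forall>y\<in>X. d x y = 0 \<longrightarrow> x = y)"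

definition out_ball :: "'a set \<Rightarrow> ('a \<Rightarrow> 'a \<Rightarrow> ennreal) \<Rightarrow> real \<Rightarrow> 'a \<Rightarrow> 'a set" where
  "out_ball X d r x = {y\<in>X. d x y \<le> ennreal r}"

definition in_ball :: "'a set \<Rightarrow> ('a \<Rightarrow> 'a \<Rightarrow> ennreal) \<Rightarrow> real \<Rightarrow> 'a \<Rightarrow> 'a set" where
  "in_ball X d r x = {y\<in>X. d y x \<le> ennreal r}"

definition forward_topology :: "'a set \<Rightarrow> ('a \<Rightarrow> 'a \<Rightarrow> ennreal) \<Rightarrow> 'a topology" where
  "forward_topology X d =
     topology_generated_by {{y\<in>X. d x y < ennreal r} | x r. x \<in> X \<and> 0 < r}"

definition backward_topology :: "'a set \<Rightarrow> ('a \<Rightarrow> 'a \<Rightarrow> ennreal) \<Rightarrow> 'a topology" where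
  "backward_topology X d =
     topology_generated_by {{y\<in>X. d y x < ennreal r} | x r. x \<in> X \<and> 0 < r}"

definition real_semimetric :: "real \<Rightarrow> real \<Rightarrow> ennreal" where
  "real_semimetric s t = (if s \<le> t then ennreal (t - s) else \<infinity>)"

definition bicontinuous_on :: "real set \<Rightarrow> 'a set \<Rightarrow> ('a \<Rightarrow> 'a \<Rightarrow> ennreal) \<Rightarrow> (real \<Rightarrow> 'a) \<Rightarrow> bool" where
  "bicontinuous_on I X d f \<longleftrightarrow>
     continuous_map (forward_topology I real_semimetric) (forward_topology X d) f \<and>
     continuous_map (backward_topology I real_semimetric) (backward_topology X d) f"


section \<open>Directed paths and geodesics\<close>

text \<open>A path is given by the two ends of its parameter interval and a function on the reals, whose
  values outside of that interval are irrelevant.\<close>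

datatype 'a dpath = DPath (left_end: real) (right_end: real) (path_map: "real \<Rightarrow> 'a")

definition start_point :: "'a dpath \<Rightarrow> 'a" where
  "start_point P = path_map P (left_end P)"

definition end_point :: "'a dpath \<Rightarrow> 'a" where
  "end_point P = path_map P (right_end P)"

definition points_of :: "'a dpath \<Rightarrow> 'a set" where
  "points_of P = path_map P ` {left_end P..right_end P}"

definition directed_path :: "'a set \<Rightarrow> ('a \<Rightarrow> 'a \<Rightarrow> ennreal) \<Rightarrow> 'a dpath \<Rightarrow> bool" where
  "directed_path X d P \<longleftrightarrow>
     left_end P < right_end P \<and> bicontinuous_on {left_end P..right_end P} X d (path_map P)"

definition partition_point :: "'a dpath \<Rightarrow> nat \<Rightarrow> nat \<Rightarrow> real" where
  "partition_point P N i = left_end P + real i * (right_end P - left_end P) / real N"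

text \<open>For a directed path in a semimetric space the limit always exists in \<open>[0,\<infinity>]\<close>: it is the
  supremum over all partitions of the parameter interval.\<close>

definition path_len :: "('a \<Rightarrow> 'a \<Rightarrow> ennreal) \<Rightarrow> 'a dpath \<Rightarrow> ennreal" where
  "path_len d P =
     lim (\<lambda>N. \<Sum>i=1..N. d (path_map P (partition_point P N (i - 1)))
                          (path_map P (partition_point P N i)))"

definition geodesic :: "'a set \<Rightarrow> ('a \<Rightarrow> 'a \<Rightarrow> ennreal) \<Rightarrow> 'a dpath \<Rightarrow> bool" where
  "geodesic X d P \<longleftrightarrow> directed_path X d P \<and> path_len d P = d (start_point P) (end_point P)"

definition geodesic_from_to :: "'a set \<Rightarrow> ('a \<Rightarrow> 'a \<Rightarrow> ennreal) \<Rightarrow> 'a \<Rightarrow> 'a \<Rightarrow> 'a dpath \<Rightarrow> bool" where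
  "geodesic_from_to X d x y P \<longleftrightarrow> geodesic X d P \<and> start_point P = x \<and> end_point P = y"

definition quasi_geodesic ::
  "'a set \<Rightarrow> ('a \<Rightarrow> 'a \<Rightarrow> ennreal) \<Rightarrow> real \<Rightarrow> real \<Rightarrow> 'a dpath \<Rightarrow> bool" where
  "quasi_geodesic X d \<gamma> c P \<longleftrightarrow>
     directed_path X d P \<and>
     (\<forall>s t. left_end P \<le> s \<and> s < t \<and> t \<le> right_end P \<longrightarrow>
        path_len d (DPath s t (path_map P)) \<le> ennreal \<gamma> * d (path_map P s) (path_map P t) + ennreal c)"

definition geodesic_space :: "'a set \<Rightarrow> ('a \<Rightarrow> 'a \<Rightarrow> ennreal) \<Rightarrow> bool" where
  "geodesic_space X d \<longleftrightarrow> (\<forall>x\<in>X. \<forall>y\<in>X. d x y < \<infinity> \<longrightarrow> (\<exists>P. geodesic_from_to X d x y P))"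


section \<open>Hyperbolicity and the bounds on balls\<close>

definition triangle_side :: "'a set \<Rightarrow> ('a \<Rightarrow> 'a \<Rightarrow> ennreal) \<Rightarrow> 'a \<Rightarrow> 'a \<Rightarrow> 'a dpath \<Rightarrow> bool" where
  "triangle_side X d x y P \<longleftrightarrow> geodesic_from_to X d x y P \<or> geodesic_from_to X d y x P"

text \<open>The three points need not be distinct.\<close>

definition geodesic_triangle ::
  "'a set \<Rightarrow> ('a \<Rightarrow> 'a \<Rightarrow> ennreal) \<Rightarrow> 'a \<Rightarrow> 'a \<Rightarrow> 'a \<Rightarrow> 'a dpath \<Rightarrow> 'a dpath \<Rightarrow> 'a dpath \<Rightarrow> bool" where
  "geodesic_triangle X d x y z A B C \<longleftrightarrow>
     x \<in> X \<and> y \<in> X \<and> z \<in> X \<and>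
     triangle_side X d x y A \<and> triangle_side X d y z B \<and> triangle_side X d z x C"

definition thin_triangle ::
  "'a set \<Rightarrow> ('a \<Rightarrow> 'a \<Rightarrow> ennreal) \<Rightarrow> real \<Rightarrow> 'a dpath \<Rightarrow> 'a dpath \<Rightarrow> 'a dpath \<Rightarrow> bool" where
  "thin_triangle X d \<delta> A B C \<longleftrightarrow>
     (\<forall>P Q R. mset [P, Q, R] = mset [A, B, C] \<and>
        start_point P \<in> {start_point Q, end_point Q} \<and>
        end_point P \<in> {start_point R, end_point R} \<longrightarrow>
        points_of P \<subseteq> (\<Union>q\<in>points_of Q. out_ball X d \<delta> q) \<union> (\<Union>r\<in>points_of R. in_ball X d \<delta> r))"

definition hyperbolic :: "'a set \<Rightarrow> ('a \<Rightarrow> 'a \<Rightarrow> ennreal) \<Rightarrow> real \<Rightarrow> bool" where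
  "hyperbolic X d \<delta> \<longleftrightarrow>
     (\<forall>x y z A B C. geodesic_triangle X d x y z A B C \<longrightarrow> thin_triangle X d \<delta> A B C)"

text \<open>The bounds are compared in \<^typ>\<open>ereal\<close>, since \<^const>\<open>ennreal\<close> would turn negative values of
  \<open>f\<close> into \<open>0\<close>.\<close>

definition B1 :: "'a set \<Rightarrow> ('a \<Rightarrow> 'a \<Rightarrow> ennreal) \<Rightarrow> (real \<Rightarrow> real) \<Rightarrow> bool" where
  "B1 X d f \<longleftrightarrow>
     (\<forall>x\<in>X. \<forall>r\<ge>0. \<forall>y\<in>out_ball X d r x. \<forall>z\<in>out_ball X d r x.
        d y z = \<infinity> \<or> enn2ereal (d y z) \<le> ereal (f r))"

definition B2 :: "'a set \<Rightarrow> ('a \<Rightarrow> 'a \<Rightarrow> ennreal) \<Rightarrow> (real \<Rightarrow> real) \<Rightarrow> bool" where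
  "B2 X d f \<longleftrightarrow>
     (\<forall>x\<in>X. \<forall>r\<ge>0. \<forall>y\<in>in_ball X d r x. \<forall>z\<in>in_ball X d r x.
        d y z = \<infinity> \<or> enn2ereal (d y z) \<le> ereal (f r))"


section \<open>The quasi-geodesic boundary\<close>

definition is_ray :: "'a set \<Rightarrow> ('a \<Rightarrow> 'a \<Rightarrow> ennreal) \<Rightarrow> (real \<Rightarrow> 'a) \<Rightarrow> bool" where
  "is_ray X d R \<longleftrightarrow>
     bicontinuous_on {0..} X d R \<and>
     (\<forall>x\<in>X. \<forall>r\<ge>0. \<exists>p\<ge>0. R ` {p..} \<inter> out_ball X d r x = {})"

definition is_anti_ray :: "'a set \<Rightarrow> ('a \<Rightarrow> 'a \<Rightarrow> ennreal) \<Rightarrow> (real \<Rightarrow> 'a) \<Rightarrow> bool" where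
  "is_anti_ray X d R \<longleftrightarrow>
     bicontinuous_on {..0} X d R \<and>
     (\<forall>x\<in>X. \<forall>r\<ge>0. \<exists>p\<le>0. R ` {..p} \<inter> in_ball X d r x = {})"

text \<open>Rays and anti-rays are tagged, because their maps have the same type but are relevant only on
  \<open>[0,\<infinity>)\<close> and on \<open>(-\<infinity>,0]\<close>, respectively.\<close>

datatype 'a semiray = Ray (semiray_map: "real \<Rightarrow> 'a") | Anti_Ray (semiray_map: "real \<Rightarrow> 'a")

fun semiray_dom :: "'a semiray \<Rightarrow> real set" where
  "semiray_dom (Ray R) = {0..}"
| "semiray_dom (Anti_Ray R) = {..0}"

fun is_semiray :: "'a set \<Rightarrow> ('a \<Rightarrow> 'a \<Rightarrow> ennreal) \<Rightarrow> 'a semiray \<Rightarrow> bool" where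
  "is_semiray X d (Ray R) = is_ray X d R"
| "is_semiray X d (Anti_Ray R) = is_anti_ray X d R"

definition semiray_points :: "'a semiray \<Rightarrow> 'a set" where
  "semiray_points R = semiray_map R ` semiray_dom R"

definition quasi_geodesic_semirays :: "'a set \<Rightarrow> ('a \<Rightarrow> 'a \<Rightarrow> ennreal) \<Rightarrow> 'a semiray set" where
  "quasi_geodesic_semirays X d =
     {R. is_semiray X d R \<and>
         (\<exists>\<gamma>\<ge>1. \<exists>c\<ge>0. \<forall>s\<in>semiray_dom R. \<forall>t\<in>semiray_dom R. s < t \<longrightarrow>
            quasi_geodesic X d \<gamma> c (DPath s t (semiray_map R)))}"

definition semiray_le :: "'a set \<Rightarrow> ('a \<Rightarrow> 'a \<Rightarrow> ennreal) \<Rightarrow> 'a semiray \<Rightarrow> 'a semiray \<Rightarrow> bool" where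
  "semiray_le X d R\<^sub>1 R\<^sub>2 \<longleftrightarrow>
     (\<exists>M\<ge>0. \<forall>r\<ge>0. \<forall>x\<in>X. \<exists>P. directed_path X d P \<and>
        start_point P \<in> semiray_points R\<^sub>1 \<and> end_point P \<in> semiray_points R\<^sub>2 \<and>
        path_len d P \<le> ennreal M \<and>
        points_of P \<inter> (out_ball X d r x \<union> in_ball X d r x) = {})"

definition semiray_equiv :: "'a set \<Rightarrow> ('a \<Rightarrow> 'a \<Rightarrow> ennreal) \<Rightarrow> ('a semiray \<times> 'a semiray) set" where
  "semiray_equiv X d =
     {(R\<^sub>1, R\<^sub>2). R\<^sub>1 \<in> quasi_geodesic_semirays X d \<and> R\<^sub>2 \<in> quasi_geodesic_semirays X d \<and>
        semiray_le X d R\<^sub>1 R\<^sub>2 \<and> semiray_le X d R\<^sub>2 R\<^sub>1}"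

text \<open>Two maps that differ only outside of the relevant half-line are equivalent, so the irrelevant
  values do not create additional classes.\<close>

definition qg_boundary :: "'a set \<Rightarrow> ('a \<Rightarrow> 'a \<Rightarrow> ennreal) \<Rightarrow> 'a semiray set set" where
  "qg_boundary X d = quasi_geodesic_semirays X d // semiray_equiv X d"

text \<open>\<open>X \<union> \<partial>X\<close> is rendered as a disjoint union.\<close>

type_synonym 'a bpoint = "'a + 'a semiray set"

definition bordification :: "'a set \<Rightarrow> ('a \<Rightarrow> 'a \<Rightarrow> ennreal) \<Rightarrow> 'a bpoint set" where
  "bordification X d = X <+> qg_boundary X d"


section \<open>The distance on the bordification\<close>

definition sym_dist :: "('a \<Rightarrow> 'a \<Rightarrow> ennreal) \<Rightarrow> 'a \<Rightarrow> 'a \<Rightarrow> ennreal" where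
  "sym_dist d x y = min (d x y) (d y x)"

definition sym_dist_path :: "('a \<Rightarrow> 'a \<Rightarrow> ennreal) \<Rightarrow> 'a \<Rightarrow> 'a dpath \<Rightarrow> ennreal" where
  "sym_dist_path d s P = (INF p\<in>points_of P. sym_dist d s p)"

definition is_base :: "'a set \<Rightarrow> ('a \<Rightarrow> 'a \<Rightarrow> ennreal) \<Rightarrow> 'a set \<Rightarrow> bool" where
  "is_base X d S \<longleftrightarrow> S \<subseteq> X \<and> (\<forall>x\<in>X. \<exists>s\<in>S. sym_dist d x s < \<infinity>)"

text \<open>The point \<open>R(i)\<close> for \<open>i \<ge> 0\<close>, which is \<open>R(-i)\<close> for anti-rays.\<close>

fun semiray_at :: "'a semiray \<Rightarrow> real \<Rightarrow> 'a" where
  "semiray_at (Ray R) i = R i"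
| "semiray_at (Anti_Ray R) i = R (- i)"

fun representatives :: "'a bpoint \<Rightarrow> (real \<Rightarrow> 'a) set" where
  "representatives (Inl x) = {\<lambda>_. x}"
| "representatives (Inr E) = semiray_at ` E"

definition geodesic_dists ::
  "'a set \<Rightarrow> ('a \<Rightarrow> 'a \<Rightarrow> ennreal) \<Rightarrow> 'a \<Rightarrow> (real \<Rightarrow> 'a) \<Rightarrow> (real \<Rightarrow> 'a) \<Rightarrow> nat \<Rightarrow> ereal set" where
  "geodesic_dists X d s R Q n =
     {enn2ereal (sym_dist_path d s P) | P i j.
        real n \<le> i \<and> real n \<le> j \<and> geodesic_from_to X d (R i) (Q j) P}"

definition L_base ::
  "'a set \<Rightarrow> ('a \<Rightarrow> 'a \<Rightarrow> ennreal) \<Rightarrow> 'a \<Rightarrow> (real \<Rightarrow> 'a) \<Rightarrow> (real \<Rightarrow> 'a) \<Rightarrow> ereal" where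
  "L_base X d s R Q =
     (if \<exists>n. geodesic_dists X d s R Q n = {} then - \<infinity>
      else (SUP n. Inf (geodesic_dists X d s R Q n)))"

text \<open>\<open>a\<^sup>x\<close> for \<open>a > 1\<close> and extended real \<open>x\<close>.\<close>

fun epowr :: "real \<Rightarrow> ereal \<Rightarrow> ennreal" where
  "epowr a (ereal x) = ennreal (a powr x)"
| "epowr a PInfty = \<infinity>"
| "epowr a MInfty = 0"

definition rho_pt ::
  "'a set \<Rightarrow> ('a \<Rightarrow> 'a \<Rightarrow> ennreal) \<Rightarrow> 'a \<Rightarrow> 'a bpoint \<Rightarrow> 'a bpoint \<Rightarrow> ereal" where
  "rho_pt X d s \<eta> \<mu> =
     (if \<exists>x. \<eta> = Inl x \<and> \<mu> = Inl x then \<infinity>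
      else (SUP R\<in>representatives \<eta>. SUP Q\<in>representatives \<mu>. L_base X d s R Q))"

definition rho_eps_pt ::
  "'a set \<Rightarrow> ('a \<Rightarrow> 'a \<Rightarrow> ennreal) \<Rightarrow> real \<Rightarrow> 'a \<Rightarrow> 'a bpoint \<Rightarrow> 'a bpoint \<Rightarrow> ennreal" where
  "rho_eps_pt X d \<epsilon> s \<eta> \<mu> =
     (if \<exists>x. \<eta> = Inl x \<and> \<mu> = Inl x then 0
      else (INF R\<in>representatives \<eta>. INF Q\<in>representatives \<mu>.
              epowr (exp 1) (- (ereal \<epsilon> * L_base X d s R Q))))"

definition rho ::
  "'a set \<Rightarrow> ('a \<Rightarrow> 'a \<Rightarrow> ennreal) \<Rightarrow> 'a set \<Rightarrow> 'a bpoint \<Rightarrow> 'a bpoint \<Rightarrow> ereal" where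
  "rho X d S \<eta> \<mu> = (MIN s\<in>S. rho_pt X d s \<eta> \<mu>)"

definition rho_eps ::
  "'a set \<Rightarrow> ('a \<Rightarrow> 'a \<Rightarrow> ennreal) \<Rightarrow> 'a set \<Rightarrow> real \<Rightarrow> 'a bpoint \<Rightarrow> 'a bpoint \<Rightarrow> ennreal" where
  "rho_eps X d S \<epsilon> \<eta> \<mu> = (MAX s\<in>S. rho_eps_pt X d \<epsilon> s \<eta> \<mu>)"

text \<open>The trivial chain with \<open>n = 0\<close> is allowed when \<open>\<eta> = \<mu>\<close>.\<close>

definition chain_dist ::
  "'a set \<Rightarrow> ('a \<Rightarrow> 'a \<Rightarrow> ennreal) \<Rightarrow> 'a set \<Rightarrow> real \<Rightarrow> 'a bpoint \<Rightarrow> 'a bpoint \<Rightarrow> ennreal" where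
  "chain_dist X d S \<epsilon> \<eta> \<mu> =
     Inf {\<Sum>i<n. rho_eps X d S \<epsilon> (c i) (c (Suc i)) | (n::nat) c.
            c 0 = \<eta> \<and> c n = \<mu> \<and> (\<forall>i\<le>n. c i \<in> bordification X d)}"

definition visual ::
  "'a set \<Rightarrow> ('a \<Rightarrow> 'a \<Rightarrow> ennreal) \<Rightarrow> 'a set \<Rightarrow> real \<Rightarrow> ('a bpoint \<Rightarrow> 'a bpoint \<Rightarrow> ennreal) \<Rightarrow> bool" where
  "visual X d S a d\<^sub>a \<longleftrightarrow>
     pseudo_semimetric (bordification X d) d\<^sub>a \<and> 1 < a \<and>
     (\<exists>C>0. \<forall>\<eta>\<in>bordification X d. \<forall>\<mu>\<in>bordification X d.
        ennreal (1 / C) * epowr a (- rho X d S \<eta> \<mu>) \<le> d\<^sub>a \<eta> \<mu> \<and>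
        d\<^sub>a \<eta> \<mu> \<le> ennreal C * epowr a (- rho X d S \<eta> \<mu>))"

end

theory Submission
  imports Defs
begin

text \<open>
  Write \<open>\<rho>\<close> for the visual size \<open>\<rho>\<^sub>S\<^sup>\<epsilon>\<close>. If \<open>\<rho>(x,x) = 0\<close> and \<open>\<rho>(x,z) \<le> K max(\<rho>(x,y), \<rho>(y,z))\<close> with
  \<open>1 \<le> K \<le> \<surd>2\<close>, then splitting a chain at half of its length shows by induction that the length of
  a chain is at least \<open>3 - 2K\<close> times the value of \<open>\<rho>\<close> at its ends (\<open>quasi_ultrametric_chain\<close>). For
  \<open>K = \<epsilon>'\<close> this is the lower bound of the theorem, the upper bound is the chain with one step, and both
  together say that the chain distance is visual with parameter \<open>e\<^sup>\<epsilon>\<close>. What has to be shown is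
  therefore that \<open>\<rho>\<^sub>s(\<eta>,\<eta>) = \<infinity>\<close> and that, for a base point \<open>s\<close>,
  \<open>\<rho>\<^sub>s(\<eta>,\<mu>) \<ge> min(\<rho>\<^sub>s(\<eta>,\<nu>), \<rho>\<^sub>s(\<nu>,\<mu>)) - (12\<delta> + 4\<delta>f(\<delta>+1))\<close>: if the geodesics from \<open>\<eta>\<close> to \<open>\<nu>\<close> and from
  \<open>\<nu>\<close> to \<open>\<mu>\<close> stay far away from \<open>s\<close>, then so do those from \<open>\<eta>\<close> to \<open>\<mu>\<close>.

  The difficulty is the direction of the distances. Let a point \<open>p\<close> on a side of a triangle be close to
  \<open>s\<close> in the sense that \<open>d(s,p)\<close> is small. Thinness yields a point \<open>q\<close> on one of the other sides with
  \<open>d(q,p) \<le> \<delta>\<close> or \<open>d(p,q) \<le> \<delta>\<close>, and only the second case says that another side is close to \<open>s\<close>.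
  Lemma \<open>out_close\<close> turns the first case into the second: if \<open>P\<close> and \<open>Q\<close> start at the same vertex and
  \<open>R\<close> is the third side, then each \<open>p\<close> on \<open>P\<close> has a point \<open>u\<close> on \<open>Q \<union> R\<close> with \<open>d(p,u) \<le> 4\<delta> + \<eta>\<close>. All
  hypotheses on the space are invariant under reversal of the distance, so everything that concerns
  \<open>d(p,s)\<close> follows from the statements about \<open>d(s,p)\<close>. The last side of a transitive triangle need
  not be close to the other two in the outward direction, whatever constant is allowed. Such sides occur
  when geodesics run between rays, and then the bounds on balls have to help (\<open>anchored_point_or_ideal\<close>).

  For points \<open>\<eta>\<close>, \<open>\<nu>\<close>, \<open>\<mu>\<close> of \<open>X\<close> one triangle suffices. For boundary points the arguments are:
  geodesics with ends on a quasi-geodesic stay close to it (\<open>geodesic_near_chain\<close>), hence geodesics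
  between points far out on a quasi-geodesic ray are far from any given point
  (\<open>quasi_ray_tail_far\<close>); two representatives of the same boundary point are connected by geodesics far
  out (\<open>linked_trans\<close>); and the geodesics from \<open>\<eta>\<close> to \<open>\<mu>\<close> are compared with those through \<open>\<nu>\<close> by means
  of at most four triangles (\<open>avoid_transfer\<close>), whose additional sides connect points on the same ray or on
  two representatives of \<open>\<nu>\<close> and lie far out. The loss is at most \<open>13\<delta>\<close>, which is covered by
  \<open>12\<delta> + 4\<delta>f(\<delta>+1)\<close> because the existence of a boundary point implies \<open>f(\<delta>+1) \<ge> 1\<close>.
\<close>


section \<open>Chains in a quasi-ultrametric\<close>

lemma cubic_bound:
  fixes K :: real
  assumes "1 \<le> K"
  shows "K\<^sup>2 * (3 - 2 * K) \<le> 1"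
proof -
  have "1 - K\<^sup>2 * (3 - 2 * K) = (K - 1)\<^sup>2 * (2 * K + 1)"
    by (simp add: power2_eq_square algebra_simps)
  moreover have "\<dots> \<ge> 0" using assms by simp
  ultimately show ?thesis by linarith
qed

text \<open>Cut the sum at the last index \<open>p\<close> up to which at most half of it has been used. The parts before and
  after the step from \<open>p\<close> to \<open>p + 1\<close> sum up to at most one half each, so induction bounds \<open>r\<close> on them
  by half of the sum over \<open>3 - 2 K\<close>, and on the step itself \<open>r\<close> is at most the whole sum. Joining the
  three pieces costs a factor \<open>K\<^sup>2 \<le> 2\<close>, and for the middle one \<open>K\<^sup>2 (3 - 2 K) \<le> 1\<close> is used.\<close>
lemma quasi_ultrametric_chain_real:
  fixes r :: "nat \<Rightarrow> nat \<Rightarrow> real"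
  assumes K: "1 \<le> K" "K\<^sup>2 \<le> 2"
    and nonneg: "\<And>i j. i \<le> j \<Longrightarrow> j \<le> n \<Longrightarrow> 0 \<le> r i j"
    and refl: "\<And>i. i \<le> n \<Longrightarrow> r i i = 0"
    and quasi: "\<And>i j k. i \<le> j \<Longrightarrow> j \<le> k \<Longrightarrow> k \<le> n \<Longrightarrow> r i k \<le> K * max (r i j) (r j k)"
    and "i \<le> j" "j \<le> n"
  shows "(3 - 2 * K) * r i j \<le> (\<Sum>k=i..<j. r k (Suc k))"
  using \<open>i \<le> j\<close> \<open>j \<le> n\<close>
proof (induction "j - i" arbitrary: i j rule: less_induct)
  case less
  have K32: "0 < 3 - 2 * K"
  proof (rule ccontr)
    assume "\<not> ?thesis"
    then have "3 / 2 \<le> K" by simp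
    then have "(3 / 2)\<^sup>2 \<le> K\<^sup>2" by (rule power_mono) simp
    with K(2) show False by (simp add: power2_eq_square)
  qed
  let ?a = "\<lambda>k. r k (Suc k)"
  let ?A = "\<lambda>k l. sum ?a {k..<l}"
  define S where "S = ?A i j"
  have a0: "0 \<le> ?a k" if "k < j" for k using that nonneg less.prems by simp
  show ?case
  proof (cases "i = j")
    case True
    then show ?thesis using refl less.prems by simp
  next
    case False
    \<comment> \<open>the last index up to which the sum is at most one half\<close>
    define p where "p = (GREATEST k. i \<le> k \<and> k < j \<and> ?A i k \<le> S / 2)"
    have S0: "0 \<le> S" unfolding S_def by (rule sum_nonneg) (use a0 in auto)
    have ex: "i \<le> i \<and> i < j \<and> ?A i i \<le> S / 2" using False S0 less.prems by simp
    have p: "i \<le> p \<and> p < j \<and> ?A i p \<le> S / 2" unfolding p_def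
      by (rule GreatestI_nat[where k = i and b = j]) (use ex in auto)
    have greatest: "k \<le> p" if "i \<le> k \<and> k < j \<and> ?A i k \<le> S / 2" for k
      unfolding p_def by (rule Greatest_le_nat[where b = j]) (use that in auto)
    have ap: "?a p \<le> S"
      unfolding S_def by (rule member_le_sum) (use p a0 in auto)
    have tail: "?A (Suc p) j \<le> S / 2"
    proof (cases "Suc p < j")
      case True
      have "\<not> ?A i (Suc p) \<le> S / 2" using greatest[of "Suc p"] True p by auto
      moreover have "S = ?A i (Suc p) + ?A (Suc p) j"
        unfolding S_def by (rule sum.atLeastLessThan_concat[symmetric]) (use True p in auto)
      ultimately show ?thesis by simp
    qed (use S0 in auto)
    have le1: "(3 - 2 * K) * r i p \<le> S / 2"
      using less.hyps[of p i] less.prems p by force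
    have le2: "(3 - 2 * K) * r (Suc p) j \<le> S / 2"
      using less.hyps[of j "Suc p"] less.prems p tail by force
    let ?x = "r i p" and ?y = "r p (Suc p)" and ?z = "r (Suc p) j"
    have "r i j \<le> K * max (r i (Suc p)) ?z" using quasi p less.prems by simp
    also have "\<dots> \<le> K * max (K * max ?x ?y) (K * ?z)"
    proof -
      have "r i (Suc p) \<le> K * max ?x ?y" using quasi p less.prems by simp
      moreover have "?z \<le> K * ?z" using nonneg[of "Suc p" j] p less.prems K
        by (simp add: mult_le_cancel_right1)
      ultimately show ?thesis using K by (intro mult_left_mono max.mono) auto
    qed
    also have "\<dots> = K\<^sup>2 * max (max ?x ?y) ?z"
      using K by (simp add: power2_eq_square max_mult_distrib_left mult.assoc)
    finally have le: "r i j \<le> K\<^sup>2 * max (max ?x ?y) ?z" .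
    have half: "K\<^sup>2 * ((3 - 2 * K) * w) \<le> S" if "(3 - 2 * K) * w \<le> S / 2" for w
    proof -
      have "K\<^sup>2 * ((3 - 2 * K) * w) \<le> K\<^sup>2 * (S / 2)" using that by (intro mult_left_mono) auto
      also have "\<dots> \<le> 2 * (S / 2)" using K(2) S0 by (intro mult_right_mono) auto
      finally show ?thesis by simp
    qed
    have "K\<^sup>2 * ((3 - 2 * K) * ?y) \<le> S"
    proof -
      have "K\<^sup>2 * ((3 - 2 * K) * ?y) \<le> 1 * ?y"
        unfolding mult.assoc[symmetric] using cubic_bound[OF K(1)] a0 p
        by (intro mult_right_mono) auto
      then show ?thesis using ap by simp
    qed
    with half[OF le1] half[OF le2] have "K\<^sup>2 * ((3 - 2 * K) * max (max ?x ?y) ?z) \<le> S"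
      by (auto simp: max_def)
    moreover have "(3 - 2 * K) * r i j \<le> (3 - 2 * K) * (K\<^sup>2 * max (max ?x ?y) ?z)"
      using le K32 by (intro mult_left_mono) auto
    ultimately show ?thesis by (simp add: S_def mult.left_commute)
  qed
qed

text \<open>If the sum is finite, then so are all values of \<open>\<rho>\<close> along the chain by the quasi-ultrametric
  inequality, so the real version applies to the indices of the chain.\<close>
lemma quasi_ultrametric_chain:
  fixes \<rho> :: "'b \<Rightarrow> 'b \<Rightarrow> ennreal"
  assumes K: "1 \<le> K" "K\<^sup>2 \<le> 2"
    and refl: "\<And>x. x \<in> B \<Longrightarrow> \<rho> x x = 0"
    and quasi: "\<And>x y z. x \<in> B \<Longrightarrow> y \<in> B \<Longrightarrow> z \<in> B \<Longrightarrow> \<rho> x z \<le> ennreal K * max (\<rho> x y) (\<rho> y z)"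
    and c: "\<And>i. i \<le> n \<Longrightarrow> c i \<in> B"
  shows "ennreal (3 - 2 * K) * \<rho> (c 0) (c n) \<le> (\<Sum>i<n. \<rho> (c i) (c (Suc i)))"
proof (cases "(\<Sum>i<n. \<rho> (c i) (c (Suc i))) = \<infinity>")
  case False
  then have step: "\<rho> (c i) (c (Suc i)) < \<infinity>" if "i < n" for i
  proof -
    have "\<rho> (c i) (c (Suc i)) \<le> (\<Sum>i<n. \<rho> (c i) (c (Suc i)))"
      by (rule member_le_sum) (use that in auto)
    also have "\<dots> < \<infinity>" using False by (simp add: less_top)
    finally show ?thesis .
  qed
  have fin: "\<rho> (c i) (c j) < \<infinity>" if "i \<le> j" "j \<le> n" for i j
    using that
  proof (induction j rule: dec_induct)
    case base
    then show ?case using refl c by simp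
  next
    case (step j)
    have "\<rho> (c i) (c (Suc j)) \<le> ennreal K * max (\<rho> (c i) (c j)) (\<rho> (c j) (c (Suc j)))"
      using quasi c step by simp
    also have "\<dots> < \<infinity>"
      using step \<open>\<And>i. i < n \<Longrightarrow> \<rho> (c i) (c (Suc i)) < \<infinity>\<close>
      by (simp add: ennreal_mult_less_top max_def)
    finally show ?case .
  qed
  define r where "r i j = enn2real (\<rho> (c i) (c j))" for i j
  have r: "\<rho> (c i) (c j) = ennreal (r i j)" if "i \<le> j" "j \<le> n" for i j
    using fin[OF that] by (simp add: r_def less_top)
  have r0: "0 \<le> r i j" for i j by (simp add: r_def)
  have "(3 - 2 * K) * r 0 n \<le> (\<Sum>k=0..<n. r k (Suc k))"
  proof (rule quasi_ultrametric_chain_real[OF K, where n = n])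
    fix i j k assume ijk: "i \<le> j" "j \<le> k" "k \<le> n"
    have "ennreal (r i k) \<le> ennreal K * max (ennreal (r i j)) (ennreal (r j k))"
      using quasi[of "c i" "c j" "c k"] c ijk by (simp flip: r)
    also have "\<dots> = ennreal (K * max (r i j) (r j k))"
      using K r0 by (simp add: ennreal_mult max_def)
    finally show "r i k \<le> K * max (r i j) (r j k)"
      using K r0 by (simp add: max_def split: if_splits)
  qed (use r0 refl c in \<open>auto simp: r_def\<close>)
  then have "ennreal ((3 - 2 * K) * r 0 n) \<le> (\<Sum>k=0..<n. ennreal (r k (Suc k)))"
    using r0 by (simp add: ennreal_leI)
  moreover have "(\<Sum>k=0..<n. ennreal (r k (Suc k))) = (\<Sum>i<n. \<rho> (c i) (c (Suc i)))"
    by (rule sum.cong) (auto simp: r)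
  moreover have "ennreal (3 - 2 * K) * \<rho> (c 0) (c n) = ennreal ((3 - 2 * K) * r 0 n)"
    using r0[of 0 n] by (simp add: r ennreal_mult'')
  ultimately show ?thesis by simp
next
  case True
  then show ?thesis by (metis infinity_ennreal_def top_greatest)
qed

section \<open>One-sided continuity and the length of paths\<close>

definition reversed :: "('a \<Rightarrow> 'a \<Rightarrow> ennreal) \<Rightarrow> 'a \<Rightarrow> 'a \<Rightarrow> ennreal" where
  "reversed d x y = d y x"

lemma reversed_reversed [simp]: "reversed (reversed d) = d"
  by (simp add: reversed_def fun_eq_iff)

lemma pseudo_semimetric_reversed: "pseudo_semimetric X d \<Longrightarrow> pseudo_semimetric X (reversed d)"
  by (simp add: pseudo_semimetric_def reversed_def add.commute)

text \<open>This makes every statement about forward topologies available for backward topologies.\<close>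
lemma backward_topology_eq: "backward_topology X d = forward_topology X (reversed d)"
  by (simp add: backward_topology_def forward_topology_def reversed_def)

lemma openin_forward_topology:
  assumes ps: "pseudo_semimetric X d"
  shows "openin (forward_topology X d) U \<longleftrightarrow> U \<subseteq> X \<and> (\<forall>x\<in>U. \<exists>r>0. {y \<in> X. d x y < ennreal r} \<subseteq> U)"
proof
  assume "openin (forward_topology X d) U"
  then show "U \<subseteq> X \<and> (\<forall>x\<in>U. \<exists>r>0. {y \<in> X. d x y < ennreal r} \<subseteq> U)"
    unfolding forward_topology_def openin_topology_generated_by_iff
  proof (induction rule: generate_topology_on.induct)
    case (Int A B)
    have "\<exists>r>0. {y \<in> X. d x y < ennreal r} \<subseteq> A \<inter> B" if x: "x \<in> A \<inter> B" for x
    proof -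
      have "x \<in> A" "x \<in> B" using x by auto
      from bspec[OF conjunct2[OF Int.IH(1)] \<open>x \<in> A\<close>]
      obtain r where r: "r > 0 \<and> {y \<in> X. d x y < ennreal r} \<subseteq> A" ..
      from bspec[OF conjunct2[OF Int.IH(2)] \<open>x \<in> B\<close>]
      obtain r' where r': "r' > 0 \<and> {y \<in> X. d x y < ennreal r'} \<subseteq> B" ..
      have "{y \<in> X. d x y < ennreal (min r r')} \<subseteq> {y \<in> X. d x y < ennreal r} \<inter> {y \<in> X. d x y < ennreal r'}"
        by (auto elim!: less_le_trans intro: ennreal_leI)
      then have "{y \<in> X. d x y < ennreal (min r r')} \<subseteq> A \<inter> B" using r r' by fast
      then show ?thesis using r r' by (intro exI[of _ "min r r'"]) simp
    qed
    moreover have "A \<inter> B \<subseteq> X" using conjunct1[OF Int.IH(1)] by fast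
    ultimately show ?case by simp
  next
    case (UN K)
    have "\<exists>r>0. {y \<in> X. d x y < ennreal r} \<subseteq> \<Union>K" if x: "x \<in> \<Union>K" for x
    proof -
      obtain k where k: "k \<in> K" "x \<in> k" using x by blast
      from bspec[OF conjunct2[OF UN.IH[OF k(1)]] k(2)]
      obtain r where "r > 0 \<and> {y \<in> X. d x y < ennreal r} \<subseteq> k" ..
      moreover have "k \<subseteq> \<Union>K" using k(1) by fast
      ultimately show ?thesis by (intro exI[of _ r] conjI) (auto intro: order_trans)
    qed
    moreover have "\<Union>K \<subseteq> X" using UN.IH by (intro Union_least) simp
    ultimately show ?case by simp
  next
    case (Basis s)
    then obtain x0 r0 where s: "s = {y \<in> X. d x0 y < ennreal r0}" "x0 \<in> X" by blast
    have "\<exists>r>0. {y \<in> X. d x y < ennreal r} \<subseteq> s" if x: "x \<in> s" for x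
    proof -
      obtain w where w: "d x0 x = ennreal w" "0 \<le> w" "w < r0"
        using x s by (cases "d x0 x") (auto simp: ennreal_less_iff)
      have "d x0 y < ennreal r0" if y: "y \<in> X" "d x y < ennreal (r0 - w)" for y
      proof -
        obtain v where v: "d x y = ennreal v" "0 \<le> v" "v < r0 - w"
          using y by (cases "d x y") (auto simp: ennreal_less_iff)
        have "d x0 y \<le> d x0 x + d x y" using ps x s y by (auto simp: pseudo_semimetric_def)
        also have "\<dots> = ennreal (w + v)" using w v by simp
        also have "\<dots> < ennreal r0" using w v by (intro ennreal_lessI) auto
        finally show ?thesis .
      qed
      then show ?thesis using w s by (intro exI[of _ "r0 - w"]) auto
    qed
    then show ?case using s by blast
  qed simp
next
  assume U: "U \<subseteq> X \<and> (\<forall>x\<in>U. \<exists>r>0. {y \<in> X. d x y < ennreal r} \<subseteq> U)"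
  show "openin (forward_topology X d) U"
  proof (subst openin_subopen, intro ballI)
    fix x assume x: "x \<in> U"
    then obtain r where r: "r > 0" "{y \<in> X. d x y < ennreal r} \<subseteq> U" using U by blast
    have "openin (forward_topology X d) {y \<in> X. d x y < ennreal r}"
      unfolding forward_topology_def by (rule topology_generated_by_Basis) (use U x r in auto)
    moreover have "x \<in> {y \<in> X. d x y < ennreal r}"
      using ps U x r by (auto simp: pseudo_semimetric_def)
    ultimately show "\<exists>T. openin (forward_topology X d) T \<and> x \<in> T \<and> T \<subseteq> U" using r by blast
  qed
qed

lemma topspace_forward_topology:
  assumes "pseudo_semimetric X d"
  shows "topspace (forward_topology X d) = X"
proof (rule antisym)
  have "openin (forward_topology X d) X"
    unfolding openin_forward_topology[OF assms] using zero_less_one by blast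
  then show "X \<subseteq> topspace (forward_topology X d)" by (rule openin_subset)
  show "topspace (forward_topology X d) \<subseteq> X"
    using openin_topspace[of "forward_topology X d"] unfolding openin_forward_topology[OF assms] by blast
qed

lemma continuous_map_forward_topology:
  assumes psI: "pseudo_semimetric I e" and ps: "pseudo_semimetric X d"
  shows "continuous_map (forward_topology I e) (forward_topology X d) c \<longleftrightarrow> c ` I \<subseteq> X \<and>
    (\<forall>t\<in>I. \<forall>r>0. \<exists>q>0. \<forall>u\<in>I. e t u < ennreal q \<longrightarrow> d (c t) (c u) < ennreal r)"
    (is "?L \<longleftrightarrow> ?R")
proof
  assume L: ?L
  have cX: "c ` I \<subseteq> X"
    using continuous_map_image_subset_topspace[OF L] by (simp add: topspace_forward_topology psI ps)
  moreover have "\<exists>q>0. \<forall>u\<in>I. e t u < ennreal q \<longrightarrow> d (c t) (c u) < ennreal r"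
    if t: "t \<in> I" and r: "0 < r" for t r
  proof -
    have ct: "c t \<in> X" using cX t by blast
    have "openin (forward_topology X d) {y \<in> X. d (c t) y < ennreal r}"
      unfolding forward_topology_def by (rule topology_generated_by_Basis) (use ct r in auto)
    from openin_continuous_map_preimage[OF L this]
    have "openin (forward_topology I e) {u \<in> I. c u \<in> X \<and> d (c t) (c u) < ennreal r}"
      by (simp add: topspace_forward_topology psI)
    moreover have "t \<in> {u \<in> I. c u \<in> X \<and> d (c t) (c u) < ennreal r}"
      using ps t ct r by (simp add: pseudo_semimetric_def)
    ultimately show ?thesis unfolding openin_forward_topology[OF psI] by blast
  qed
  ultimately show ?R by blast
next
  assume R: ?R
  have "openin (forward_topology I e) {t \<in> I. c t \<in> U}" if U: "openin (forward_topology X d) U" for U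
    unfolding openin_forward_topology[OF psI]
  proof (intro conjI ballI)
    fix t assume t: "t \<in> {t \<in> I. c t \<in> U}"
    have "\<forall>x\<in>U. \<exists>r>0. {y \<in> X. d x y < ennreal r} \<subseteq> U"
      using U unfolding openin_forward_topology[OF ps] by (rule conjunct2)
    then obtain r where r: "0 < r" "{y \<in> X. d (c t) y < ennreal r} \<subseteq> U" using t by auto
    obtain q where q: "0 < q" "\<forall>u\<in>I. e t u < ennreal q \<longrightarrow> d (c t) (c u) < ennreal r" using R t r(1) by blast
    have "c u \<in> U" if "u \<in> I" "e t u < ennreal q" for u using that q r(2) R by auto
    then show "\<exists>q>0. {u \<in> I. e t u < ennreal q} \<subseteq> {t \<in> I. c t \<in> U}" using q(1) by auto
  qed simp
  moreover have "c \<in> I \<rightarrow> X" using R by auto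
  ultimately show ?L
    by (simp add: continuous_map_def topspace_forward_topology psI ps)
qed

text \<open>The topologies that the semimetric of the reals induces on an interval are those of half-open
  intervals. Hence continuity in both senses only compares \<open>c t\<close> with later values from \<open>c t\<close> and with
  earlier values to \<open>c t\<close>.\<close>
definition one_sided_cont_on :: "real set \<Rightarrow> 'a set \<Rightarrow> ('a \<Rightarrow> 'a \<Rightarrow> ennreal) \<Rightarrow> (real \<Rightarrow> 'a) \<Rightarrow> bool" where
  "one_sided_cont_on I X d c \<longleftrightarrow> c ` I \<subseteq> X \<and> (\<forall>t\<in>I. \<forall>r>0. \<exists>e>0.
     (\<forall>u\<in>I. t \<le> u \<and> u < t + e \<longrightarrow> d (c t) (c u) < ennreal r) \<and>
     (\<forall>u\<in>I. t - e < u \<and> u \<le> t \<longrightarrow> d (c u) (c t) < ennreal r))"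

lemma one_sided_cont_onD:
  assumes "one_sided_cont_on I X d c" "t \<in> I" "0 < r"
  shows "\<exists>e>0. (\<forall>u\<in>I. t \<le> u \<and> u < t + e \<longrightarrow> d (c t) (c u) < ennreal r) \<and>
     (\<forall>u\<in>I. t - e < u \<and> u \<le> t \<longrightarrow> d (c u) (c t) < ennreal r)"
  using assms unfolding one_sided_cont_on_def by blast

lemma bicontinuous_on_iff:
  assumes ps: "pseudo_semimetric X d"
  shows "bicontinuous_on I X d c \<longleftrightarrow> one_sided_cont_on I X d c"
proof -
  have psI: "pseudo_semimetric I real_semimetric"
    by (auto simp: pseudo_semimetric_def real_semimetric_def simp flip: ennreal_plus)
  have near: "real_semimetric t u < ennreal q \<longleftrightarrow> t \<le> u \<and> u < t + q" if "0 < q" for t u q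
    using that by (auto simp: real_semimetric_def ennreal_less_iff)
  have near': "real_semimetric u t < ennreal q \<longleftrightarrow> t - q < u \<and> u \<le> t" if "0 < q" for t u q
    using that by (auto simp: real_semimetric_def ennreal_less_iff)
  have "bicontinuous_on I X d c \<longleftrightarrow> c ` I \<subseteq> X \<and>
    (\<forall>t\<in>I. \<forall>r>0. \<exists>q>0. \<forall>u\<in>I. real_semimetric t u < ennreal q \<longrightarrow> d (c t) (c u) < ennreal r) \<and>
    (\<forall>t\<in>I. \<forall>r>0. \<exists>q>0. \<forall>u\<in>I. real_semimetric u t < ennreal q \<longrightarrow> d (c u) (c t) < ennreal r)"
    unfolding bicontinuous_on_def backward_topology_eq continuous_map_forward_topology[OF psI ps]
      continuous_map_forward_topology[OF pseudo_semimetric_reversed[OF psI] pseudo_semimetric_reversed[OF ps]] reversed_def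
    by blast
  also have "\<dots> \<longleftrightarrow> one_sided_cont_on I X d c"
  proof
    assume h: "c ` I \<subseteq> X \<and>
      (\<forall>t\<in>I. \<forall>r>0. \<exists>q>0. \<forall>u\<in>I. real_semimetric t u < ennreal q \<longrightarrow> d (c t) (c u) < ennreal r) \<and>
      (\<forall>t\<in>I. \<forall>r>0. \<exists>q>0. \<forall>u\<in>I. real_semimetric u t < ennreal q \<longrightarrow> d (c u) (c t) < ennreal r)"
    show "one_sided_cont_on I X d c"
      unfolding one_sided_cont_on_def
    proof (intro conjI ballI allI impI)
      fix t r assume t: "t \<in> I" and r: "(0::real) < r"
      obtain q where q: "0 < q" "\<forall>u\<in>I. real_semimetric t u < ennreal q \<longrightarrow> d (c t) (c u) < ennreal r"
        using h t r by blast
      obtain q' where q': "0 < q'" "\<forall>u\<in>I. real_semimetric u t < ennreal q' \<longrightarrow> d (c u) (c t) < ennreal r"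
        using h t r by blast
      show "\<exists>e>0. (\<forall>u\<in>I. t \<le> u \<and> u < t + e \<longrightarrow> d (c t) (c u) < ennreal r) \<and>
          (\<forall>u\<in>I. t - e < u \<and> u \<le> t \<longrightarrow> d (c u) (c t) < ennreal r)"
      proof (intro exI[of _ "min q q'"] conjI ballI impI)
        fix u assume u: "u \<in> I"
        show "d (c t) (c u) < ennreal r" if "t \<le> u \<and> u < t + min q q'"
          using q(2)[rule_format, OF u] near[OF q(1), of t u] that min.cobounded1[of q q'] by auto
        show "d (c u) (c t) < ennreal r" if "t - min q q' < u \<and> u \<le> t"
        proof -
          have "t - q' < u \<and> u \<le> t" using that min.cobounded2[of q q'] by linarith
          then show ?thesis using q'(2)[rule_format, OF u] near'[OF q'(1), of u t] by blast
        qed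
      qed (use q q' in simp)
    qed (use h in blast)
  next
    assume h: "one_sided_cont_on I X d c"
    have *: "\<exists>q>0. \<forall>u\<in>I. real_semimetric t u < ennreal q \<longrightarrow> d (c t) (c u) < ennreal r"
      "\<exists>q>0. \<forall>u\<in>I. real_semimetric u t < ennreal q \<longrightarrow> d (c u) (c t) < ennreal r"
      if tr: "t \<in> I" "0 < r" for t r
    proof -
      obtain q where q: "0 < q" "\<forall>u\<in>I. t \<le> u \<and> u < t + q \<longrightarrow> d (c t) (c u) < ennreal r"
        "\<forall>u\<in>I. t - q < u \<and> u \<le> t \<longrightarrow> d (c u) (c t) < ennreal r" using one_sided_cont_onD[OF h tr] by blast
      show "\<exists>q>0. \<forall>u\<in>I. real_semimetric t u < ennreal q \<longrightarrow> d (c t) (c u) < ennreal r"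
      proof (rule exI[of _ q], rule conjI[OF q(1)])
        show "\<forall>u\<in>I. real_semimetric t u < ennreal q \<longrightarrow> d (c t) (c u) < ennreal r"
          unfolding near[OF q(1)] by (rule q(2))
      qed
      show "\<exists>q>0. \<forall>u\<in>I. real_semimetric u t < ennreal q \<longrightarrow> d (c u) (c t) < ennreal r"
      proof (rule exI[of _ q], rule conjI[OF q(1)])
        show "\<forall>u\<in>I. real_semimetric u t < ennreal q \<longrightarrow> d (c u) (c t) < ennreal r"
          unfolding near'[OF q(1)] by (rule q(3))
      qed
    qed
    show "c ` I \<subseteq> X \<and>
      (\<forall>t\<in>I. \<forall>r>0. \<exists>q>0. \<forall>u\<in>I. real_semimetric t u < ennreal q \<longrightarrow> d (c t) (c u) < ennreal r) \<and>
      (\<forall>t\<in>I. \<forall>r>0. \<exists>q>0. \<forall>u\<in>I. real_semimetric u t < ennreal q \<longrightarrow> d (c u) (c t) < ennreal r)"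
    proof (intro conjI ballI allI impI)
      show "c ` I \<subseteq> X" using h unfolding one_sided_cont_on_def by (rule conjunct1)
    qed (rule *; assumption)+
  qed
  finally show ?thesis .
qed

lemma telescoping_triangle:
  fixes m n :: nat
  assumes "pseudo_semimetric X d" "m \<le> n" "\<And>i. m \<le> i \<Longrightarrow> i \<le> n \<Longrightarrow> z i \<in> X"
  shows "d (z m) (z n) \<le> (\<Sum>i\<in>{m<..n}. d (z (i - 1)) (z i))"
  using assms(2,3)
proof (induction n rule: dec_induct)
  case base
  then show ?case using assms(1) by (simp add: pseudo_semimetric_def)
next
  case (step n)
  have "d (z m) (z (Suc n)) \<le> d (z m) (z n) + d (z n) (z (Suc n))"
    using assms(1) step by (simp add: pseudo_semimetric_def)
  also have "\<dots> \<le> (\<Sum>i\<in>{m<..n}. d (z (i - 1)) (z i)) + d (z n) (z (Suc n))"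
    using step by (intro add_right_mono) simp
  also have "\<dots> = (\<Sum>i\<in>{m<..Suc n}. d (z (i - 1)) (z i))"
  proof -
    have "{m<..Suc n} = insert (Suc n) {m<..n}" using step by auto
    then show ?thesis by (simp add: add.commute)
  qed
  finally show ?case .
qed

abbreviation grid :: "real \<Rightarrow> real \<Rightarrow> nat \<Rightarrow> nat \<Rightarrow> real" where
  "grid a b N i \<equiv> a + real i * (b - a) / real N"

text \<open>The first grid point after \<open>s\<close> and the last one before \<open>t\<close> converge to \<open>s\<close> and \<open>t\<close> from inside, which
  is the side on which continuity bounds \<open>d(c(s), \<cdot>)\<close> and \<open>d(\<cdot>, c(t))\<close>.\<close>
lemma grid_sum_between:
  assumes ps: "pseudo_semimetric X d" and c: "one_sided_cont_on {a..b} X d c"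
    and st: "a \<le> s" "s \<le> t" "t \<le> b" and ab: "a < b" and \<eta>: "\<eta> > 0"
  shows "\<forall>\<^sub>F N in sequentially. d (c s) (c t)
     \<le> (\<Sum>i\<in>{i\<in>{1..N}. s \<le> grid a b N (i - 1) \<and> grid a b N i \<le> t}.
          d (c (grid a b N (i - 1))) (c (grid a b N i))) + ennreal \<eta>"
proof (cases "s = t")
  case True
  have "c s \<in> X" using c st by (auto simp: one_sided_cont_on_def)
  then have "d (c s) (c t) = 0"
    using ps True by (simp add: pseudo_semimetric_def)
  then show ?thesis by simp
next
  case False
  have cX: "c u \<in> X" if "u \<in> {a..b}" for u using c that by (auto simp: one_sided_cont_on_def)
  have sI: "s \<in> {a..b}" and tI: "t \<in> {a..b}" and \<eta>2: "0 < \<eta> / 2" using st \<eta> by auto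
  obtain e1 where e1: "e1 > 0" "\<forall>u\<in>{a..b}. s \<le> u \<and> u < s + e1 \<longrightarrow> d (c s) (c u) < ennreal (\<eta> / 2)"
    using one_sided_cont_onD[OF c sI \<eta>2] by blast
  obtain e2 where e2: "e2 > 0" "\<forall>u\<in>{a..b}. t - e2 < u \<and> u \<le> t \<longrightarrow> d (c u) (c t) < ennreal (\<eta> / 2)"
    using one_sided_cont_onD[OF c tI \<eta>2] by blast
  define e where "e = min (min e1 e2) ((t - s) / 2)"
  have e: "e > 0" using e1 e2 st False by (simp add: e_def)
  have "(\<lambda>N. (b - a) / real N) \<longlonglongrightarrow> 0" by (rule lim_const_over_n)
  then have "\<forall>\<^sub>F N in sequentially. (b - a) / real N < e"
    using e by (rule order_tendstoD)
  moreover have "\<forall>\<^sub>F N in sequentially. (0::nat) < N" by (rule eventually_gt_at_top)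
  ultimately show ?thesis
  proof eventually_elim
    case (elim N)
    define h where "h = (b - a) / real N"
    have h: "0 < h" "h < e" using elim ab by (auto simp: h_def)
    have G: "grid a b N i = a + real i * h" for i by (simp add: h_def)
    define i0 where "i0 = nat \<lceil>(s - a) / h\<rceil>"
    define i1 where "i1 = nat \<lfloor>(t - a) / h\<rfloor>"
    have sa: "0 \<le> (s - a) / h" "0 \<le> (t - a) / h" using h st by auto
    have "real i0 = of_int \<lceil>(s - a) / h\<rceil>"
      using sa by (simp add: i0_def)
    then have r0: "(s - a) / h \<le> real i0" "real i0 < (s - a) / h + 1" by linarith+
    have "real i1 = of_int \<lfloor>(t - a) / h\<rfloor>" using sa by (simp add: i1_def)
    then have r1: "real i1 \<le> (t - a) / h" "(t - a) / h < real i1 + 1" by linarith+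
    have g0: "s \<le> grid a b N i0" "grid a b N i0 < s + h"
      using r0 h unfolding G by (simp_all add: field_simps)
    have g1: "grid a b N i1 \<le> t" "t - h < grid a b N i1"
      using r1 h unfolding G by (simp_all add: field_simps)
    have "h < (t - s) / 2" using h by (simp add: e_def)
    then have "s + h < t - h" by (simp add: field_simps)
    with g0(2) have "grid a b N i0 < t - h" by (rule less_trans)
    also note g1(2)
    finally have "grid a b N i0 < grid a b N i1" .
    then have "real i0 * h < real i1 * h" unfolding G by simp
    then have i01: "i0 < i1" using h by simp
    have "real i1 * h \<le> real N * h"
    proof -
      have "real N * h = b - a" using elim by (simp add: h_def)
      then show ?thesis using g1 st unfolding G by simp
    qed
    then have i1N: "i1 \<le> N" using h by simp
    have gmono: "grid a b N i \<le> grid a b N j" if "i \<le> j" for i j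
      using that h unfolding G by (simp add: mult_right_mono)
    have gab: "grid a b N i \<in> {a..b}" if "i0 \<le> i" "i \<le> i1" for i
      using gmono[OF that(1)] gmono[OF that(2)] g0 g1 st by auto
    have "d (c s) (c t) \<le> d (c s) (c (grid a b N i0)) + d (c (grid a b N i0)) (c t)"
      using ps cX st gab[of i0] i01 unfolding pseudo_semimetric_def by auto
    also have "d (c (grid a b N i0)) (c t)
        \<le> d (c (grid a b N i0)) (c (grid a b N i1)) + d (c (grid a b N i1)) (c t)"
      using ps cX st gab[of i0] gab[of i1] i01 unfolding pseudo_semimetric_def by auto
    also have "d (c (grid a b N i0)) (c (grid a b N i1))
        \<le> (\<Sum>i\<in>{i0<..i1}. d (c (grid a b N (i - 1))) (c (grid a b N i)))"
      by (rule telescoping_triangle[OF ps]) (use i01 gab cX in auto)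
    also have "\<dots> \<le> (\<Sum>i\<in>{i\<in>{1..N}. s \<le> grid a b N (i - 1) \<and> grid a b N i \<le> t}.
          d (c (grid a b N (i - 1))) (c (grid a b N i)))" (is "_ \<le> ?S")
    proof (rule sum_mono2)
      show "{i0<..i1} \<subseteq> {i\<in>{1..N}. s \<le> grid a b N (i - 1) \<and> grid a b N i \<le> t}"
      proof
        fix i assume i: "i \<in> {i0<..i1}"
        then have "i0 \<le> i - 1" "i \<le> i1" by auto
        from gmono[OF this(1)] gmono[OF this(2)] show "i \<in> {i\<in>{1..N}. s \<le> grid a b N (i - 1) \<and> grid a b N i \<le> t}"
          using i i1N g0 g1 by auto
      qed
    qed auto
    also have "d (c s) (c (grid a b N i0)) \<le> ennreal (\<eta> / 2)"
      using e1 g0 h gab[of i0] i01 by (auto simp: e_def intro!: less_imp_le)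
    also have "d (c (grid a b N i1)) (c t) \<le> ennreal (\<eta> / 2)"
      using e2 g1 h gab[of i1] i01 by (auto simp: e_def intro!: less_imp_le)
    finally have "d (c s) (c t) \<le> ennreal (\<eta> / 2) + (?S + ennreal (\<eta> / 2))"
      by (simp add: add_mono add_left_mono)
    also have "\<dots> = ?S + ennreal \<eta>"
      using \<eta> by (simp add: add.left_commute flip: ennreal_plus)
    finally show ?case .
  qed
qed

text \<open>The grid steps inside different intervals of the partition are different, so the estimates for the
  single intervals add up.\<close>
lemma partition_sum_le_grid_sum:
  fixes u :: "nat \<Rightarrow> real"
  assumes ps: "pseudo_semimetric X d" and c: "one_sided_cont_on {a..b} X d c" and ab: "a < b"
    and u: "a \<le> u 0" "u k \<le> b" "\<And>l. l < k \<Longrightarrow> u l \<le> u (Suc l)" and \<eta>: "\<eta> > 0"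
  shows "\<forall>\<^sub>F N in sequentially. (\<Sum>l<k. d (c (u l)) (c (u (Suc l))))
     \<le> (\<Sum>i=1..N. d (c (grid a b N (i - 1))) (c (grid a b N i))) + ennreal \<eta>"
proof (cases "k = 0")
  case False
  have mono: "u l \<le> u m" if "l \<le> m" "m \<le> k" for l m
    using that
  proof (induction m rule: dec_induct)
    case (step m)
    then show ?case using u(3)[of m] by simp
  qed simp
  define J where "J N l = {i\<in>{1..N}. u l \<le> grid a b N (i - 1) \<and> grid a b N i \<le> u (Suc l)}" for N l
  let ?s = "\<lambda>N i. d (c (grid a b N (i - 1))) (c (grid a b N i))"
  have "\<forall>\<^sub>F N in sequentially. \<forall>l\<in>{..<k}. d (c (u l)) (c (u (Suc l))) \<le> sum (?s N) (J N l) + ennreal (\<eta> / k)"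
  proof (rule eventually_ball_finite, simp, intro ballI)
    fix l assume l: "l \<in> {..<k}"
    show "\<forall>\<^sub>F N in sequentially. d (c (u l)) (c (u (Suc l))) \<le> sum (?s N) (J N l) + ennreal (\<eta> / k)"
      unfolding J_def
    proof (rule grid_sum_between[OF ps c _ _ _ ab])
      show "a \<le> u l" using mono[of 0 l] l u by auto
      show "u (Suc l) \<le> b" using mono[of "Suc l" k] l u by auto
      show "0 < \<eta> / k" using False \<eta> by simp
    qed (use l u in auto)
  qed
  then show ?thesis
  proof eventually_elim
    case (elim N)
    have disj: "J N l \<inter> J N m = {}" if "l < m" "m < k" for l m
    proof (rule ccontr)
      assume "J N l \<inter> J N m \<noteq> {}"
      then obtain i where i: "i \<in> {1..N}" "grid a b N i \<le> u (Suc l)" "u m \<le> grid a b N (i - 1)"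
        unfolding J_def by blast
      have "u (Suc l) \<le> u m" using mono that by simp
      moreover have "real (i - 1) * (b - a) / real N < real i * (b - a) / real N"
        using i ab by (intro divide_strict_right_mono mult_strict_right_mono) auto
      ultimately show False using i by (meson add_strict_left_mono leD le_less_trans order_trans)
    qed
    have "(\<Sum>l<k. d (c (u l)) (c (u (Suc l)))) \<le> (\<Sum>l<k. sum (?s N) (J N l) + ennreal (\<eta> / k))"
      by (rule sum_mono) (use elim in auto)
    also have "\<dots> = (\<Sum>l<k. sum (?s N) (J N l)) + ennreal \<eta>"
      using False \<eta> by (simp add: sum.distrib ennreal_of_nat_eq_real_of_nat flip: ennreal_mult)
    also have "(\<Sum>l<k. sum (?s N) (J N l)) = sum (?s N) (\<Union>l<k. J N l)"
    proof (rule sum.UNION_disjoint[symmetric])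
      show "\<forall>i\<in>{..<k}. \<forall>j\<in>{..<k}. i \<noteq> j \<longrightarrow> J N i \<inter> J N j = {}"
        using disj by (metis Int_commute lessThan_iff linorder_neqE_nat)
    qed (auto simp: J_def)
    also have "sum (?s N) (\<Union>l<k. J N l) + ennreal \<eta> \<le> sum (?s N) {1..N} + ennreal \<eta>"
      by (intro add_right_mono sum_mono2) (auto simp: J_def)
    finally show ?case .
  qed
qed simp

text \<open>The preceding lemma, applied to uniform partitions, shows that the upper limit of the grid sums is at
  most their lower limit. So the limit in the definition of the length exists, and it bounds the sum
  over any partition.\<close>
lemma partition_sum_le_path_len:
  fixes u :: "nat \<Rightarrow> real"
  assumes ps: "pseudo_semimetric X d" and c: "one_sided_cont_on {a..b} X d c" and ab: "a < b"
    and u: "a \<le> u 0" "u k \<le> b" "\<And>l. l < k \<Longrightarrow> u l \<le> u (Suc l)"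
  shows "(\<Sum>l<k. d (c (u l)) (c (u (Suc l)))) \<le> path_len d (DPath a b c)"
proof -
  define S where "S N = (\<Sum>i=1..N. d (c (grid a b N (i - 1))) (c (grid a b N i)))" for N
  have low: "(\<Sum>l<k. d (c (u l)) (c (u (Suc l)))) \<le> liminf S"
    if "a \<le> u 0" "u k \<le> b" "\<And>l. l < k \<Longrightarrow> u l \<le> u (Suc l)" for u :: "nat \<Rightarrow> real" and k
    unfolding le_Liminf_iff
  proof (intro allI impI)
    let ?U = "\<Sum>l<k. d (c (u l)) (c (u (Suc l)))"
    fix y assume y: "y < ?U"
    have "\<exists>\<eta>>0. y + ennreal \<eta> < ?U"
    proof (rule ccontr)
      assume neg: "\<not> ?thesis"
      have le: "?U \<le> y + ennreal \<eta>" if "\<eta> > 0" for \<eta>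
      proof (rule leI, rule notI)
        assume "y + ennreal \<eta> < ?U"
        with neg that show False by blast
      qed
      have "?U \<le> y" by (rule ennreal_le_epsilon) (rule le)
      from leD[OF this] y show False ..
    qed
    then obtain \<eta> where \<eta>: "\<eta> > 0" "y + ennreal \<eta> < ?U" by blast
    have "\<forall>\<^sub>F N in sequentially. ?U \<le> S N + ennreal \<eta>"
      unfolding S_def by (rule partition_sum_le_grid_sum[OF ps c ab that \<eta>(1)])
    then show "\<forall>\<^sub>F N in sequentially. y < S N"
    proof eventually_elim
      case (elim N)
      with \<eta>(2) have "y + ennreal \<eta> < S N + ennreal \<eta>" by (rule less_le_trans)
      show ?case
      proof (rule ccontr)
        assume "\<not> y < S N"
        then have "S N + ennreal \<eta> \<le> y + ennreal \<eta>" by (intro add_right_mono leI)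
        from leD[OF this] \<open>y + ennreal \<eta> < S N + ennreal \<eta>\<close> show False ..
      qed
    qed
  qed
  have "limsup S \<le> liminf S"
  proof (rule Limsup_bounded)
    have "\<forall>\<^sub>F N in sequentially. (0::nat) < N" by (rule eventually_gt_at_top)
    then show "\<forall>\<^sub>F N in sequentially. S N \<le> liminf S"
    proof eventually_elim
      case (elim N)
      have "S N = (\<Sum>l<N. d (c (grid a b N l)) (c (grid a b N (Suc l))))"
        unfolding S_def by (simp only: One_nat_def sum.atLeast1_atMost_eq diff_Suc_Suc diff_zero)
      also have "\<dots> \<le> liminf S"
      proof (rule low)
        show "grid a b N l \<le> grid a b N (Suc l)" for l
          using ab by (simp add: divide_right_mono mult_right_mono)
      qed (use elim ab in auto)
      finally show ?case .
    qed
  qed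
  moreover have "liminf S \<le> limsup S" by (rule Liminf_le_Limsup) simp
  ultimately have "S \<longlonglongrightarrow> liminf S" by (intro Liminf_eq_Limsup) auto
  then have "lim S = liminf S" by (rule limI)
  moreover have "path_len d (DPath a b c) = lim S"
    by (simp add: path_len_def S_def[abs_def] partition_point_def)
  ultimately show ?thesis using low[OF u] by simp
qed

lemma dist_le_path_len:
  assumes ps: "pseudo_semimetric X d" and c: "one_sided_cont_on {a..b} X d c" and "a < b"
  shows "d (c a) (c b) \<le> path_len d (DPath a b c)"
proof -
  define u where "u l = (if l = 0 then a else b)" for l :: nat
  have "(\<Sum>l<1. d (c (u l)) (c (u (Suc l)))) \<le> path_len d (DPath a b c)"
    by (rule partition_sum_le_path_len[OF assms]) (use \<open>a < b\<close> in \<open>auto simp: u_def\<close>)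
  then show ?thesis by (simp add: u_def)
qed

lemma one_sided_cont_on_subset: "one_sided_cont_on I X d c \<Longrightarrow> J \<subseteq> I \<Longrightarrow> one_sided_cont_on J X d c"
  unfolding one_sided_cont_on_def by (meson image_mono order_trans subsetD)

text \<open>Near a point \<open>x\<close> of the interval, a step across \<open>x\<close> consists of a part that ends at \<open>c x\<close> and a part that
  starts there, both short. Bolzano's bisection principle extends this to the whole interval.\<close>
lemma short_steps:
  assumes ps: "pseudo_semimetric X d" and c: "one_sided_cont_on I X d c" and I: "{a..b} \<subseteq> I" and ab: "a \<le> b"
  shows "\<exists>n u. u 0 = a \<and> u n = b \<and> (\<forall>l<n. u l \<le> u (Suc l) \<and> d (c (u l)) (c (u (Suc l))) \<le> ennreal 2)"
proof -
  define Q where "Q s t \<longleftrightarrow> (\<exists>n u. u 0 = s \<and> u n = t \<and>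
     (\<forall>l<n. u l \<le> u (Suc l) \<and> d (c (u l)) (c (u (Suc l))) \<le> ennreal 2))" for s t
  define P where "P s t \<longleftrightarrow> (s \<in> {a..b} \<longrightarrow> t \<in> {a..b} \<longrightarrow> s \<le> t \<longrightarrow> Q s t)" for s t
  have trans: "Q s v" if Q: "Q s t" "Q t v" for s t v
  proof -
    obtain n u where u: "u 0 = s" "u n = t"
      "\<And>l. l < n \<Longrightarrow> u l \<le> u (Suc l) \<and> d (c (u l)) (c (u (Suc l))) \<le> ennreal 2"
      using Q(1) unfolding Q_def by blast
    obtain m w where w: "w 0 = t" "w m = v"
      "\<And>l. l < m \<Longrightarrow> w l \<le> w (Suc l) \<and> d (c (w l)) (c (w (Suc l))) \<le> ennreal 2"
      using Q(2) unfolding Q_def by blast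
    define x where "x l = (if l \<le> n then u l else w (l - n))" for l
    have "x l \<le> x (Suc l) \<and> d (c (x l)) (c (x (Suc l))) \<le> ennreal 2" if l: "l < n + m" for l
    proof -
      consider "l < n" | "l = n" | "n < l" by linarith
      then show ?thesis
      proof cases
        case 2
        then show ?thesis using w(3)[of 0] w(1) u(2) l by (auto simp: x_def)
      next
        case 3
        then have "Suc l - n = Suc (l - n)" by simp
        then show ?thesis using w(3)[of "l - n"] l 3 by (auto simp: x_def)
      qed (use u in \<open>auto simp: x_def\<close>)
    qed
    moreover have "x 0 = s" "x (n + m) = v" using u w by (auto simp: x_def)
    ultimately show ?thesis unfolding Q_def by blast
  qed
  have "P a b"
  proof (rule Bolzano)
    show "a \<le> b" by (rule ab)
  next
    fix r s t assume rst: "P r s" "P s t" "r \<le> s" "s \<le> t"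
    show "P r t" unfolding P_def
    proof (intro impI)
      assume "r \<in> {a..b}" "t \<in> {a..b}"
      then show "Q r t" using rst trans[of r s t] by (auto simp: P_def)
    qed
  next
    fix x assume x: "a \<le> x" "x \<le> b"
    then have "x \<in> I" using I by auto
    from one_sided_cont_onD[OF c this zero_less_one] obtain e where e: "e > 0"
      "\<forall>u\<in>I. x \<le> u \<and> u < x + e \<longrightarrow> d (c x) (c u) < ennreal 1"
      "\<forall>u\<in>I. x - e < u \<and> u \<le> x \<longrightarrow> d (c u) (c x) < ennreal 1" by blast
    have "P s t" if "s \<le> x" "x \<le> t" "t - s < e" for s t
      unfolding P_def
    proof (intro impI)
      assume st: "s \<in> {a..b}" "t \<in> {a..b}" "s \<le> t"
      have stI: "s \<in> I" "t \<in> I" using st I by auto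
      then have X: "c s \<in> X" "c t \<in> X" "c x \<in> X" using c \<open>x \<in> I\<close> by (auto simp: one_sided_cont_on_def)
      have "d (c s) (c t) \<le> d (c s) (c x) + d (c x) (c t)"
        using ps X by (simp add: pseudo_semimetric_def)
      also have "\<dots> \<le> ennreal 1 + ennreal 1"
        using e stI that by (intro add_mono less_imp_le) auto
      also have "\<dots> = ennreal 2" by (simp flip: ennreal_plus)
      finally show "Q s t" unfolding Q_def
        using st by (intro exI[of _ 1] exI[of _ "\<lambda>l. if l = 0 then s else t"]) auto
    qed
    with e(1) show "\<exists>d>0. \<forall>s t. s \<le> x \<and> x \<le> t \<and> t - s < d \<longrightarrow> P s t" by blast
  qed
  then show ?thesis using ab by (auto simp: P_def Q_def)
qed

lemma path_dist_finite:
  assumes ps: "pseudo_semimetric X d" and c: "one_sided_cont_on I X d c" and I: "{a..b} \<subseteq> I" and ab: "a \<le> b"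
  shows "d (c a) (c b) < \<infinity>"
proof -
  from short_steps[OF assms] obtain n u where u: "u 0 = a" "u n = b"
    "\<And>l. l < n \<Longrightarrow> u l \<le> u (Suc l) \<and> d (c (u l)) (c (u (Suc l))) \<le> ennreal 2" by blast
  have mono: "u l \<le> u m" if "l \<le> m" "m \<le> n" for l m
    using that
  proof (induction m rule: dec_induct)
    case (step m)
    then show ?case using u(3)[of m] by simp
  qed simp
  have X: "c (u l) \<in> X" if "l \<le> n" for l
  proof -
    have "u l \<in> {a..b}" using mono[of 0 l] mono[of l n] that u by auto
    then have "u l \<in> I" using I by auto
    then show ?thesis using c unfolding one_sided_cont_on_def by blast
  qed
  have "d (c (u 0)) (c (u n)) \<le> (\<Sum>i\<in>{0<..n}. d (c (u (i - 1))) (c (u i)))"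
    by (rule telescoping_triangle[OF ps]) (use X in auto)
  also have "\<dots> < \<infinity>"
  proof -
    have "d (c (u (i - 1))) (c (u i)) < top" if "i \<in> {0<..n}" for i
    proof -
      have "d (c (u (i - 1))) (c (u i)) \<le> ennreal 2" using u(3)[of "i - 1"] that by auto
      also have "\<dots> < top" by simp
      finally show ?thesis .
    qed
    then show ?thesis by simp
  qed
  finally show ?thesis using u by simp
qed

section \<open>Triangles of segments\<close>

text \<open>Stating bounds on distances by real numbers keeps the arithmetic in the reals; a bound implies that both
  points lie in \<open>X\<close> and that the distance is finite.\<close>
definition reaches :: "'a set \<Rightarrow> ('a \<Rightarrow> 'a \<Rightarrow> ennreal) \<Rightarrow> 'a \<Rightarrow> 'a \<Rightarrow> real \<Rightarrow> bool" where
  "reaches X d x y r \<longleftrightarrow> x \<in> X \<and> y \<in> X \<and> 0 \<le> r \<and> d x y \<le> ennreal r"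

definition isom_geod :: "'a set \<Rightarrow> ('a \<Rightarrow> 'a \<Rightarrow> ennreal) \<Rightarrow> (real \<Rightarrow> 'a) \<Rightarrow> real \<Rightarrow> bool" where
  "isom_geod X d g D \<longleftrightarrow> 0 \<le> D \<and> g ` {0..D} \<subseteq> X \<and>
     (\<forall>s t. 0 \<le> s \<and> s \<le> t \<and> t \<le> D \<longrightarrow> d (g s) (g t) = ennreal (t - s))"

text \<open>A geodesic only matters through its set of points with the arc length parametrization, which
  identifies it with an isometric image of a real interval.\<close>
definition seg :: "'a set \<Rightarrow> ('a \<Rightarrow> 'a \<Rightarrow> ennreal) \<Rightarrow> 'a \<Rightarrow> 'a \<Rightarrow> 'a set \<Rightarrow> bool" where
  "seg X d x y A \<longleftrightarrow> (\<exists>g D. isom_geod X d g D \<and> g 0 = x \<and> g D = y \<and> A = g ` {0..D})"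

definition side :: "'a set \<Rightarrow> ('a \<Rightarrow> 'a \<Rightarrow> ennreal) \<Rightarrow> 'a \<Rightarrow> 'a \<Rightarrow> 'a set \<Rightarrow> bool" where
  "side X d x y A \<longleftrightarrow> seg X d x y A \<or> seg X d y x A"

lemma reaches_reversed [simp]: "reaches X (reversed d) x y r \<longleftrightarrow> reaches X d y x r"
  by (auto simp: reaches_def reversed_def)

lemma isom_geod_reverse:
  assumes "isom_geod X d g D"
  shows "isom_geod X (reversed d) (\<lambda>t. g (D - t)) D"
  using assms unfolding isom_geod_def reversed_def by auto

lemma seg_reversed_imp:
  assumes "seg X d x y A"
  shows "seg X (reversed d) y x A"
proof -
  obtain g D where g: "isom_geod X d g D" "g 0 = x" "g D = y" "A = g ` {0..D}"
    using assms by (auto simp: seg_def)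
  have "0 \<le> D" using g by (simp add: isom_geod_def)
  have "(\<lambda>t. g (D - t)) ` {0..D} = g ` ((-) D ` {0..D})" by (simp only: image_image)
  also have "(-) D ` {0..D} = {0..D}" by simp
  finally show ?thesis
    unfolding seg_def using isom_geod_reverse[OF g(1)] g
    by (intro exI[of _ "\<lambda>t. g (D - t)"] exI[of _ D]) auto
qed

lemma seg_reversed [simp]: "seg X (reversed d) x y A \<longleftrightarrow> seg X d y x A"
  using seg_reversed_imp[of X d y x A] seg_reversed_imp[of X "reversed d" x y A] by auto

lemma side_reversed [simp]: "side X (reversed d) x y A \<longleftrightarrow> side X d x y A"
  by (auto simp: side_def)

lemma side_commute: "side X d x y A \<longleftrightarrow> side X d y x A"
  by (auto simp: side_def)

text \<open>The properties of a hyperbolic space in terms of segments. Every assumption is invariant under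
  reversal of the distance, see \<open>reversed\<close> below.\<close>
locale thin_space =
  fixes X :: "'a set" and d :: "'a \<Rightarrow> 'a \<Rightarrow> ennreal" and \<delta> :: real and f :: "real \<Rightarrow> real"
  assumes delta: "0 \<le> \<delta>"
    and ps: "pseudo_semimetric X d"
    and geod: "x \<in> X \<Longrightarrow> y \<in> X \<Longrightarrow> d x y < \<infinity> \<Longrightarrow> \<exists>A. seg X d x y A"
    and thin: "seg X d x y P \<Longrightarrow> side X d x z Q \<Longrightarrow> side X d y z R \<Longrightarrow> p \<in> P \<Longrightarrow>
      (\<exists>q\<in>Q. reaches X d q p \<delta>) \<or> (\<exists>r\<in>R. reaches X d p r \<delta>)"
    and B1: "reaches X d x y r \<Longrightarrow> reaches X d x z r \<Longrightarrow> d y z < \<infinity> \<Longrightarrow> reaches X d y z (f r)"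
    and B2: "reaches X d y x r \<Longrightarrow> reaches X d z x r \<Longrightarrow> d y z < \<infinity> \<Longrightarrow> reaches X d y z (f r)"
begin

abbreviation "W \<equiv> reaches X d"
abbreviation "sg \<equiv> seg X d"
abbreviation "sd \<equiv> side X d"

lemma reversed: "thin_space X (reversed d) \<delta> f"
proof
  fix x y P z Q R p
  assume "seg X (reversed d) x y P" "side X (reversed d) x z Q" "side X (reversed d) y z R" "p \<in> P"
  then show "(\<exists>q\<in>Q. reaches X (reversed d) q p \<delta>) \<or> (\<exists>r\<in>R. reaches X (reversed d) p r \<delta>)"
    using thin[of y x P z R Q p] by auto
next
  show "pseudo_semimetric X (reversed d)"
    using pseudo_semimetric_reversed[OF ps] .
qed (use delta geod B1 B2 in \<open>auto simp: reversed_def\<close>)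

lemma W_D: "W x y r \<Longrightarrow> x \<in> X \<and> y \<in> X \<and> 0 \<le> r \<and> d x y < \<infinity>"
  by (auto simp: reaches_def less_top[symmetric] top_unique)

lemma W_refl: "x \<in> X \<Longrightarrow> 0 \<le> r \<Longrightarrow> W x x r"
  using ps by (simp add: reaches_def pseudo_semimetric_def)

lemma W_mono: "W x y r \<Longrightarrow> r \<le> r' \<Longrightarrow> W x y r'"
  by (auto simp: reaches_def elim: order_trans intro: ennreal_leI)

lemma W_trans:
  assumes "W x y r" "W y z r'"
  shows "W x z (r + r')"
proof -
  have "d x z \<le> d x y + d y z" using assms ps by (simp add: reaches_def pseudo_semimetric_def)
  also have "\<dots> \<le> ennreal r + ennreal r'" using assms by (intro add_mono) (auto simp: reaches_def)
  also have "\<dots> = ennreal (r + r')" using assms by (simp add: reaches_def)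
  finally show ?thesis using assms by (simp add: reaches_def)
qed

lemma seg_ex: "W x y r \<Longrightarrow> \<exists>A. sg x y A"
  using geod W_D by blast

lemma isom_W:
  assumes "isom_geod X d g D" "0 \<le> s" "s \<le> t" "t \<le> D"
  shows "W (g s) (g t) (t - s)"
  using assms by (auto simp: isom_geod_def reaches_def)

lemma isom_le:
  assumes "isom_geod X d g D" "0 \<le> s" "t \<le> D" "W (g s) (g t) r"
  shows "t - s \<le> r"
proof (cases "s \<le> t")
  case True
  then have "d (g s) (g t) = ennreal (t - s)" using assms by (auto simp: isom_geod_def)
  then show ?thesis using assms by (auto simp: reaches_def ennreal_le_iff)
qed (use assms W_D in force)

lemma isom_sub:
  assumes g: "isom_geod X d g D" and "0 \<le> s" "s \<le> t" "t \<le> D"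
  shows "sg (g s) (g t) (g ` {s..t})"
proof -
  have "isom_geod X d (\<lambda>u. g (s + u)) (t - s)"
    using assms by (auto simp: isom_geod_def)
  moreover have "g ` {s..t} = (\<lambda>u. g (s + u)) ` {0..t - s}"
  proof -
    have eq: "{s..t} = (+) s ` {0..t - s}" by simp
    show ?thesis unfolding eq image_image ..
  qed
  ultimately show ?thesis unfolding seg_def
    by (intro exI[of _ "\<lambda>u. g (s + u)"] exI[of _ "t - s"]) auto
qed

lemma segE:
  assumes "sg x y A"
  obtains g D where "isom_geod X d g D" "0 \<le> D" "g 0 = x" "g D = y" "A = g ` {0..D}"
  using assms by (auto simp: seg_def isom_geod_def)

lemma seg_const: "x \<in> X \<Longrightarrow> sg x x {x}"
  unfolding seg_def isom_geod_def using ps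
  by (intro exI[of _ "\<lambda>_. x"] exI[of _ 0]) (auto simp: pseudo_semimetric_def)

lemma seg_ends: "sg x y A \<Longrightarrow> x \<in> A \<and> y \<in> A"
  by (auto simp: seg_def isom_geod_def)

lemma seg_subset: "sg x y A \<Longrightarrow> u \<in> A \<Longrightarrow> u \<in> X"
  by (auto simp: seg_def isom_geod_def)

lemma side_ends: "sd x y A \<Longrightarrow> x \<in> A \<and> y \<in> A"
  using seg_ends by (auto simp: side_def)

text \<open>A point of a segment splits its length.\<close>
lemma seg_split:
  assumes "sg x y A" "u \<in> A" "W x y r"
  obtains s where "0 \<le> s" "s \<le> r" "W x u s" "W u y (r - s)"
proof -
  obtain g D where g: "isom_geod X d g D" "0 \<le> D" "g 0 = x" "g D = y" "A = g ` {0..D}"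
    using assms(1) by (rule segE)
  have D: "D \<le> r" using isom_le[OF g(1), of 0 D r] g assms by auto
  obtain s where s: "0 \<le> s" "s \<le> D" "u = g s" using assms(2) g by auto
  have "W x u s" using isom_W[OF g(1), of 0 s] s g by auto
  moreover have "W u y (r - s)" using isom_W[OF g(1), of s D] s g D by (auto intro: W_mono)
  ultimately show ?thesis using that[of s] s D by auto
qed

lemma seg_W: "sg x y A \<Longrightarrow> u \<in> A \<Longrightarrow> W x y r \<Longrightarrow> W x u r \<and> W u y r"
  by (erule (2) seg_split) (auto intro: W_mono)

lemma seg_W_ex:
  assumes "sg x y A" "u \<in> A"
  shows "\<exists>r. W x u r \<and> W u y r"
proof -
  obtain g D where g: "isom_geod X d g D" "0 \<le> D" "g 0 = x" "g D = y" "A = g ` {0..D}"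
    using assms(1) by (rule segE)
  have "W x y D" using isom_W[OF g(1), of 0 D] g by auto
  then show ?thesis using seg_W assms by blast
qed

lemma seg_W_ends: "sg x y A \<Longrightarrow> \<exists>r. W x y r"
  using seg_W_ex seg_ends by blast

text \<open>A point at distance more than \<open>l + \<delta>\<close> from \<open>a\<close> is not in the out-neighbourhood of a geodesic from \<open>a\<close> to \<open>c\<close>,
  so thinness moves it to \<open>R\<close> within \<open>\<delta>\<close>. Any other point first walks along \<open>P\<close> until it is such a point
  or reaches \<open>b\<close>.\<close>
lemma fan:
  assumes ac: "W a c l" and P: "sg a b P" and R: "sd b c R" and p: "p \<in> P" and \<eta>: "0 < \<eta>"
  shows "\<exists>r\<in>R. W p r (l + 2 * \<delta> + \<eta>)"
proof -
  obtain Q where Q: "sg a c Q" using seg_ex ac by blast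
  obtain g D where g: "isom_geod X d g D" "0 \<le> D" "g 0 = a" "g D = b" "P = g ` {0..D}"
    using P by (rule segE)
  obtain t0 where t0: "0 \<le> t0" "t0 \<le> D" "p = g t0" using p g by auto
  have l: "0 \<le> l" using ac W_D by blast
  have far: "\<exists>r\<in>R. W (g t) r \<delta>" if t: "l + \<delta> < t" "t \<le> D" for t
  proof -
    have t': "0 \<le> t" using t l delta by linarith
    then have "g t \<in> P" using g t by auto
    from thin[OF P _ R this, of Q] Q have "(\<exists>q\<in>Q. W q (g t) \<delta>) \<or> (\<exists>r\<in>R. W (g t) r \<delta>)"
      by (auto simp: side_def)
    moreover have "\<not> W q (g t) \<delta>" if "q \<in> Q" for q
    proof
      assume "W q (g t) \<delta>"
      then have "W a (g t) (l + \<delta>)" using seg_W[OF Q that ac] W_trans by blast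
      then show False using isom_le[OF g(1), of 0 t "l + \<delta>"] g t t' by auto
    qed
    ultimately show ?thesis by blast
  qed
  define t where "t = l + \<delta> + \<eta>"
  show ?thesis
  proof (cases "t < t0")
    case True
    then have "l + \<delta> < t0" using \<eta> by (simp add: t_def)
    then obtain r where r: "r \<in> R" "W p r \<delta>" using far[of t0] t0 by auto
    have "W p r (l + 2 * \<delta> + \<eta>)" using r(2) by (rule W_mono) (use l delta \<eta> in simp)
    then show ?thesis using r(1) by blast
  next
    case False
    show ?thesis
    proof (cases "t < D")
      case True
      then obtain r where r: "r \<in> R" "W (g t) r \<delta>" using far[of t] \<eta> by (auto simp: t_def)
      have "W p (g t) (t - t0)" using isom_W[OF g(1), of t0 t] t0 True False by auto
      from W_trans[OF this r(2)] have "W p r (l + 2 * \<delta> + \<eta>)"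
        by (rule W_mono) (use t0 in \<open>simp add: t_def\<close>)
      then show ?thesis using r by blast
    next
      case False
      have "W p b (D - t0)" using isom_W[OF g(1), of t0 D] t0 g by auto
      then have "W p b (l + 2 * \<delta> + \<eta>)"
        by (rule W_mono) (use t0 False delta in \<open>simp add: t_def\<close>)
      then show ?thesis using side_ends[OF R] by blast
    qed
  qed
qed

text \<open>Thinness of the side \<open>Q\<close> assigns to a point \<open>q\<close> of \<open>Q\<close> a point of \<open>P\<close> that reaches \<open>q\<close> within \<open>\<delta>\<close>, or a
  point of \<open>R\<close> that is reached from \<open>q\<close> within \<open>\<delta>\<close>. Follow \<open>Q\<close> in small steps as long as the first case
  occurs. If the assigned points of \<open>P\<close> jump over \<open>p\<close>, then two points of \<open>P\<close> on both sides of \<open>p\<close> reach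
  the same point of \<open>Q\<close>, and \<open>fan\<close> applies to them. If they stay before \<open>p\<close>, then the last of them reaches a
  point of \<open>R\<close>, and \<open>fan\<close> applies to the rest of \<open>P\<close>.\<close>
lemma out_close:
  assumes P: "sg x y P" and Q: "sg x z Q" and R: "sd y z R" and p: "p \<in> P" and \<eta>: "0 < \<eta>"
  shows "\<exists>u\<in>Q \<union> R. W p u (4 * \<delta> + \<eta>)"
proof -
  obtain g D where g: "isom_geod X d g D" "0 \<le> D" "g 0 = x" "g D = y" "P = g ` {0..D}"
    using P by (rule segE)
  obtain h E where h: "isom_geod X d h E" "0 \<le> E" "h 0 = x" "h E = z" "Q = h ` {0..E}"
    using Q by (rule segE)
  obtain t0 where t0: "0 \<le> t0" "t0 \<le> D" "p = g t0" using p g by auto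
  define \<zeta> where "\<zeta> = \<eta> / 2"
  have \<zeta>: "0 < \<zeta>" using \<eta> by (simp add: \<zeta>_def)
  obtain n where n: "E / \<zeta> < real n" using reals_Archimedean2 by blast
  have n0: "0 < n" using n h \<zeta> by (metis divide_nonneg_pos gr0I leD of_nat_0)
  define s where "s k = real k * (E / real n)" for k
  have s0: "s 0 = 0" and sn: "s n = E" using n0 by (auto simp: s_def)
  have s_step: "s (Suc k) - s k \<le> \<zeta>" for k
    using n n0 \<zeta> by (simp add: s_def field_simps)
  have s_mono: "s k \<le> s l" if "k \<le> l" for k l
    unfolding s_def using that h by (intro mult_right_mono) auto
  have s_in: "0 \<le> s k" "s k \<le> E" if "k \<le> n" for k using s_mono[of 0 k] s_mono[of k n] that s0 sn by auto
  have hstep: "W (h (s k)) (h (s (Suc k))) \<zeta>" if "k < n" for k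
    using isom_W[OF h(1), of "s k" "s (Suc k)"] s_in[of k] s_in[of "Suc k"] s_mono[of k "Suc k"]
      s_step[of k] that by (auto intro: W_mono)
  define A where "A k \<longleftrightarrow> (\<exists>t. 0 \<le> t \<and> t \<le> D \<and> W (g t) (h (s k)) \<delta>)" for k
  have xX: "x \<in> X" using P seg_ends seg_subset by blast
  have A0: "A 0" unfolding A_def using g s0 h W_refl[OF xX delta] by (intro exI[of _ 0]) auto
  have notA: "\<exists>r\<in>R. W (h (s k)) r \<delta>" if "\<not> A k" "k \<le> n" for k
  proof -
    have "h (s k) \<in> Q" using h s_in[OF that(2)] by auto
    moreover have "sd x y P" "sd z y R" using P R by (auto simp: side_def)
    ultimately have "(\<exists>q\<in>P. W q (h (s k)) \<delta>) \<or> (\<exists>r\<in>R. W (h (s k)) r \<delta>)"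
      using thin[OF Q] by blast
    moreover have "\<not> (\<exists>q\<in>P. W q (h (s k)) \<delta>)" using that g unfolding A_def by auto
    ultimately show ?thesis by blast
  qed
  \<comment> \<open>up to step \<open>m\<close>, all points of \<open>Q\<close> are reached from \<open>P\<close>\<close>
  define m where "m = (GREATEST k. k \<le> n \<and> (\<forall>j\<le>k. A j))"
  have ex: "0 \<le> n \<and> (\<forall>j\<le>0. A j)" using A0 by simp
  have m: "m \<le> n" "\<And>j. j \<le> m \<Longrightarrow> A j"
    using GreatestI_nat[where P = "\<lambda>k. k \<le> n \<and> (\<forall>j\<le>k. A j)" and b = n, OF ex] unfolding m_def by auto
  have m_max: "k \<le> m" if "k \<le> n" "\<forall>j\<le>k. A j" for k
    unfolding m_def by (rule Greatest_le_nat[where b = n]) (use that in auto)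
  have "\<forall>j. \<exists>t. j \<le> m \<longrightarrow> 0 \<le> t \<and> t \<le> D \<and> W (g t) (h (s j)) \<delta>"
    using m unfolding A_def by blast
  then obtain \<tau>' where \<tau>': "\<And>j. j \<le> m \<Longrightarrow> 0 \<le> \<tau>' j \<and> \<tau>' j \<le> D \<and> W (g (\<tau>' j)) (h (s j)) \<delta>" by metis
  \<comment> \<open>the start \<open>x\<close> of \<open>Q\<close> is assigned to itself, so the assigned points begin before \<open>p\<close>\<close>
  define \<tau> where "\<tau> j = (if j = 0 then 0 else \<tau>' j)" for j
  have \<tau>: "0 \<le> \<tau> j \<and> \<tau> j \<le> D \<and> W (g (\<tau> j)) (h (s j)) \<delta>" if "j \<le> m" for j
    using \<tau>'[OF that] g h s0 W_refl[OF xX delta] by (auto simp: \<tau>_def)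
  show ?thesis
  proof (cases "\<exists>j\<le>m. t0 \<le> \<tau> j")
    case True
    define j where "j = (LEAST j. j \<le> m \<and> t0 \<le> \<tau> j)"
    have j: "j \<le> m" "t0 \<le> \<tau> j" using True LeastI_ex[of "\<lambda>j. j \<le> m \<and> t0 \<le> \<tau> j"] by (auto simp: j_def)
    show ?thesis
    proof (cases j)
      case 0
      then have "p = x" using j t0 g by (auto simp: \<tau>_def)
      then show ?thesis using seg_ends[OF Q] W_refl[OF xX] delta \<eta> by (metis UnI1 add_nonneg_pos less_imp_le mult_nonneg_nonneg zero_le_numeral)
    next
      case (Suc i)
      then have "\<not> (i \<le> m \<and> t0 \<le> \<tau> i)" using not_less_Least[of i "\<lambda>j. j \<le> m \<and> t0 \<le> \<tau> j"] by (simp add: j_def)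
      then have i: "i \<le> m" "\<tau> i < t0" using j Suc by auto
      have ac: "W (g (\<tau> i)) (h (s j)) (\<delta> + \<zeta>)"
        unfolding Suc using \<tau>[OF i(1)] hstep[of i] Suc j m W_trans by auto
      obtain R' where R': "sg (g (\<tau> j)) (h (s j)) R'" using seg_ex \<tau>[OF j(1)] by blast
      have "sg (g (\<tau> i)) (g (\<tau> j)) (g ` {\<tau> i..\<tau> j})"
        using isom_sub[OF g(1)] \<tau>[OF i(1)] \<tau>[OF j(1)] i j by auto
      moreover have "p \<in> g ` {\<tau> i..\<tau> j}" using t0 i j by auto
      ultimately obtain r where r: "r \<in> R'" "W p r (\<delta> + \<zeta> + 2 * \<delta> + \<zeta>)"
        using fan[OF ac _ _ _ \<zeta>] R' unfolding side_def by blast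
      have "W r (h (s j)) \<delta>" using seg_W[OF R' r(1)] \<tau>[OF j(1)] by blast
      from W_trans[OF r(2) this] have "W p (h (s j)) (4 * \<delta> + \<eta>)"
        by (rule W_mono) (simp add: \<zeta>_def)
      moreover have "h (s j) \<in> Q" using h s_in[of j] j m by auto
      ultimately show ?thesis by blast
    qed
  next
    case False
    then have lt: "\<tau> m < t0" by force
    obtain r1 where r1: "r1 \<in> R" "W (g (\<tau> m)) r1 (2 * \<delta> + \<zeta>)"
    proof (cases "m = n")
      case True
      then have "W (g (\<tau> m)) z \<delta>" using \<tau>[of m] sn h by auto
      then have "W (g (\<tau> m)) z (2 * \<delta> + \<zeta>)" by (rule W_mono) (use delta \<zeta> in simp)
      then show ?thesis using that side_ends[OF R] by blast
    next
      case False
      then have "Suc m \<le> n" using m by simp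
      then have "\<not> A (Suc m)" using m_max[of "Suc m"] m by (metis le_SucE not_less_eq_eq order_refl)
      then obtain r1 where r1: "r1 \<in> R" "W (h (s (Suc m))) r1 \<delta>" using notA \<open>Suc m \<le> n\<close> by blast
      have "W (g (\<tau> m)) (h (s (Suc m))) (\<delta> + \<zeta>)"
        using \<tau>[of m] hstep[of m] \<open>Suc m \<le> n\<close> W_trans by auto
      from W_trans[OF this r1(2)] have "W (g (\<tau> m)) r1 (2 * \<delta> + \<zeta>)" by (rule W_mono) simp
      then show ?thesis using that r1 by blast
    qed
    obtain R' where R': "sd y r1 R'" "R' \<subseteq> R"
    proof -
      consider "sg y z R" | "sg z y R" using R by (auto simp: side_def)
      then show ?thesis
      proof cases
        case 1
        then obtain k F where k: "isom_geod X d k F" "0 \<le> F" "k 0 = y" "k F = z" "R = k ` {0..F}"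
          by (rule segE)
        obtain v where v: "0 \<le> v" "v \<le> F" "r1 = k v" using r1 k by auto
        have "sg (k 0) (k v) (k ` {0..v})" using isom_sub[OF k(1)] v by auto
        then have "sd y r1 (k ` {0..v})" using k v by (simp add: side_def)
        moreover have "k ` {0..v} \<subseteq> R" unfolding k using v by (intro image_mono) auto
        ultimately show ?thesis using that by blast
      next
        case 2
        then obtain k F where k: "isom_geod X d k F" "0 \<le> F" "k 0 = z" "k F = y" "R = k ` {0..F}"
          by (rule segE)
        obtain v where v: "0 \<le> v" "v \<le> F" "r1 = k v" using r1 k by auto
        have "sg (k v) (k F) (k ` {v..F})" using isom_sub[OF k(1)] v by auto
        then have "sd y r1 (k ` {v..F})" using k v by (simp add: side_def)
        moreover have "k ` {v..F} \<subseteq> R" unfolding k using v by (intro image_mono) auto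
        ultimately show ?thesis using that by blast
      qed
    qed
    have "sg (g (\<tau> m)) y (g ` {\<tau> m..D})" using isom_sub[OF g(1), of "\<tau> m" D] \<tau>[of m] g by auto
    moreover have "p \<in> g ` {\<tau> m..D}" using t0 lt by auto
    ultimately obtain r where r: "r \<in> R'" "W p r (2 * \<delta> + \<zeta> + 2 * \<delta> + \<zeta>)"
      using fan[OF r1(2) _ R'(1) _ \<zeta>] by blast
    then show ?thesis using R' by (intro bexI[of _ r]) (auto simp: \<zeta>_def add.commute)
  qed
qed

end

section \<open>Geodesics as isometric segments\<close>

text \<open>A partition with the two interior points \<open>s\<close> and \<open>t\<close> has sum at most the length \<open>d(c(a), c(b))\<close>, so the
  triangle inequality is an equality along a geodesic.\<close>
lemma geodesic_additive:
  assumes ps: "pseudo_semimetric X d" and c: "one_sided_cont_on {a..b} X d c" and ab: "a < b"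
    and len: "path_len d (DPath a b c) = d (c a) (c b)"
    and st: "a \<le> s" "s \<le> t" "t \<le> b"
  shows "d (c s) (c t) = ennreal (enn2real (d (c a) (c t)) - enn2real (d (c a) (c s)))"
    and "enn2real (d (c a) (c s)) \<le> enn2real (d (c a) (c t))"
proof -
  have X: "c u \<in> X" if "u \<in> {a..b}" for u using c that by (auto simp: one_sided_cont_on_def)
  have tri: "d (c u) (c w) \<le> d (c u) (c v) + d (c v) (c w)"
    if "u \<in> {a..b}" "v \<in> {a..b}" "w \<in> {a..b}" for u v w
    using ps X[OF that(1)] X[OF that(2)] X[OF that(3)] by (simp add: pseudo_semimetric_def)
  have fin: "d (c u) (c v) < \<infinity>" if "a \<le> u" "u \<le> v" "v \<le> b" for u v
    by (rule path_dist_finite[OF ps c]) (use that in auto)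
  define u where "u l = (if l = 0 then a else if l = 1 then s else if l = 2 then t else b)" for l :: nat
  have "(\<Sum>l<3. d (c (u l)) (c (u (Suc l)))) \<le> path_len d (DPath a b c)"
    by (rule partition_sum_le_path_len[OF ps c ab]) (use st in \<open>auto simp: u_def\<close>)
  moreover have "(\<Sum>l<3. d (c (u l)) (c (u (Suc l)))) = d (c a) (c s) + d (c s) (c t) + d (c t) (c b)"
    by (simp add: u_def eval_nat_numeral)
  ultimately have "d (c a) (c s) + d (c s) (c t) + d (c t) (c b) \<le> d (c a) (c b)" using len by simp
  also have "\<dots> \<le> d (c a) (c t) + d (c t) (c b)" using tri[of a t b] st by auto
  finally have 1: "d (c a) (c s) + d (c s) (c t) + d (c t) (c b) \<le> d (c a) (c t) + d (c t) (c b)" .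
  have 2: "d (c a) (c t) \<le> d (c a) (c s) + d (c s) (c t)" using tri[of a s t] st by auto
  obtain A where A: "0 \<le> A" "d (c a) (c s) = ennreal A" using fin[of a s] st by (cases "d (c a) (c s)") auto
  obtain B where B: "0 \<le> B" "d (c s) (c t) = ennreal B" using fin[of s t] st by (cases "d (c s) (c t)") auto
  obtain C where C: "0 \<le> C" "d (c t) (c b) = ennreal C" using fin[of t b] st by (cases "d (c t) (c b)") auto
  obtain T where T: "0 \<le> T" "d (c a) (c t) = ennreal T" using fin[of a t] st by (cases "d (c a) (c t)") auto
  have "A + B + C \<le> T + C" using 1 A B C T by (simp flip: ennreal_plus)
  moreover have "T \<le> A + B" using 2 A B T by (simp flip: ennreal_plus)
  ultimately have "B = T - A" by simp
  then show "d (c s) (c t) = ennreal (enn2real (d (c a) (c t)) - enn2real (d (c a) (c s)))"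
    and "enn2real (d (c a) (c s)) \<le> enn2real (d (c a) (c t))" using A B T by auto
qed

text \<open>Parametrize the geodesic by the distance from its starting point, which is continuous and
  nondecreasing. Where that distance does not change, the path is constant because the space is a
  semimetric space.\<close>
lemma geodesic_seg:
  assumes sm: "semimetric X d" and P: "geodesic_from_to X d x y P"
  shows "seg X d x y (points_of P)"
proof -
  have ps: "pseudo_semimetric X d" and sep: "\<And>x y. x \<in> X \<Longrightarrow> y \<in> X \<Longrightarrow> d x y = 0 \<Longrightarrow> x = y"
    using sm by (auto simp: semimetric_def)
  obtain a b c where P_eq: "P = DPath a b c" by (cases P)
  have ab: "a < b" and c: "one_sided_cont_on {a..b} X d c" and len: "path_len d (DPath a b c) = d (c a) (c b)"
    and xy: "c a = x" "c b = y"
    using P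
    by (auto simp: bicontinuous_on_iff[OF ps] P_eq geodesic_from_to_def geodesic_def directed_path_def start_point_def end_point_def)
  have X: "c u \<in> X" if "u \<in> {a..b}" for u using c that by (auto simp: one_sided_cont_on_def)
  define T where "T t = enn2real (d (c a) (c t))" for t
  have T: "d (c s) (c t) = ennreal (T t - T s)" "T s \<le> T t" if "a \<le> s" "s \<le> t" "t \<le> b" for s t
    unfolding T_def using geodesic_additive[OF ps c ab len that] by auto
  have Ta: "T a = 0" using ps X[of a] ab by (simp add: T_def pseudo_semimetric_def)
  define D where "D = T b"
  have D0: "0 \<le> D" using T(2)[of a b] Ta ab by (simp add: D_def)
  have cont: "continuous_on {a..b} T"
    unfolding continuous_on_iff
  proof (intro ballI allI impI)
    fix t e :: real assume t: "t \<in> {a..b}" and e: "0 < e"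
    from one_sided_cont_onD[OF c t e] obtain r where r: "r > 0"
      "\<forall>u\<in>{a..b}. t \<le> u \<and> u < t + r \<longrightarrow> d (c t) (c u) < ennreal e"
      "\<forall>u\<in>{a..b}. t - r < u \<and> u \<le> t \<longrightarrow> d (c u) (c t) < ennreal e" by blast
    have "dist (T u) (T t) < e" if u: "u \<in> {a..b}" "dist u t < r" for u
    proof (cases "t \<le> u")
      case True
      then have "d (c t) (c u) < ennreal e" using r u by (auto simp: dist_real_def)
      moreover note T[of t u]
      ultimately show ?thesis using True t u e by (auto simp: dist_real_def ennreal_less_iff)
    next
      case False
      then have "d (c u) (c t) < ennreal e" using r u by (auto simp: dist_real_def)
      moreover note T[of u t]
      ultimately show ?thesis using False t u e by (auto simp: dist_real_def ennreal_less_iff)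
    qed
    with r(1) show "\<exists>r>0. \<forall>u\<in>{a..b}. dist u t < r \<longrightarrow> dist (T u) (T t) < e" by blast
  qed
  define \<sigma> where "\<sigma> v = (SOME t. t \<in> {a..b} \<and> T t = v)" for v
  have \<sigma>: "\<sigma> v \<in> {a..b} \<and> T (\<sigma> v) = v" if "0 \<le> v" "v \<le> D" for v
  proof -
    have "\<exists>t\<ge>a. t \<le> b \<and> T t = v"
      by (rule IVT'[OF _ _ _ cont]) (use that Ta ab in \<open>auto simp: D_def\<close>)
    then have "\<exists>t. t \<in> {a..b} \<and> T t = v" by auto
    then show ?thesis unfolding \<sigma>_def by (rule someI_ex)
  qed
  define g where "g v = c (\<sigma> v)" for v
  have g_T: "g (T t) = c t" if t: "t \<in> {a..b}" for t
  proof -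
    have v: "0 \<le> T t" "T t \<le> D" using T(2)[of a t] T(2)[of t b] t Ta by (auto simp: D_def)
    note \<sigma>v = \<sigma>[OF v]
    \<comment> \<open>\<open>\<sigma> (T t)\<close> may differ from \<open>t\<close>, but then the path is constant between them\<close>
    show ?thesis
    proof (cases "\<sigma> (T t) \<le> t")
      case True
      then have "d (c (\<sigma> (T t))) (c t) = 0" using T(1)[of "\<sigma> (T t)" t] \<sigma>v t by auto
      then show ?thesis unfolding g_def using sep X \<sigma>v t by blast
    next
      case False
      then have "d (c t) (c (\<sigma> (T t))) = 0" using T(1)[of t "\<sigma> (T t)"] \<sigma>v t by auto
      then have "c t = c (\<sigma> (T t))" using sep X \<sigma>v t by blast
      then show ?thesis by (simp add: g_def)
    qed
  qed
  have T_mono_rev: "\<sigma> u \<le> \<sigma> v" if "0 \<le> u" "u < v" "v \<le> D" for u v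
  proof (rule ccontr)
    assume "\<not> ?thesis"
    then have "T (\<sigma> v) \<le> T (\<sigma> u)" using T(2)[of "\<sigma> v" "\<sigma> u"] \<sigma>[of u] \<sigma>[of v] that by auto
    then show False using \<sigma>[of u] \<sigma>[of v] that by auto
  qed
  have "isom_geod X d g D"
    unfolding isom_geod_def
  proof (intro conjI allI impI)
    show "0 \<le> D" by (rule D0)
    show "g ` {0..D} \<subseteq> X" using X \<sigma> by (auto simp: g_def)
    fix s t assume st: "0 \<le> s \<and> s \<le> t \<and> t \<le> D"
    show "d (g s) (g t) = ennreal (t - s)"
    proof (cases "s = t")
      case True
      then show ?thesis using T(1)[of "\<sigma> s" "\<sigma> s"] \<sigma>[of s] st by (auto simp: g_def)
    next
      case False
      then show ?thesis using T(1)[of "\<sigma> s" "\<sigma> t"] \<sigma>[of s] \<sigma>[of t] T_mono_rev[of s t] st by (auto simp: g_def)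
    qed
  qed
  moreover have "g 0 = x" using g_T[of a] Ta ab xy by simp
  moreover have "g D = y" using g_T[of b] ab xy by (simp add: D_def)
  moreover have "points_of P = g ` {0..D}"
  proof
    show "g ` {0..D} \<subseteq> points_of P" using \<sigma> by (auto simp: g_def points_of_def P_eq)
    show "points_of P \<subseteq> g ` {0..D}"
    proof
      fix p assume "p \<in> points_of P"
      then obtain t where t: "t \<in> {a..b}" "p = c t" by (auto simp: points_of_def P_eq)
      then have "p = g (T t)" using g_T by simp
      moreover have "T t \<in> {0..D}" using T(2)[of a t] T(2)[of t b] t Ta by (auto simp: D_def)
      ultimately show "p \<in> g ` {0..D}" by blast
    qed
  qed
  ultimately show ?thesis unfolding seg_def by blast
qed

lemma isom_geod_bicontinuous:
  assumes "pseudo_semimetric X d" and g: "isom_geod X d g D"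
  shows "bicontinuous_on {0..D} X d g"
  unfolding bicontinuous_on_iff[OF assms(1)] one_sided_cont_on_def
proof (intro conjI ballI allI impI)
  have gd: "d (g s) (g t) = ennreal (t - s)" if "0 \<le> s" "s \<le> t" "t \<le> D" for s t
    using that g by (auto simp: isom_geod_def)
  fix t r :: real assume t: "t \<in> {0..D}" and r: "0 < r"
  show "\<exists>e>0. (\<forall>u\<in>{0..D}. t \<le> u \<and> u < t + e \<longrightarrow> d (g t) (g u) < ennreal r) \<and>
      (\<forall>u\<in>{0..D}. t - e < u \<and> u \<le> t \<longrightarrow> d (g u) (g t) < ennreal r)"
    using r t gd by (intro exI[of _ r]) (auto simp: ennreal_less_iff)
qed (use g in \<open>auto simp: isom_geod_def\<close>)

lemma const_path:
  assumes ps: "pseudo_semimetric X d" and x: "x \<in> X"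
  shows "directed_path X d (DPath 0 1 (\<lambda>_. x))" "path_len d (DPath 0 1 (\<lambda>_. x)) = 0"
proof -
  have d0: "d x x = 0" using ps x by (simp add: pseudo_semimetric_def)
  have "topspace (forward_topology X d) = X" "topspace (backward_topology X d) = X"
    using topspace_forward_topology ps pseudo_semimetric_reversed[OF ps] by (auto simp: backward_topology_eq)
  then show "directed_path X d (DPath 0 1 (\<lambda>_. x))"
    using x by (simp add: directed_path_def bicontinuous_on_def)
  show "path_len d (DPath 0 1 (\<lambda>_. x)) = 0"
    by (simp add: path_len_def d0 limI)
qed

text \<open>A segment of length \<open>0\<close> becomes a constant path on \<open>[0,1]\<close>, because the parameter interval of a directed
  path has positive length.\<close>
lemma seg_geodesic:
  assumes ps: "pseudo_semimetric X d" and A: "seg X d x y A"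
  shows "\<exists>P. geodesic_from_to X d x y P \<and> points_of P = A"
proof -
  obtain g D where g: "isom_geod X d g D" "g 0 = x" "g D = y" "A = g ` {0..D}"
    using A by (auto simp: seg_def)
  have D: "0 \<le> D" using g by (simp add: isom_geod_def)
  have xX: "x \<in> X" using g D by (auto simp: isom_geod_def)
  have d0: "d x x = 0" using ps xX by (simp add: pseudo_semimetric_def)
  show ?thesis
  proof (cases "D = 0")
    case True
    then have "y = x" "A = {x}" using g by auto
    moreover have "geodesic_from_to X d x x (DPath 0 1 (\<lambda>_. x))"
      unfolding geodesic_from_to_def geodesic_def start_point_def end_point_def
      by (simp add: const_path[OF ps xX] d0)
    moreover have "points_of (DPath 0 1 (\<lambda>_. x)) = {x}"
      unfolding points_of_def by (simp add: image_constant_conv)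
    ultimately show ?thesis by blast
  next
    case False
    with D have D: "0 < D" by simp
    have gd: "d (g s) (g t) = ennreal (t - s)" if "0 \<le> s" "s \<le> t" "t \<le> D" for s t
      using that g by (auto simp: isom_geod_def)
    have sum: "(\<Sum>i=1..N. d (g (real (i - 1) * D / real N)) (g (real i * D / real N))) = ennreal D" if "1 \<le> N" for N
    proof -
      have "d (g (real (i - 1) * D / real N)) (g (real i * D / real N)) = ennreal (D / real N)" if i: "i \<in> {1..N}" for i
      proof -
        have "d (g (real (i - 1) * D / real N)) (g (real i * D / real N)) = ennreal (real i * D / real N - real (i - 1) * D / real N)"
          using i D by (intro gd) (auto simp: field_simps of_nat_diff)
        also have "real i * D / real N - real (i - 1) * D / real N = D / real N"
          using i by (simp add: of_nat_diff field_simps)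
        finally show ?thesis .
      qed
      then have "(\<Sum>i=1..N. d (g (real (i - 1) * D / real N)) (g (real i * D / real N))) = (\<Sum>i=1..N. ennreal (D / real N))"
        by (intro sum.cong) auto
      also have "\<dots> = ennreal (\<Sum>i=1..N. D / real N)" using D by (intro sum_ennreal) auto
      finally show ?thesis using that by simp
    qed
    have "(\<lambda>N. \<Sum>i=1..N. d (g (real (i - 1) * D / real N)) (g (real i * D / real N))) \<longlonglongrightarrow> ennreal D"
      by (rule tendsto_eventually, rule eventually_mono[OF eventually_ge_at_top[of 1]]) (rule sum)
    then have "path_len d (DPath 0 D g) = ennreal D"
      by (simp add: path_len_def partition_point_def limI)
    moreover have "d (g 0) (g D) = ennreal D" using gd[of 0 D] D by simp
    ultimately show ?thesis
      using isom_geod_bicontinuous[OF ps g(1)] D g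
      by (intro exI[of _ "DPath 0 D g"])
        (auto simp: geodesic_from_to_def geodesic_def directed_path_def start_point_def end_point_def points_of_def)
  qed
qed

lemma thin_space_of_hyperbolic:
  assumes "0 \<le> \<delta>" and sm: "semimetric X d" and gs: "geodesic_space X d" and hyp: "hyperbolic X d \<delta>"
    and B1: "B1 X d f" and B2: "B2 X d f"
  shows "thin_space X d \<delta> f"
proof
  have ps: "pseudo_semimetric X d" using sm by (simp add: semimetric_def)
  show "0 \<le> \<delta>" "pseudo_semimetric X d" by fact+
  show "\<exists>A. seg X d x y A" if "x \<in> X" "y \<in> X" "d x y < \<infinity>" for x y
    using gs that geodesic_seg[OF sm] unfolding geodesic_space_def by blast
  have f_bound: "reaches X d y z (f r)" if "y \<in> X" "z \<in> X" "enn2ereal (d y z) \<le> ereal (f r)" for y z r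
  proof -
    have "0 \<le> enn2ereal (d y z)" by simp
    also note that(3)
    finally have "0 \<le> f r" by simp
    moreover have "d y z \<le> ennreal (f r)"
      using that(3) \<open>0 \<le> f r\<close> by (simp add: less_eq_ennreal.rep_eq enn2ereal_ennreal)
    ultimately show ?thesis using that by (simp add: reaches_def)
  qed
  show "reaches X d y z (f r)" if "reaches X d x y r" "reaches X d x z r" "d y z < \<infinity>" for x y z r
  proof (rule f_bound)
    have "d y z = \<infinity> \<or> enn2ereal (d y z) \<le> ereal (f r)"
      using B1 that unfolding B1_def reaches_def out_ball_def by blast
    then show "enn2ereal (d y z) \<le> ereal (f r)" using that(3) by auto
  qed (use that in \<open>auto simp: reaches_def\<close>)
  show "reaches X d y z (f r)" if "reaches X d y x r" "reaches X d z x r" "d y z < \<infinity>" for x y z r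
  proof (rule f_bound)
    have "d y z = \<infinity> \<or> enn2ereal (d y z) \<le> ereal (f r)"
      using B2 that unfolding B2_def reaches_def in_ball_def by blast
    then show "enn2ereal (d y z) \<le> ereal (f r)" using that(3) by auto
  qed (use that in \<open>auto simp: reaches_def\<close>)
  fix x y z P Q R p
  assume P: "seg X d x y P" and Q: "side X d x z Q" and R: "side X d y z R" and p: "p \<in> P"
  have path: "\<exists>G. triangle_side X d u v G \<and> points_of G = A \<and>
      {start_point G, end_point G} = {u, v}" if "side X d u v A" for u v A
  proof -
    have uv: "seg X d u v A \<or> seg X d v u A" using that by (simp add: side_def)
    have "\<exists>G. (geodesic_from_to X d u v G \<or> geodesic_from_to X d v u G) \<and> points_of G = A"
      using uv seg_geodesic[OF ps, of u v A] seg_geodesic[OF ps, of v u A] by blast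
    then obtain G where "geodesic_from_to X d u v G \<or> geodesic_from_to X d v u G" "points_of G = A" by blast
    then show ?thesis
      by (intro exI[of _ G]) (auto simp: triangle_side_def geodesic_from_to_def)
  qed
  obtain P' where P': "geodesic_from_to X d x y P'" "points_of P' = P" using seg_geodesic[OF ps P] by blast
  obtain Q' where Q': "triangle_side X d z x Q'" "points_of Q' = Q" "{start_point Q', end_point Q'} = {z, x}"
    using path[of z x Q] Q side_commute[of X d z x Q] by blast
  obtain R' where R': "triangle_side X d y z R'" "points_of R' = R" "{start_point R', end_point R'} = {y, z}"
    using path[of y z R] R by blast
  have X: "x \<in> X" "y \<in> X" "z \<in> X" using P Q unfolding side_def seg_def isom_geod_def by auto
  have "geodesic_triangle X d x y z P' R' Q'"
    unfolding geodesic_triangle_def using X P' Q' R' by (simp add: triangle_side_def)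
  then have "thin_triangle X d \<delta> P' R' Q'" using hyp unfolding hyperbolic_def by blast
  moreover have "mset [P', Q', R'] = mset [P', R', Q'] \<and> start_point P' \<in> {start_point Q', end_point Q'} \<and>
        end_point P' \<in> {start_point R', end_point R'}"
    unfolding Q'(3) R'(3) using P' by (auto simp: geodesic_from_to_def)
  ultimately have "points_of P' \<subseteq> (\<Union>q\<in>points_of Q'. out_ball X d \<delta> q) \<union> (\<Union>r\<in>points_of R'. in_ball X d \<delta> r)"
    unfolding thin_triangle_def by blast
  moreover have "q \<in> X" if "q \<in> Q" for q using that Q by (auto simp: side_def seg_def isom_geod_def)
  moreover have "r \<in> X" if "r \<in> R" for r using that R by (auto simp: side_def seg_def isom_geod_def)
  ultimately show "(\<exists>q\<in>Q. reaches X d q p \<delta>) \<or> (\<exists>r\<in>R. reaches X d p r \<delta>)"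
    using p \<open>0 \<le> \<delta>\<close> unfolding P'(2) Q'(2) R'(2) reaches_def out_ball_def in_ball_def by blast
qed

section \<open>Geodesic stability\<close>

text \<open>A discrete quasi-geodesic: \<open>a k\<close> bounds the step from \<open>z k\<close> to \<open>z (k+1)\<close>.\<close>
definition qg_chain :: "'a set \<Rightarrow> ('a \<Rightarrow> 'a \<Rightarrow> ennreal) \<Rightarrow> real \<Rightarrow> real \<Rightarrow> real \<Rightarrow> (nat \<Rightarrow> 'a) \<Rightarrow> (nat \<Rightarrow> real) \<Rightarrow> nat \<Rightarrow> bool" where
  "qg_chain X d \<gamma> c \<beta> z a n \<longleftrightarrow>
     (\<forall>k\<le>n. z k \<in> X) \<and> (\<forall>k<n. reaches X d (z k) (z (Suc k)) (a k) \<and> a k \<le> \<beta>) \<and>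
     (\<forall>k l r. k \<le> l \<and> l \<le> n \<and> reaches X d (z k) (z l) r \<longrightarrow> sum a {k..<l} \<le> \<gamma> * r + c)"

text \<open>Greedily group the indices into blocks of total weight between \<open>\<kappa> - \<beta>\<close> and \<open>\<kappa>\<close>: over each block \<open>g\<close>
  increases by at most \<open>A\<close>.\<close>
lemma progress_bound:
  fixes g a :: "nat \<Rightarrow> real"
  assumes "m \<le> n" and a: "\<And>k. m \<le> k \<Longrightarrow> k < n \<Longrightarrow> 0 \<le> a k \<and> a k \<le> \<beta>"
    and \<beta>: "0 \<le> \<beta>" and \<kappa>: "\<beta> < \<kappa>" and A: "0 \<le> A"
    and step: "\<And>k l. m \<le> k \<Longrightarrow> k \<le> l \<Longrightarrow> l \<le> n \<Longrightarrow> sum a {k..<l} \<le> \<kappa> \<Longrightarrow> g l - g k \<le> A"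
  shows "g n - g m \<le> A * (sum a {m..<n} / (\<kappa> - \<beta>) + 1)"
  using assms
proof (induction "n - m" arbitrary: m rule: less_induct)
  case less
  note a = less.prems(2) and step = less.prems(6)
  show ?case
  proof (cases "sum a {m..<n} \<le> \<kappa>")
    case True
    have "g n - g m \<le> A" using step True less.prems by simp
    also have "\<dots> \<le> A * (sum a {m..<n} / (\<kappa> - \<beta>) + 1)"
    proof -
      have "0 \<le> sum a {m..<n} / (\<kappa> - \<beta>)"
        using a \<kappa> by (intro divide_nonneg_pos sum_nonneg) auto
      then show ?thesis using A by (simp add: mult_le_cancel_left1)
    qed
    finally show ?thesis .
  next
    case False
    define k where "k = (LEAST k. m \<le> k \<and> \<kappa> - \<beta> < sum a {m..<k})"
    have "m \<le> n \<and> \<kappa> - \<beta> < sum a {m..<n}" using False less.prems by auto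
    then have k: "m \<le> k" "\<kappa> - \<beta> < sum a {m..<k}" "k \<le> n"
      unfolding k_def by (rule LeastI2, simp, rule LeastI2, auto intro: Least_le)
    have "m < k" using k \<kappa> by (cases "m = k") auto
    then obtain j where j: "k = Suc j" "m \<le> j" by (cases k) auto
    have "\<not> (m \<le> j \<and> \<kappa> - \<beta> < sum a {m..<j})"
      using not_less_Least[of j "\<lambda>k. m \<le> k \<and> \<kappa> - \<beta> < sum a {m..<k}"] j by (simp add: k_def)
    then have "sum a {m..<k} \<le> \<kappa>" using j a[of j] k by simp
    then have 1: "g k - g m \<le> A" using step[of m k] k by simp
    have 2: "g n - g k \<le> A * (sum a {k..<n} / (\<kappa> - \<beta>) + 1)"
      by (rule less.hyps) (use k \<open>m < k\<close> \<beta> \<kappa> A a step in auto)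
    have "sum a {m..<n} = sum a {m..<k} + sum a {k..<n}"
      using k by (simp add: sum.atLeastLessThan_concat)
    then have "sum a {k..<n} / (\<kappa> - \<beta>) + 1 \<le> sum a {m..<n} / (\<kappa> - \<beta>)"
    proof -
      have "1 \<le> sum a {m..<k} / (\<kappa> - \<beta>)" using k \<kappa> by (simp add: pos_le_divide_eq)
      then show ?thesis using \<open>sum a {m..<n} = _\<close> by (simp add: add_divide_distrib)
    qed
    then have "A * (sum a {k..<n} / (\<kappa> - \<beta>) + 1) \<le> A * (sum a {m..<n} / (\<kappa> - \<beta>))"
      using A by (rule mult_left_mono)
    with 1 2 show ?thesis by (simp add: algebra_simps)
  qed
qed

context thin_space
begin

lemma chain_W:
  assumes "qg_chain X d \<gamma> c \<beta> z a n" "k \<le> l" "l \<le> n"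
  shows "W (z k) (z l) (sum a {k..<l})"
  using assms(2,3)
proof (induction l rule: dec_induct)
  case base
  then show ?case using assms(1) W_refl by (simp add: qg_chain_def)
next
  case (step l)
  have "W (z l) (z (Suc l)) (a l)" using assms(1) step by (simp add: qg_chain_def)
  with step show ?case using W_trans by simp
qed

lemma f_nonneg: "x \<in> X \<Longrightarrow> 0 \<le> r \<Longrightarrow> 0 \<le> f r"
  using B1[of x x r x] W_refl W_D by (metis)

text \<open>Let \<open>g \<tau>\<close> and \<open>g \<tau>'\<close> be almost nearest points for \<open>w\<close> and \<open>w'\<close>, in the sense of distances from the geodesic.
  A point \<open>g t\<close> between them reaches within \<open>4\<delta> + 1\<close> a geodesic that ends at \<open>w'\<close>, and from there, in the
  triangle with \<open>w\<close>, possibly one that ends at \<open>w\<close>. Since the projections are almost nearest points, the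
  point so reached is close to \<open>g \<tau>'\<close> or \<open>g \<tau>\<close> or to the end \<open>w'\<close>, and in the first two cases (B2) bounds the
  distance of \<open>g t\<close> from the projection. So a short step away from the geodesic makes bounded progress along it.\<close>
lemma projection_step:
  assumes g: "isom_geod X d g D" and \<tau>: "0 \<le> \<tau>" "\<tau> \<le> t" "t \<le> \<tau>'" "\<tau>' \<le> D"
    and E: "W (g \<tau>) w E" "\<And>t r. 0 \<le> t \<Longrightarrow> t \<le> D \<Longrightarrow> W (g t) w r \<Longrightarrow> E \<le> r + 1"
    and E': "W (g \<tau>') w' E'" "\<And>t r. 0 \<le> t \<Longrightarrow> t \<le> D \<Longrightarrow> W (g t) w' r \<Longrightarrow> E' \<le> r + 1"
    and ww': "W w w' \<Lambda>"
  shows "W (g t) w' (8 * \<delta> + 2 + \<Lambda>) \<or> W (g t) (g \<tau>') (f (4 * \<delta> + 2)) \<or> W (g \<tau>) (g t) (f (8 * \<delta> + 3))"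
proof -
  have P: "sg (g \<tau>) (g \<tau>') (g ` {\<tau>..\<tau>'})" using isom_sub[OF g] \<tau> by auto
  have t: "g t \<in> g ` {\<tau>..\<tau>'}" using \<tau> by auto
  have t\<tau>': "W (g t) (g \<tau>') (\<tau>' - t)" and \<tau>t: "W (g \<tau>) (g t) (t - \<tau>)"
    using isom_W[OF g] \<tau> by auto
  have "W (g \<tau>) w' (E + \<Lambda>)" using W_trans E(1) ww' by blast
  then obtain Q where Q: "sg (g \<tau>) w' Q" using seg_ex by blast
  obtain R where R: "sg (g \<tau>') w' R" using seg_ex E' by blast
  obtain Q2 where Q2: "sg (g \<tau>) w Q2" using seg_ex E by blast
  obtain R2 where R2: "sg w w' R2" using seg_ex ww' by blast
  obtain u where u: "u \<in> Q \<union> R" "W (g t) u (4 * \<delta> + 1)"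
    using out_close[OF P Q _ t, of R 1] R by (auto simp: side_def)
  show ?thesis
  proof (cases "u \<in> R")
    case True
    obtain s where s: "0 \<le> s" "s \<le> E'" "W (g \<tau>') u s" "W u w' (E' - s)"
      using seg_split[OF R True E'(1)] .
    have "W (g t) w' (4 * \<delta> + 1 + (E' - s))" using W_trans u s by blast
    from E'(2)[OF _ _ this] have "E' \<le> 4 * \<delta> + 1 + (E' - s) + 1" using \<tau> by simp
    then have "W (g \<tau>') u (4 * \<delta> + 2)" using s W_mono by auto
    moreover have "W (g t) u (4 * \<delta> + 2)" using u W_mono by auto
    ultimately show ?thesis using B2 t\<tau>' W_D by blast
  next
    case False
    then have "u \<in> Q" using u by blast
    from out_close[OF Q Q2 _ this, of R2 1] R2 obtain u' where
      u': "u' \<in> Q2 \<union> R2" "W u u' (4 * \<delta> + 1)" by (auto simp: side_def)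
    from W_trans[OF u(2) u'(2)] have tu': "W (g t) u' (8 * \<delta> + 2)" by simp
    show ?thesis
    proof (cases "u' \<in> R2")
      case True
      then have "W u' w' \<Lambda>" using seg_W[OF R2 _ ww'] by blast
      then show ?thesis using W_trans tu' by blast
    next
      case False
      then have "u' \<in> Q2" using u' by blast
      then obtain s where s: "0 \<le> s" "s \<le> E" "W (g \<tau>) u' s" "W u' w (E - s)"
        using seg_split[OF Q2 _ E(1)] by blast
      have "W (g t) w (8 * \<delta> + 2 + (E - s))" using W_trans tu' s by blast
      from E(2)[OF _ _ this] have "E \<le> 8 * \<delta> + 2 + (E - s) + 1" using \<tau> by simp
      then have "W (g \<tau>) u' (8 * \<delta> + 3)" using s W_mono by auto
      moreover have "W (g t) u' (8 * \<delta> + 3)" using tu' W_mono by auto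
      ultimately show ?thesis using B2 \<tau>t W_D by blast
    qed
  qed
qed

lemma near_projection:
  assumes g: "isom_geod X d g D" and "0 \<le> D" and w: "W (g 0) w r0"
  shows "\<exists>\<tau> E. 0 \<le> \<tau> \<and> \<tau> \<le> D \<and> W (g \<tau>) w E \<and> (\<forall>t r. 0 \<le> t \<longrightarrow> t \<le> D \<longrightarrow> W (g t) w r \<longrightarrow> E \<le> r + 1)"
proof -
  define B where "B = {r. \<exists>t. 0 \<le> t \<and> t \<le> D \<and> W (g t) w r}"
  have ne: "B \<noteq> {}" unfolding B_def using assms by auto
  have bdd: "bdd_below B" unfolding B_def by (rule bdd_belowI[of _ 0]) (use W_D in blast)
  have "Inf B < Inf B + 1" by simp
  then obtain E where E: "E \<in> B" "E < Inf B + 1" using cInf_lessD[OF ne] by blast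
  have "E \<le> r + 1" if "r \<in> B" for r using cInf_lower[OF that bdd] E by simp
  then show ?thesis using E(1) unfolding B_def by blast
qed

text \<open>A geodesic from \<open>u'\<close> to \<open>y\<close> leaves the out-neighbourhood of \<open>u\<close> after bounded length by (B1), and outside of it
  thinness leads to \<open>P\<close>. This replaces the symmetry \<open>d(u,u') = d(u',u)\<close>: the distance from \<open>u'\<close> to a later point
  of \<open>P\<close> is bounded.\<close>
lemma return_to_segment:
  assumes P: "sg u y P" and uu': "W u u' r" and u'y: "W u' y r'"
  shows "\<exists>q\<in>P. W u' q (f (r + \<delta>) + 1 + \<delta>)"
proof -
  obtain Q where Q: "sg u' y Q" using seg_ex u'y by blast
  obtain U where U: "sg u u' U" using seg_ex uu' by blast
  obtain h l where h: "isom_geod X d h l" "0 \<le> l" "h 0 = u'" "h l = y" "Q = h ` {0..l}"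
    using Q by (rule segE)
  have f0: "0 \<le> f (r + \<delta>)" using f_nonneg uu' W_D delta by (metis add_nonneg_nonneg)
  define s where "s = min l (f (r + \<delta>) + 1)"
  have s: "0 \<le> s" "s \<le> l" using f0 h by (auto simp: s_def)
  have u's: "W u' (h s) s" using isom_W[OF h(1), of 0 s] s h by auto
  show ?thesis
  proof (cases "s = l")
    case True
    then have "W u' y (f (r + \<delta>) + 1 + \<delta>)"
      using u's h delta by (auto simp: s_def elim!: W_mono)
    then show ?thesis using seg_ends[OF P] by blast
  next
    case False
    then have sf: "s = f (r + \<delta>) + 1" by (auto simp: s_def)
    have "h s \<in> Q" using s h by auto
    moreover have "sd u' u U" "sd y u P" using U P by (auto simp: side_def)
    ultimately consider q where "q \<in> U" "W q (h s) \<delta>" | q where "q \<in> P" "W (h s) q \<delta>"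
      using thin[OF Q] by blast
    then show ?thesis
    proof cases
      case 1
      then have "W u (h s) (r + \<delta>)" using seg_W[OF U 1(1) uu'] W_trans by blast
      moreover have "W u u' (r + \<delta>)" using uu' delta W_mono by auto
      ultimately have "W u' (h s) (f (r + \<delta>))" using B1 u's W_D by blast
      then have "s \<le> f (r + \<delta>)" using isom_le[OF h(1), of 0 s] s h by auto
      then show ?thesis using sf by simp
    next
      case 2
      then have "W u' q (s + \<delta>)" using W_trans u's by blast
      then show ?thesis using 2 sf by auto
    qed
  qed
qed

text \<open>Project the points \<open>z k\<close> to the geodesic. The point \<open>p\<close> lies between the projections of two points
  \<open>z k1\<close> and \<open>z k2\<close> at distance at most \<open>Ds\<close> from the geodesic such that all points of the chain between
  them are at larger distance. By \<open>projection_step\<close> the projections of the latter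
  move only by \<open>A1\<close> while the chain moves by \<open>\<kappa>\<close>. On the other hand \<open>return_to_segment\<close> bounds the distance
  from \<open>z k1\<close> to \<open>z k2\<close>, and hence the length of the chain between them, linearly in the distance \<open>L\<close> of the
  projections. For large \<open>\<kappa>\<close> this bounds \<open>L\<close>.\<close>
lemma geodesic_near_chain:
  assumes nn: "0 \<le> \<gamma>" "0 \<le> c" "0 \<le> \<beta>"
  shows "\<exists>C. \<forall>z a n P p. qg_chain X d \<gamma> c \<beta> z a n \<longrightarrow> sg (z 0) (z n) P \<longrightarrow> p \<in> P \<longrightarrow> (\<exists>k\<le>n. W p (z k) C)"
proof -
  define f4 where "f4 = f (4 * \<delta> + 2)"
  define f8 where "f8 = f (8 * \<delta> + 3)"
  define A1 where "A1 = f4 + f8"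
  define \<kappa> where "\<kappa> = \<beta> + 2 * A1 * \<gamma> + 1"
  define Ds where "Ds = 8 * \<delta> + 3 + \<kappa>"
  define A2 where "A2 = A1 + f Ds"
  define D2 where "D2 = f (Ds + \<delta>) + 1 + \<delta>"
  define Lm where "Lm = D2 + Ds + 2 * (A1 * c + A1 + A2)"
  have "\<exists>k\<le>n. W p (z k) (Lm + Ds)"
    if ch: "qg_chain X d \<gamma> c \<beta> z a n" and P: "sg (z 0) (z n) P" and p: "p \<in> P" for z a n P p
  proof -
    have zX: "z k \<in> X" if "k \<le> n" for k using ch that by (simp add: qg_chain_def)
    have a: "0 \<le> a k \<and> a k \<le> \<beta>" if "k < n" for k using ch that W_D by (simp add: qg_chain_def) blast
    have qg: "sum a {k..<l} \<le> \<gamma> * r + c" if "k \<le> l" "l \<le> n" "W (z k) (z l) r" for k l r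
      using ch that unfolding qg_chain_def by blast
    have f0: "0 \<le> f r" if "0 \<le> r" for r using f_nonneg zX[of 0] that by blast
    have f4: "0 \<le> f4" and f8: "0 \<le> f8" unfolding f4_def f8_def using delta by (auto intro: f0)
    then have A1: "0 \<le> A1" by (simp add: A1_def)
    have A1\<gamma>: "0 \<le> A1 * \<gamma>" using A1 nn by simp
    have \<kappa>: "\<beta> + 1 \<le> \<kappa>" "0 \<le> \<kappa>" using A1\<gamma> nn by (auto simp: \<kappa>_def)
    have Ds: "0 \<le> Ds" using \<kappa> delta by (simp add: Ds_def)
    have fDs: "0 \<le> f Ds" using f0 Ds by blast
    have D2: "0 \<le> D2" using f0[of "Ds + \<delta>"] Ds delta by (simp add: D2_def)
    obtain g D where g: "isom_geod X d g D" "0 \<le> D" "g 0 = z 0" "g D = z n" "P = g ` {0..D}"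
      using P by (rule segE)
    obtain t0 where t0: "0 \<le> t0" "t0 \<le> D" "p = g t0" using p g by auto
    have "\<forall>k. \<exists>\<tau>E. k \<le> n \<longrightarrow> 0 \<le> fst \<tau>E \<and> fst \<tau>E \<le> D \<and> W (g (fst \<tau>E)) (z k) (snd \<tau>E) \<and>
        (\<forall>t r. 0 \<le> t \<longrightarrow> t \<le> D \<longrightarrow> W (g t) (z k) r \<longrightarrow> snd \<tau>E \<le> r + 1)"
    proof
      fix k
      show "\<exists>\<tau>E. k \<le> n \<longrightarrow> 0 \<le> fst \<tau>E \<and> fst \<tau>E \<le> D \<and> W (g (fst \<tau>E)) (z k) (snd \<tau>E) \<and>
        (\<forall>t r. 0 \<le> t \<longrightarrow> t \<le> D \<longrightarrow> W (g t) (z k) r \<longrightarrow> snd \<tau>E \<le> r + 1)"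
      proof (cases "k \<le> n")
        case True
        have "W (g 0) (z k) (sum a {0..<k})" using chain_W[OF ch _ True] g by simp
        from near_projection[OF g(1,2) this] obtain \<tau> E where "0 \<le> \<tau>" "\<tau> \<le> D" "W (g \<tau>) (z k) E"
          "\<forall>t r. 0 \<le> t \<longrightarrow> t \<le> D \<longrightarrow> W (g t) (z k) r \<longrightarrow> E \<le> r + 1" by blast
        then show ?thesis by (intro exI[of _ "(\<tau>, E)"]) simp
      qed simp
    qed
    then obtain \<tau>E where \<tau>E: "\<And>k. k \<le> n \<Longrightarrow> 0 \<le> fst (\<tau>E k) \<and> fst (\<tau>E k) \<le> D \<and>
        W (g (fst (\<tau>E k))) (z k) (snd (\<tau>E k)) \<and>
        (\<forall>t r. 0 \<le> t \<longrightarrow> t \<le> D \<longrightarrow> W (g t) (z k) r \<longrightarrow> snd (\<tau>E k) \<le> r + 1)" by metis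
    have D0: "D = 0" if "n = 0"
    proof -
      have "W (g 0) (g D) 0" using g that W_refl zX[of 0] by simp
      from isom_le[OF g(1) _ _ this] g show ?thesis by simp
    qed
    \<comment> \<open>the ends of the chain lie on the geodesic and are their own projections, so that the indices
      \<open>k1\<close> and \<open>k2\<close> exist\<close>
    define \<tau> where "\<tau> k = (if k = 0 then 0 else if k = n then D else fst (\<tau>E k))" for k
    define E where "E k = (if k = 0 \<or> k = n then 0 else snd (\<tau>E k))" for k
    have \<tau>: "0 \<le> \<tau> k" "\<tau> k \<le> D" if "k \<le> n" for k using \<tau>E[OF that] g by (auto simp: \<tau>_def)
    have E: "W (g (\<tau> k)) (z k) (E k)" if "k \<le> n" for k
      using \<tau>E[OF that] g W_refl zX[of 0] zX[of n] by (auto simp: \<tau>_def E_def)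
    have E_min: "E k \<le> r + 1" if "k \<le> n" "0 \<le> t" "t \<le> D" "W (g t) (z k) r" for k t r
    proof (cases "k = 0 \<or> k = n")
      case True
      then show ?thesis using W_D[OF that(4)] by (auto simp: E_def)
    next
      case False
      then show ?thesis using \<tau>E[OF that(1)] that by (auto simp: E_def)
    qed
    have \<tau>0: "\<tau> 0 = 0" "\<tau> n = D" "E 0 = 0" "E n = 0" using D0 by (auto simp: \<tau>_def E_def)
    define k1 where "k1 = (GREATEST k. k \<le> n \<and> E k \<le> Ds \<and> \<tau> k \<le> t0)"
    have ex: "0 \<le> n \<and> E 0 \<le> Ds \<and> \<tau> 0 \<le> t0" using \<tau>0 Ds t0 by simp
    have k1: "k1 \<le> n \<and> E k1 \<le> Ds \<and> \<tau> k1 \<le> t0" unfolding k1_def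
      by (rule GreatestI_nat[where k = 0 and b = n]) (use ex in auto)
    have k1_max: "k \<le> k1" if "k \<le> n" "E k \<le> Ds" "\<tau> k \<le> t0" for k
      unfolding k1_def by (rule Greatest_le_nat[where b = n]) (use that in auto)
    show ?thesis
    proof (cases "k1 = n")
      case True
      then have "t0 = D" using k1 \<tau>0 t0 by simp
      then have "W p (z n) 0" using t0 g W_refl zX[of n] by simp
      then have "W p (z n) (Lm + Ds)"
        by (rule W_mono) (use D2 Ds A1 nn fDs in \<open>simp add: Lm_def A2_def\<close>)
      then show ?thesis by blast
    next
      case False
      define k2 where "k2 = (LEAST k. k1 < k \<and> E k \<le> Ds)"
      have "k1 < n \<and> E n \<le> Ds" using False k1 \<tau>0 Ds by auto
      then have k2: "k1 < k2 \<and> E k2 \<le> Ds" "k2 \<le> n"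
        unfolding k2_def by (rule LeastI, rule Least_le)
      have far: "Ds < E k" if "k1 < k" "k < k2" for k
        using not_less_Least[of k "\<lambda>k. k1 < k \<and> E k \<le> Ds"] that by (auto simp: k2_def)
      have t0k2: "t0 < \<tau> k2" using k1_max[of k2] k2 by force
      have step: "W (g t) (z l) (8 * \<delta> + 2 + \<kappa>) \<or> \<tau> l - t \<le> f4 \<or> t - \<tau> k \<le> f8"
        if kl: "k \<le> l" "l \<le> n" "sum a {k..<l} \<le> \<kappa>" "\<tau> k \<le> t" "t \<le> \<tau> l" for k l t
      proof -
        have kn: "k \<le> n" using kl by simp
        have "W (z k) (z l) \<kappa>" using chain_W[OF ch kl(1,2)] kl(3) by (rule W_mono)
        from projection_step[OF g(1) \<tau>(1)[OF kn] kl(4,5) \<tau>(2)[OF kl(2)] E[OF kn] _ E[OF kl(2)] _ this]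
        have "W (g t) (z l) (8 * \<delta> + 2 + \<kappa>) \<or> W (g t) (g (\<tau> l)) f4 \<or> W (g (\<tau> k)) (g t) f8"
          using E_min kn kl unfolding f4_def f8_def by blast
        moreover have "\<tau> l - t \<le> f4" if "W (g t) (g (\<tau> l)) f4"
          using isom_le[OF g(1) _ _ that] \<tau>[OF kn] \<tau>[OF kl(2)] kl by auto
        moreover have "t - \<tau> k \<le> f8" if "W (g (\<tau> k)) (g t) f8"
          using isom_le[OF g(1) _ _ that] \<tau>[OF kn] \<tau>[OF kl(2)] kl by auto
        ultimately show ?thesis by blast
      qed
      have far_step: "\<tau> l - \<tau> k \<le> A1" if kl: "k1 \<le> k" "k \<le> l" "l < k2" "sum a {k..<l} \<le> \<kappa>" for k l
      proof (cases "k = l")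
        case False
        show ?thesis
        proof (rule ccontr)
          assume "\<not> ?thesis"
          then have big: "f4 + f8 < \<tau> l - \<tau> k" by (simp add: A1_def)
          define t where "t = (\<tau> k + f8 + \<tau> l - f4) / 2"
          have t: "f8 < t - \<tau> k" "f4 < \<tau> l - t" using big by (auto simp: t_def field_simps)
          have ln: "l \<le> n" using kl k2 by simp
          have "W (g t) (z l) (8 * \<delta> + 2 + \<kappa>)" using step[of k l t] kl ln t f4 f8 by auto
          from E_min[OF ln _ _ this] have "E l \<le> Ds"
            using t f4 f8 \<tau>[OF ln] \<tau>[of k] kl ln by (auto simp: Ds_def)
          then show False using far[of l] kl False by auto
        qed
      qed (use A1 in simp)
      define m where "m = k2 - 1"
      have m: "k2 = Suc m" "k1 \<le> m" "m < n" using k2 by (auto simp: m_def)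
      \<comment> \<open>the last step leads back to a point near the geodesic, where (B2) bounds the jump of the projection\<close>
      have last: "\<tau> k2 - \<tau> m \<le> A2"
      proof (rule ccontr)
        assume "\<not> ?thesis"
        then have big: "f4 + f8 + f Ds < \<tau> k2 - \<tau> m" by (simp add: A1_def A2_def)
        define t where "t = (\<tau> m + f8 + \<tau> k2 - (f4 + f Ds)) / 2"
        have t: "f8 < t - \<tau> m" "f4 + f Ds < \<tau> k2 - t" using big by (auto simp: t_def field_simps)
        have "sum a {m..<k2} \<le> \<kappa>" using a[of m] m \<kappa> by simp
        then have "W (g t) (z k2) (8 * \<delta> + 2 + \<kappa>)" using step[of m k2 t] m k2 t f4 f8 fDs by auto
        then have "W (g t) (z k2) Ds" by (rule W_mono) (simp add: Ds_def)
        moreover have "W (g (\<tau> k2)) (z k2) Ds" using E[OF k2(2)] k2 W_mono by blast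
        moreover have "W (g t) (g (\<tau> k2)) (\<tau> k2 - t)"
          using isom_W[OF g(1), of t "\<tau> k2"] t \<tau>[of m] \<tau>[OF k2(2)] m f8 f4 fDs by auto
        ultimately have "W (g t) (g (\<tau> k2)) (f Ds)" using B2 W_D by blast
        then have "\<tau> k2 - t \<le> f Ds"
          using isom_le[OF g(1), of t "\<tau> k2"] t \<tau>[of m] \<tau>[OF k2(2)] m f8 by auto
        then show False using t f4 by simp
      qed
      define S where "S = sum a {k1..<k2}"
      have "\<tau> m - \<tau> k1 \<le> A1 * (sum a {k1..<m} / (\<kappa> - \<beta>) + 1)"
        by (rule progress_bound) (use m a far_step \<kappa> A1 nn in auto)
      also have "\<dots> \<le> A1 * (S / (\<kappa> - \<beta>) + 1)"
      proof -
        have "sum a {k1..<m} \<le> S" unfolding S_def m(1) using a m by simp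
        then show ?thesis using \<kappa> A1 by (intro mult_left_mono add_right_mono divide_right_mono) auto
      qed
      finally have progress: "\<tau> k2 - \<tau> k1 \<le> A1 * (S / (\<kappa> - \<beta>) + 1) + A2" using last by simp
      define L where "L = \<tau> k2 - \<tau> k1"
      have L0: "0 \<le> L" using k1 t0k2 by (simp add: L_def)
      have k1n: "k1 \<le> n" using k1 by simp
      have E1: "W (g (\<tau> k1)) (z k1) Ds" using E[OF k1n] k1 W_mono by blast
      have E2: "W (g (\<tau> k2)) (z k2) Ds" using E[OF k2(2)] k2 W_mono by blast
      have "sg (g (\<tau> k1)) (z n) (g ` {\<tau> k1..D})"
        using isom_sub[OF g(1), of "\<tau> k1" D] \<tau>[OF k1n] g by auto
      from return_to_segment[OF this E1 chain_W[OF ch k1n order_refl]]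
      obtain t' where t': "\<tau> k1 \<le> t'" "t' \<le> D" "W (z k1) (g t') D2" unfolding D2_def by auto
      have "L \<le> Lm"
      proof (cases "t' \<le> \<tau> k2")
        case False
        have "W (g (\<tau> k1)) (g t') (Ds + D2)" using W_trans E1 t' by blast
        then have "t' - \<tau> k1 \<le> Ds + D2" using isom_le[OF g(1)] \<tau>[OF k1n] t' by auto
        then have "L \<le> D2 + Ds" using False by (simp add: L_def)
        moreover have "0 \<le> A1 * c" using A1 nn by simp
        ultimately show ?thesis using A1 fDs by (simp add: Lm_def A2_def)
      next
        case True
        have "W (g t') (g (\<tau> k2)) L"
          using isom_W[OF g(1), of t' "\<tau> k2"] t' True \<tau>[OF k1n] \<tau>[OF k2(2)] by (auto simp: L_def elim!: W_mono)
        then have "W (z k1) (z k2) (D2 + L + Ds)" using W_trans t' E2 by blast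
        then have S: "S \<le> \<gamma> * (D2 + L + Ds) + c" unfolding S_def using qg k2 by simp
        have "A1 * (S / (\<kappa> - \<beta>)) \<le> (D2 + L + Ds) / 2 + A1 * c"
        proof -
          let ?q = "\<kappa> - \<beta>"
          \<comment> \<open>the choice of \<open>\<kappa>\<close> makes \<open>L\<close> appear with coefficient \<open>1/2\<close> on the right\<close>
          have q: "1 \<le> ?q" "2 * (A1 * \<gamma>) \<le> ?q" using \<kappa> by (auto simp: \<kappa>_def)
          have "A1 * S \<le> A1 * (\<gamma> * (D2 + L + Ds) + c)" using S A1 by (rule mult_left_mono)
          also have "\<dots> = (A1 * \<gamma>) * (D2 + L + Ds) + A1 * c" by (simp add: algebra_simps)
          also have "\<dots> \<le> (?q / 2) * (D2 + L + Ds) + (A1 * c) * ?q"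
          proof (rule add_mono)
            show "A1 * \<gamma> * (D2 + L + Ds) \<le> (?q / 2) * (D2 + L + Ds)"
              using q D2 L0 Ds by (intro mult_right_mono) auto
            have "(A1 * c) * 1 \<le> (A1 * c) * ?q" using q A1 nn by (intro mult_left_mono) auto
            then show "A1 * c \<le> (A1 * c) * ?q" by simp
          qed
          finally have "A1 * S \<le> ((D2 + L + Ds) / 2 + A1 * c) * ?q" by (simp add: algebra_simps)
          then show ?thesis using q by (simp add: pos_divide_le_eq)
        qed
        then have "L \<le> (D2 + L + Ds) / 2 + A1 * c + A1 + A2"
          using progress by (simp add: L_def algebra_simps)
        then show ?thesis by (simp add: Lm_def field_simps)
      qed
      moreover have "W p (g (\<tau> k2)) L"
        using isom_W[OF g(1), of t0 "\<tau> k2"] t0 t0k2 \<tau>[OF k2(2)] k1 by (auto simp: L_def elim!: W_mono)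
      ultimately have "W p (z k2) (Lm + Ds)" using W_trans E2 W_mono by blast
      then show ?thesis using k2 by blast
    qed
  qed
  then show ?thesis by blast
qed

end

section \<open>Tails of quasi-geodesic rays\<close>

text \<open>Chains as in \<open>qg_chain\<close> whose points are taken from a given part of the ray.\<close>
definition chained :: "'a set \<Rightarrow> ('a \<Rightarrow> 'a \<Rightarrow> ennreal) \<Rightarrow> (real \<Rightarrow> 'a) \<Rightarrow> real \<Rightarrow> real \<Rightarrow> real \<Rightarrow> bool" where
  "chained X d r \<gamma> c \<beta> \<longleftrightarrow> (\<forall>i j. 0 \<le> i \<longrightarrow> i \<le> j \<longrightarrow>
     (\<exists>n u a. u 0 = i \<and> u n = j \<and> (\<forall>k\<le>n. i \<le> u k \<and> u k \<le> j) \<and>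
        qg_chain X d \<gamma> c \<beta> (\<lambda>k. r (u k)) a n))"

text \<open>A quasi-geodesic ray, reduced to what the arguments about triangles use. Anti-rays are covered as well:
  with \<open>R(i)\<close> for \<open>R(-i)\<close>, an anti-ray is a ray with respect to the reversed distance.\<close>
definition quasi_ray :: "'a set \<Rightarrow> ('a \<Rightarrow> 'a \<Rightarrow> ennreal) \<Rightarrow> (real \<Rightarrow> 'a) \<Rightarrow> bool" where
  "quasi_ray X d r \<longleftrightarrow>
     (\<forall>t\<ge>0. r t \<in> X) \<and>
     (\<forall>x\<in>X. \<forall>\<rho>. \<exists>p\<ge>0. \<forall>t\<ge>p. \<not> reaches X d x (r t) \<rho>) \<and>
     (\<exists>\<gamma>\<ge>0. \<exists>c\<ge>0. \<exists>\<beta>\<ge>0. chained X d r \<gamma> c \<beta>) \<and>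
     (\<forall>N\<ge>0. \<exists>\<rho>. \<forall>t. 0 \<le> t \<and> t \<le> N \<longrightarrow> reaches X d (r 0) (r t) \<rho> \<and> reaches X d (r t) (r N) \<rho>)"

text \<open>A ray or an anti-ray, both parametrized by \<open>[0,\<infinity>)\<close>.\<close>
abbreviation ideal :: "'a set \<Rightarrow> ('a \<Rightarrow> 'a \<Rightarrow> ennreal) \<Rightarrow> (real \<Rightarrow> 'a) \<Rightarrow> bool" where
  "ideal X d r \<equiv> quasi_ray X d r \<or> quasi_ray X (reversed d) r"

definition avoids :: "'a set \<Rightarrow> ('a \<Rightarrow> 'a \<Rightarrow> ennreal) \<Rightarrow> 'a \<Rightarrow> real \<Rightarrow> 'a set \<Rightarrow> bool" where
  "avoids X d s m A \<longleftrightarrow> (\<forall>u\<in>A. \<forall>r. reaches X d s u r \<longrightarrow> m \<le> r)"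

text \<open>Only distances from \<open>s\<close> are considered; distances to \<open>s\<close> are treated by reversal.\<close>
definition far :: "'a set \<Rightarrow> ('a \<Rightarrow> 'a \<Rightarrow> ennreal) \<Rightarrow> 'a \<Rightarrow> real \<Rightarrow> 'a \<Rightarrow> 'a \<Rightarrow> bool" where
  "far X d s m x y \<longleftrightarrow> (\<exists>A. seg X d x y A) \<and> (\<forall>A. seg X d x y A \<longrightarrow> avoids X d s m A)"

text \<open>The sets \<open>J\<close> and \<open>L\<close> restrict the parameters on both rays. This matters because the parameters at which
  a third ray is connected to \<open>Q\<close> or \<open>R\<close> may be arbitrarily sparse.\<close>
definition linked :: "'a set \<Rightarrow> ('a \<Rightarrow> 'a \<Rightarrow> ennreal) \<Rightarrow> 'a \<Rightarrow> (real \<Rightarrow> 'a) \<Rightarrow> (real \<Rightarrow> 'a) \<Rightarrow> real set \<Rightarrow> real set \<Rightarrow> bool" where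
  "linked X d s Q R J L \<longleftrightarrow> (\<forall>m N. \<exists>j\<in>J. \<exists>l\<in>L. N \<le> j \<and> N \<le> l \<and> far X d s m (Q j) (R l))"

definition unbounded_above :: "real set \<Rightarrow> bool" where
  "unbounded_above J \<longleftrightarrow> (\<forall>N. \<exists>j\<in>J. N \<le> j)"

definition near :: "'a set \<Rightarrow> ('a \<Rightarrow> 'a \<Rightarrow> ennreal) \<Rightarrow> (real \<Rightarrow> 'a) \<Rightarrow> (real \<Rightarrow> 'a) \<Rightarrow> bool" where
  "near X d Q R \<longleftrightarrow> (\<exists>M. \<forall>N. \<exists>j k. N \<le> j \<and> N \<le> k \<and> reaches X d (Q j) (R k) M)"

lemma chained_subdivision:
  assumes "chained X d r \<gamma> c \<beta>" "0 \<le> i" "i \<le> j"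
  shows "\<exists>n u a. u 0 = i \<and> u n = j \<and> (\<forall>k\<le>n. i \<le> u k \<and> u k \<le> j) \<and>
      qg_chain X d \<gamma> c \<beta> (\<lambda>k. r (u k)) a n"
  using assms unfolding chained_def by (elim allE impE)

lemma near_reversed: "near X (reversed d) Q R \<longleftrightarrow> near X d R Q"
  unfolding near_def reaches_reversed by (rule ex_cong1, rule all_cong1) blast

lemma qg_chain_reversed:
  assumes "qg_chain X d \<gamma> c \<beta> z a n"
  shows "qg_chain X (reversed d) \<gamma> c \<beta> (\<lambda>k. z (n - k)) (\<lambda>k. a (n - Suc k)) n"
proof -
  have "(\<Sum>i=k..<l. a (n - Suc i)) \<le> \<gamma> * r + c"
    if "k \<le> l" "l \<le> n" "reaches X d (z (n - l)) (z (n - k)) r" for k l r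
  proof -
    have "(\<Sum>i=k..<l. a (n - Suc i)) = sum a {n - l..<n - k}"
      by (rule sum.reindex_bij_witness[where i = "\<lambda>i. n - Suc i" and j = "\<lambda>i. n - Suc i"])
        (use that in auto)
    then show ?thesis using assms that unfolding qg_chain_def by simp
  qed
  moreover have "reaches X d (z (n - Suc k)) (z (n - k)) (a (n - Suc k)) \<and> a (n - Suc k) \<le> \<beta>"
    if "k < n" for k
  proof -
    have "n - Suc k < n" "Suc (n - Suc k) = n - k" using that by auto
    then show ?thesis using assms unfolding qg_chain_def by metis
  qed
  ultimately show ?thesis using assms unfolding qg_chain_def by simp
qed

context thin_space
begin

text \<open>The reversal of \<open>out_close\<close>, hence for two sides with the same end.\<close>
lemma in_close:
  assumes "sg y x P" "sg z x Q" "sd y z R" "p \<in> P" "0 < \<eta>"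
  shows "\<exists>u\<in>Q \<union> R. W u p (4 * \<delta> + \<eta>)"
  using thin_space.out_close[OF reversed, of x y P z Q R p \<eta>] assms by simp

lemma avoids_close:
  assumes P: "sg x y P" and Q: "sg x z Q" and R: "sd y z R"
    and "avoids X d s m Q" "avoids X d s m R"
  shows "avoids X d s (m - 4 * \<delta>) P"
  unfolding avoids_def
proof (intro ballI allI impI)
  fix p r assume p: "p \<in> P" "W s p r"
  have "m \<le> r + 4 * \<delta> + \<eta>" if \<eta>: "0 < \<eta>" for \<eta>
  proof -
    obtain u where u: "u \<in> Q \<union> R" "W p u (4 * \<delta> + \<eta>)"
      using out_close[OF P Q R p(1) \<eta>] by blast
    have "W s u (r + (4 * \<delta> + \<eta>))" using W_trans p(2) u(2) by blast
    then show ?thesis using u(1) assms(4,5) unfolding avoids_def by fastforce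
  qed
  then have "m \<le> r + 4 * \<delta>" by (rule field_le_epsilon)
  then show "m - 4 * \<delta> \<le> r" by simp
qed

lemma far_trans:
  assumes "far X d s m x z" "far X d s m z y"
  shows "far X d s (m - 4 * \<delta>) x y"
proof -
  obtain Q R where Q: "sg x z Q" and R: "sg z y R" using assms by (auto simp: far_def)
  then obtain r where "W x y r" using seg_W_ends W_trans by blast
  then have "\<exists>A. sg x y A" using seg_ex by blast
  moreover have "avoids X d s (m - 4 * \<delta>) A" if "sg x y A" for A
  proof (rule avoids_close[OF that Q])
    show "sd y z R" using R by (simp add: side_def)
    show "avoids X d s m Q" "avoids X d s m R" using assms Q R unfolding far_def by blast+
  qed
  ultimately show ?thesis by (simp add: far_def)
qed

lemma far_mono: "far X d s m x y \<Longrightarrow> m' \<le> m \<Longrightarrow> far X d s m' x y"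
  unfolding far_def avoids_def by (meson order_trans)

lemma not_W_avoids: "(\<And>u. u \<in> A \<Longrightarrow> \<not> W s u m) \<Longrightarrow> avoids X d s m A"
  unfolding avoids_def by (meson W_mono linear)

lemma quasi_ray_reach:
  assumes "quasi_ray X d r" "0 \<le> i" "i \<le> j"
  shows "\<exists>\<rho>. W (r i) (r j) \<rho>"
proof -
  obtain \<gamma> c \<beta> where "chained X d r \<gamma> c \<beta>" using assms(1) unfolding quasi_ray_def by blast
  from chained_subdivision[OF this assms(2,3)] show ?thesis
  proof (elim exE conjE)
    fix n u a
    assume u: "u 0 = i" "u n = j" and "qg_chain X d \<gamma> c \<beta> (\<lambda>k. r (u k)) a n"
    from chain_W[OF this(3), of 0 n] show ?thesis unfolding u by auto
  qed
qed

lemma quasi_ray_leaves_out: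
  assumes "quasi_ray X d r" "x \<in> X"
  shows "\<exists>p\<ge>0. \<forall>t\<ge>p. \<not> W x (r t) \<rho>"
  using assms unfolding quasi_ray_def by blast

text \<open>Two points of the ray in the same in-ball are at bounded distance by (B2), because one reaches the other,
  but the ray leaves all out-balls around its points.\<close>
lemma quasi_ray_leaves_in:
  assumes r: "quasi_ray X d r" and x: "x \<in> X"
  shows "\<exists>p\<ge>0. \<forall>t\<ge>p. \<not> W (r t) x \<rho>"
proof (rule ccontr)
  assume neg: "\<not> ?thesis"
  then obtain t1 where t1: "0 \<le> t1" "W (r t1) x \<rho>" by blast
  then have "r t1 \<in> X" using W_D by blast
  from quasi_ray_leaves_out[OF r this] obtain p where p: "0 \<le> p" "\<And>t. t \<ge> p \<Longrightarrow> \<not> W (r t1) (r t) (f \<rho>)" by blast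
  have "0 \<le> max p t1" using p by simp
  with neg obtain t where t: "t \<ge> max p t1" "W (r t) x \<rho>" by blast
  have "\<exists>\<rho>. W (r t1) (r t) \<rho>" using quasi_ray_reach[OF r] t t1 by simp
  then have "W (r t1) (r t) (f \<rho>)" using B2 t1 t W_D by blast
  then show False using p t by auto
qed

lemma ideal_leaves:
  assumes r: "ideal X d r" and x: "x \<in> X"
  shows "\<exists>p\<ge>0. \<forall>t\<ge>p. \<not> W x (r t) \<rho> \<and> \<not> W (r t) x \<rho>"
proof -
  have "\<exists>p\<ge>0. \<forall>t\<ge>p. \<not> W x (r t) \<rho>"
    using r
  proof
    assume "quasi_ray X (reversed d) r"
    from thin_space.quasi_ray_leaves_in[OF reversed this x, of \<rho>] show ?thesis by simp
  qed (rule quasi_ray_leaves_out[OF _ x])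
  moreover have "\<exists>p\<ge>0. \<forall>t\<ge>p. \<not> W (r t) x \<rho>"
    using r
  proof
    assume "quasi_ray X (reversed d) r"
    from thin_space.quasi_ray_leaves_out[OF reversed this x, of \<rho>] show ?thesis by simp
  qed (rule quasi_ray_leaves_in[OF _ x])
  ultimately obtain p q where "0 \<le> p" "\<forall>t\<ge>p. \<not> W x (r t) \<rho>" "0 \<le> q" "\<forall>t\<ge>q. \<not> W (r t) x \<rho>" by blast
  then show ?thesis by (intro exI[of _ "max p q"]) auto
qed

lemma geodesic_near_chain_in:
  assumes nn: "0 \<le> \<gamma>" "0 \<le> c" "0 \<le> \<beta>"
  shows "\<exists>C. \<forall>z a n P p. qg_chain X d \<gamma> c \<beta> z a n \<longrightarrow> sg (z 0) (z n) P \<longrightarrow> p \<in> P \<longrightarrow> (\<exists>k\<le>n. W (z k) p C)"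
proof -
  from thin_space.geodesic_near_chain[OF reversed nn] obtain C where C:
    "\<forall>z a n P p. qg_chain X (reversed d) \<gamma> c \<beta> z a n \<longrightarrow> seg X (reversed d) (z 0) (z n) P \<longrightarrow>
      p \<in> P \<longrightarrow> (\<exists>k\<le>n. reaches X (reversed d) p (z k) C)" ..
  have "\<exists>k\<le>n. W (z k) p C" if h: "qg_chain X d \<gamma> c \<beta> z a n" "sg (z 0) (z n) P" "p \<in> P" for z a n P p
  proof -
    obtain k where "k \<le> n" "W (z (n - k)) p C"
      using C[rule_format, OF qg_chain_reversed[OF h(1)], of P p] h(2,3) by auto
    then show ?thesis by (intro exI[of _ "n - k"]) simp
  qed
  then show ?thesis by (intro exI[of _ C] allI impI)
qed

text \<open>A geodesic between two points of the ray in the direction of the ray stays close to the ray in both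
  directions, and the ray leaves all balls. A geodesic in the opposite direction forms a degenerate
  triangle with one in the direction of the ray, hence is close to it.\<close>
lemma quasi_ray_tail_far:
  assumes r: "quasi_ray X d r" and x: "x \<in> X"
  shows "\<exists>N\<ge>0. \<forall>i j A u. N \<le> i \<longrightarrow> N \<le> j \<longrightarrow> sg (r i) (r j) A \<longrightarrow> u \<in> A \<longrightarrow> \<not> W x u \<rho> \<and> \<not> W u x \<rho>"
proof -
  obtain \<gamma> c \<beta> where nn: "0 \<le> \<gamma>" "0 \<le> c" "0 \<le> \<beta>"
    and chain: "chained X d r \<gamma> c \<beta>"
    using r unfolding quasi_ray_def by blast
  from geodesic_near_chain[OF nn] obtain C1 where C1: "\<forall>z a n P p. qg_chain X d \<gamma> c \<beta> z a n \<longrightarrow>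
      sg (z 0) (z n) P \<longrightarrow> p \<in> P \<longrightarrow> (\<exists>k\<le>n. W p (z k) C1)" ..
  from geodesic_near_chain_in[OF nn] obtain C2 where C2: "\<forall>z a n P p. qg_chain X d \<gamma> c \<beta> z a n \<longrightarrow>
      sg (z 0) (z n) P \<longrightarrow> p \<in> P \<longrightarrow> (\<exists>k\<le>n. W (z k) p C2)" ..
  define \<rho>' where "\<rho>' = \<rho> + 4 * \<delta> + 1"
  define M where "M = \<rho>' + \<bar>C1\<bar> + \<bar>C2\<bar>"
  obtain N where N: "0 \<le> N" "\<And>t. N \<le> t \<Longrightarrow> \<not> W x (r t) M \<and> \<not> W (r t) x M"
    using ideal_leaves[of r x M] r x by blast
  have fwd: "\<not> W x v \<rho>' \<and> \<not> W v x \<rho>'" if ij: "N \<le> i" "i \<le> j" and G: "sg (r i) (r j) G" and v: "v \<in> G" for i j G v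
  proof -
    obtain n u a where u: "u 0 = i" "u n = j" "\<And>k. k \<le> n \<Longrightarrow> i \<le> u k \<and> u k \<le> j"
      and ch: "qg_chain X d \<gamma> c \<beta> (\<lambda>k. r (u k)) a n"
    proof -
      have "0 \<le> i" using N ij by simp
      from chained_subdivision[OF chain this ij(2)] show ?thesis by (elim exE conjE) (rule that; simp)
    qed
    have G': "sg (r (u 0)) (r (u n)) G" using G u by simp
    obtain k where k: "k \<le> n" "W v (r (u k)) C1" using C1[rule_format, OF ch G' v] by blast
    obtain l where l: "l \<le> n" "W (r (u l)) v C2" using C2[rule_format, OF ch G' v] by blast
    have "N \<le> u k" "N \<le> u l" using u(3)[OF k(1)] u(3)[OF l(1)] ij by auto
    moreover have "W x (r (u k)) M" if "W x v \<rho>'"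
      using W_trans[OF that k(2)] by (rule W_mono) (simp add: M_def)
    moreover have "W (r (u l)) x M" if "W v x \<rho>'"
      using W_trans[OF l(2) that] by (rule W_mono) (simp add: M_def)
    ultimately show ?thesis using N(2) by blast
  qed
  have "\<not> W x u \<rho> \<and> \<not> W u x \<rho>" if ij: "N \<le> i" "N \<le> j" and A: "sg (r i) (r j) A" and u: "u \<in> A" for i j A u
  proof (cases "i \<le> j")
    case True
    then have "\<not> W x u \<rho>' \<and> \<not> W u x \<rho>'" using fwd ij A u by blast
    then show ?thesis using delta W_mono by (auto simp: \<rho>'_def)
  next
    case False
    then have "\<exists>\<rho>. W (r j) (r i) \<rho>" using quasi_ray_reach[OF r, of j i] ij N by simp
    then obtain G where G: "sg (r j) (r i) G" using seg_ex by blast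
    have iX: "r i \<in> X" "r j \<in> X" using seg_ends seg_subset G by blast+
    have ends: "r i \<in> G" "r j \<in> G" using seg_ends G by blast+
    obtain v where v: "v \<in> G" "W u v (4 * \<delta> + 1)"
      using out_close[OF A seg_const[OF iX(1)], of G u 1] G u ends by (auto simp: side_def)
    obtain v' where v': "v' \<in> G" "W v' u (4 * \<delta> + 1)"
      using in_close[OF A seg_const[OF iX(2)], of G u 1] G u ends by (auto simp: side_def)
    have "W x v \<rho>'" if "W x u \<rho>" using W_trans[OF that v(2)] by (simp add: \<rho>'_def add.assoc)
    moreover have "W v' x \<rho>'" if "W u x \<rho>"
      using W_trans[OF v'(2) that] by (simp add: \<rho>'_def algebra_simps)
    ultimately show ?thesis using fwd[of j i G] ij False G v v' by auto
  qed
  then show ?thesis by (intro exI[of _ N] conjI[OF N(1)] allI impI)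
qed

lemma ideal_tail_far:
  assumes r: "ideal X d r" and x: "x \<in> X"
  shows "\<exists>N\<ge>0. \<forall>i j A u. N \<le> i \<longrightarrow> N \<le> j \<longrightarrow> sg (r i) (r j) A \<longrightarrow> u \<in> A \<longrightarrow> \<not> W x u \<rho> \<and> \<not> W u x \<rho>"
proof (cases "quasi_ray X d r")
  case False
  then have "quasi_ray X (reversed d) r" using r by simp
  from thin_space.quasi_ray_tail_far[OF reversed this x, of \<rho>] obtain N where N: "0 \<le> N"
    "\<forall>i j A u. N \<le> i \<longrightarrow> N \<le> j \<longrightarrow> sg (r j) (r i) A \<longrightarrow> u \<in> A \<longrightarrow> \<not> W u x \<rho> \<and> \<not> W x u \<rho>"
    by auto
  show ?thesis
  proof (intro exI[of _ N] conjI allI impI)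
    fix i j A u assume "N \<le> i" "N \<le> j" "sg (r i) (r j) A" "u \<in> A"
    with N(2)[rule_format, of j i A u] show "\<not> W x u \<rho>" "\<not> W u x \<rho>" by auto
  qed (rule N(1))
qed (use quasi_ray_tail_far x in blast)

lemma quasi_ray_reversed_reach:
  assumes "quasi_ray X (reversed d) r" "0 \<le> i" "i \<le> j"
  shows "\<exists>\<rho>. W (r j) (r i) \<rho>"
  using thin_space.quasi_ray_reach[OF reversed assms] by simp

lemma quasi_ray_far:
  assumes r: "quasi_ray X d r" and s: "s \<in> X"
  shows "\<exists>N\<ge>0. \<forall>i j. N \<le> i \<longrightarrow> i \<le> j \<longrightarrow> far X d s m (r i) (r j)"
proof -
  from quasi_ray_tail_far[OF r s, of m] obtain N where N: "0 \<le> N" "\<forall>i j A u. N \<le> i \<longrightarrow> N \<le> j \<longrightarrow>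
      sg (r i) (r j) A \<longrightarrow> u \<in> A \<longrightarrow> \<not> W s u m \<and> \<not> W u s m" by blast
  have "far X d s m (r i) (r j)" if ij: "N \<le> i" "i \<le> j" for i j
  proof -
    have "\<exists>\<rho>. W (r i) (r j) \<rho>" using quasi_ray_reach[OF r, of i j] N(1) ij by simp
    then have "\<exists>A. sg (r i) (r j) A" using seg_ex by blast
    moreover have "avoids X d s m A" if "sg (r i) (r j) A" for A
      using N(2)[rule_format, OF _ _ that] ij by (intro not_W_avoids) auto
    ultimately show ?thesis by (simp add: far_def)
  qed
  then show ?thesis by (intro exI[of _ N] conjI[OF N(1)] allI impI)
qed

lemma quasi_ray_reversed_far:
  assumes r: "quasi_ray X (reversed d) r" and s: "s \<in> X"
  shows "\<exists>N\<ge>0. \<forall>i j. N \<le> i \<longrightarrow> i \<le> j \<longrightarrow> far X d s m (r j) (r i)"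
proof -
  from ideal_tail_far[OF disjI2[OF r] s, of m] obtain N where N: "0 \<le> N" "\<forall>i j A u. N \<le> i \<longrightarrow> N \<le> j \<longrightarrow>
      sg (r i) (r j) A \<longrightarrow> u \<in> A \<longrightarrow> \<not> W s u m \<and> \<not> W u s m" by blast
  have "far X d s m (r j) (r i)" if ij: "N \<le> i" "i \<le> j" for i j
  proof -
    have "\<exists>\<rho>. W (r j) (r i) \<rho>" using quasi_ray_reversed_reach[OF r, of i j] N(1) ij by simp
    then have "\<exists>A. sg (r j) (r i) A" using seg_ex by blast
    moreover have "avoids X d s m A" if "sg (r j) (r i) A" for A
      using N(2)[rule_format, OF _ _ that] ij by (intro not_W_avoids) auto
    ultimately show ?thesis by (simp add: far_def)
  qed
  then show ?thesis by (intro exI[of _ N] conjI[OF N(1)] allI impI)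
qed

lemma near_linked:
  assumes R: "ideal X d R" and s: "s \<in> X" and near: "near X d Q R"
  shows "linked X d s Q R UNIV UNIV"
  unfolding linked_def
proof (intro allI)
  fix m N :: real
  obtain M where M: "\<And>N. \<exists>j k. N \<le> j \<and> N \<le> k \<and> W (Q j) (R k) M" using near by (auto simp: near_def)
  obtain p where p: "\<And>t. p \<le> t \<Longrightarrow> \<not> W s (R t) (m + M)" using ideal_leaves[OF R s] by blast
  obtain j k where jk: "max N p \<le> j" "max N p \<le> k" "W (Q j) (R k) M" using M by blast
  have "avoids X d s m A" if A: "sg (Q j) (R k) A" for A
  proof (rule not_W_avoids)
    fix u assume u: "u \<in> A"
    have "W u (R k) M" using seg_W[OF A u jk(3)] by blast
    then show "\<not> W s u m" using W_trans p[of k] jk by auto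
  qed
  moreover have "\<exists>A. sg (Q j) (R k) A" using jk seg_ex by blast
  ultimately have "far X d s m (Q j) (R k)" by (simp add: far_def)
  then show "\<exists>j\<in>UNIV. \<exists>l\<in>UNIV. N \<le> j \<and> N \<le> l \<and> far X d s m (Q j) (R l)" using jk by auto
qed

text \<open>On a ray follow \<open>Q\<close> from the prescribed parameter to a later one with a connection; on an anti-ray choose
  the connection first and follow \<open>Q\<close> to it from a prescribed parameter further out.\<close>
lemma linked_left:
  assumes Q: "ideal X d Q" and s: "s \<in> X" and l: "linked X d s Q R UNIV L" and J: "unbounded_above J"
  shows "linked X d s Q R J L"
  unfolding linked_def
proof (intro allI)
  fix m N :: real
  let ?m = "m + 4 * \<delta>"
  have L: "\<exists>j l. l \<in> L \<and> N \<le> j \<and> N \<le> l \<and> far X d s ?m (Q j) (R l)" for N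
    using l unfolding linked_def by blast
  show "\<exists>j\<in>J. \<exists>l\<in>L. N \<le> j \<and> N \<le> l \<and> far X d s m (Q j) (R l)"
  proof (cases "quasi_ray X d Q")
    case True
    from quasi_ray_far[OF this s] obtain N1 where N1: "\<forall>i j. N1 \<le> i \<longrightarrow> i \<le> j \<longrightarrow> far X d s ?m (Q i) (Q j)"
      by blast
    obtain j where j: "j \<in> J" "max N N1 \<le> j" using J unfolding unbounded_above_def by blast
    obtain j1 l where jl: "l \<in> L" "j \<le> j1" "j \<le> l" "far X d s ?m (Q j1) (R l)" using L by blast
    have "far X d s m (Q j) (R l)" using far_trans[OF N1[rule_format] jl(4)] j jl by auto
    then show ?thesis using j jl by (intro bexI[of _ j] bexI[of _ l]) auto
  next
    case False
    then have "quasi_ray X (reversed d) Q" using Q by simp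
    from quasi_ray_reversed_far[OF this s] obtain N1 where N1: "\<forall>i j. N1 \<le> i \<longrightarrow> i \<le> j \<longrightarrow> far X d s ?m (Q j) (Q i)"
      by blast
    obtain j1 l where jl: "l \<in> L" "max N N1 \<le> j1" "max N N1 \<le> l" "far X d s ?m (Q j1) (R l)" using L by blast
    obtain j where j: "j \<in> J" "j1 \<le> j" using J unfolding unbounded_above_def by blast
    have "far X d s m (Q j) (R l)" using far_trans[OF N1[rule_format] jl(4)] j jl by auto
    then show ?thesis using j jl by (intro bexI[of _ j] bexI[of _ l]) auto
  qed
qed

lemma linked_right:
  assumes R: "ideal X d R" and s: "s \<in> X" and l: "linked X d s Q R J UNIV" and L: "unbounded_above L"
  shows "linked X d s Q R J L"
  unfolding linked_def
proof (intro allI)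
  fix m N :: real
  let ?m = "m + 4 * \<delta>"
  have J: "\<exists>j l. j \<in> J \<and> N \<le> j \<and> N \<le> l \<and> far X d s ?m (Q j) (R l)" for N
    using l unfolding linked_def by blast
  show "\<exists>j\<in>J. \<exists>l\<in>L. N \<le> j \<and> N \<le> l \<and> far X d s m (Q j) (R l)"
  proof (cases "quasi_ray X d R")
    case True
    from quasi_ray_far[OF this s] obtain N1 where N1: "\<forall>i j. N1 \<le> i \<longrightarrow> i \<le> j \<longrightarrow> far X d s ?m (R i) (R j)"
      by blast
    obtain j l1 where jl: "j \<in> J" "max N N1 \<le> j" "max N N1 \<le> l1" "far X d s ?m (Q j) (R l1)" using J by blast
    obtain l where l: "l \<in> L" "l1 \<le> l" using L unfolding unbounded_above_def by blast
    have "far X d s m (Q j) (R l)" using far_trans[OF jl(4) N1[rule_format]] l jl by auto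
    then show ?thesis using l jl by (intro bexI[of _ j] bexI[of _ l]) auto
  next
    case False
    then have "quasi_ray X (reversed d) R" using R by simp
    from quasi_ray_reversed_far[OF this s] obtain N1 where N1: "\<forall>i j. N1 \<le> i \<longrightarrow> i \<le> j \<longrightarrow> far X d s ?m (R j) (R i)"
      by blast
    obtain l where l: "l \<in> L" "max N N1 \<le> l" using L unfolding unbounded_above_def by blast
    obtain j l1 where jl: "j \<in> J" "l \<le> j" "l \<le> l1" "far X d s ?m (Q j) (R l1)" using J by blast
    have "far X d s m (Q j) (R l)" using far_trans[OF jl(4) N1[rule_format]] l jl by auto
    then show ?thesis using l jl by (intro bexI[of _ j] bexI[of _ l]) auto
  qed
qed

text \<open>The parameters on \<open>R\<close> from which \<open>Q'\<close> is reached are unbounded, so the connection from \<open>Q\<close> to \<open>R\<close> can be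
  chosen to end at one of them.\<close>
lemma linked_trans:
  assumes R: "ideal X d R" and s: "s \<in> X"
    and 1: "linked X d s Q R UNIV UNIV" and 2: "linked X d s R Q' UNIV UNIV"
  shows "linked X d s Q Q' UNIV UNIV"
  unfolding linked_def
proof (intro allI)
  fix m N :: real
  let ?m = "m + 4 * \<delta>"
  define K where "K = {k. \<exists>l\<ge>N. far X d s ?m (R k) (Q' l)}"
  have "unbounded_above K"
    unfolding unbounded_above_def
  proof
    fix N'
    obtain k l where "max N N' \<le> k" "max N N' \<le> l" "far X d s ?m (R k) (Q' l)"
      using 2 unfolding linked_def by blast
    then show "\<exists>j\<in>K. N' \<le> j" unfolding K_def by (intro bexI[of _ k]) auto
  qed
  from linked_right[OF R s 1 this] obtain j k where jk: "k \<in> K" "N \<le> j" "far X d s ?m (Q j) (R k)"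
    unfolding linked_def by blast
  then obtain l where "N \<le> l" "far X d s ?m (R k) (Q' l)" by (auto simp: K_def)
  then have "far X d s m (Q j) (Q' l)" using far_trans[OF jk(3)] by fastforce
  with jk \<open>N \<le> l\<close> show "\<exists>j\<in>UNIV. \<exists>l\<in>UNIV. N \<le> j \<and> N \<le> l \<and> far X d s m (Q j) (Q' l)" by blast
qed

end

section \<open>Geodesics that avoid a base point\<close>

text \<open>Points that are close to \<open>s\<close> and reach the far part of \<open>T\<close> are at bounded distance from a fixed point
  \<open>w\<close>. Hence they are not reached within a given distance from points far out on another ray.\<close>
definition anchored :: "'a set \<Rightarrow> ('a \<Rightarrow> 'a \<Rightarrow> ennreal) \<Rightarrow> 'a \<Rightarrow> real \<Rightarrow> (real \<Rightarrow> 'a) \<Rightarrow> bool" where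
  "anchored X d s \<sigma> T \<longleftrightarrow> (\<exists>w\<in>X. \<exists>A M. \<forall>p t r. M \<le> t \<longrightarrow> reaches X d s p \<sigma> \<longrightarrow>
     reaches X d p (T t) r \<longrightarrow> reaches X d p w A)"

text \<open>The representatives of the points of \<open>X\<close> and of the boundary.\<close>
definition point_or_ideal :: "'a set \<Rightarrow> ('a \<Rightarrow> 'a \<Rightarrow> ennreal) \<Rightarrow> (real \<Rightarrow> 'a) \<Rightarrow> bool" where
  "point_or_ideal X d r \<longleftrightarrow> (\<exists>x\<in>X. r = (\<lambda>_. x)) \<or> ideal X d r"

lemma point_or_ideal_reversed [simp]: "point_or_ideal X (reversed d) r \<longleftrightarrow> point_or_ideal X d r"
  by (auto simp: point_or_ideal_def)

definition joined :: "'a set \<Rightarrow> ('a \<Rightarrow> 'a \<Rightarrow> ennreal) \<Rightarrow> (real \<Rightarrow> 'a) \<Rightarrow> (real \<Rightarrow> 'a) \<Rightarrow> bool" where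
  "joined X d Q R \<longleftrightarrow> (\<forall>N. \<exists>i j r. N \<le> i \<and> N \<le> j \<and> reaches X d (Q i) (R j) r)"

lemma joined_reversed [simp]: "joined X (reversed d) Q R \<longleftrightarrow> joined X d R Q"
  unfolding joined_def by (simp, rule all_cong1) blast

definition eventually_avoids :: "'a set \<Rightarrow> ('a \<Rightarrow> 'a \<Rightarrow> ennreal) \<Rightarrow> 'a \<Rightarrow> real \<Rightarrow> (real \<Rightarrow> 'a) \<Rightarrow> (real \<Rightarrow> 'a) \<Rightarrow> bool" where
  "eventually_avoids X d s m Q R \<longleftrightarrow> (\<exists>N. \<forall>i j A. N \<le> i \<longrightarrow> N \<le> j \<longrightarrow> seg X d (Q i) (R j) A \<longrightarrow> avoids X d s m A)"

text \<open>Two representatives of the same point. For a boundary point, \<open>V\<close> is a representative that generates the class.\<close>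
definition common_limit :: "'a set \<Rightarrow> ('a \<Rightarrow> 'a \<Rightarrow> ennreal) \<Rightarrow> (real \<Rightarrow> 'a) \<Rightarrow> (real \<Rightarrow> 'a) \<Rightarrow> bool" where
  "common_limit X d Q R \<longleftrightarrow> (\<exists>z\<in>X. Q = (\<lambda>_. z) \<and> R = (\<lambda>_. z)) \<or>
     (ideal X d Q \<and> ideal X d R \<and> (\<exists>V. ideal X d V \<and> near X d Q V \<and> near X d V R))"

lemma common_limit_reversed: "common_limit X (reversed d) R Q \<longleftrightarrow> common_limit X d Q R"
  unfolding common_limit_def near_reversed reversed_reversed by blast

context thin_space
begin

text \<open>If \<open>s\<close> reaches \<open>p\<close>, and \<open>p\<close> reaches \<open>T\<close> and thereby \<open>w\<close>, then \<open>p\<close> and \<open>w\<close> lie in an out-ball around \<open>s\<close>,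
  whose radius is determined by \<open>s\<close> and \<open>w\<close>, so (B1) applies.\<close>
lemma anchored_if_reaching:
  assumes s: "s \<in> X" and w: "w \<in> X" and T: "\<And>t. M \<le> t \<Longrightarrow> \<exists>r. W (T t) w r"
  shows "anchored X d s \<sigma> T"
proof (cases "\<exists>r. W s w r")
  case True
  then obtain r0 where r0: "W s w r0" by blast
  have "W p w (f (max \<sigma> r0))" if "M \<le> t" "W s p \<sigma>" "W p (T t) r" for p t r
  proof -
    have "\<exists>r. W p w r" using T[OF that(1)] W_trans that(3) by blast
    moreover have "W s p (max \<sigma> r0)" "W s w (max \<sigma> r0)" using that(2) r0 W_mono by auto
    ultimately show ?thesis using B1 W_D by blast
  qed
  then show ?thesis unfolding anchored_def using w by blast
next
  case False
  have "\<not> W p (T t) r" if "M \<le> t" "W s p \<sigma>" for p t r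
    using T[OF that(1)] that(2) False W_trans by blast
  then show ?thesis unfolding anchored_def using w by blast
qed

text \<open>Let \<open>w = T M\<close> be far out on the ray and reachable from \<open>s\<close>. A geodesic from \<open>p\<close> to \<open>T t\<close> leaves the
  out-neighbourhood of \<open>s\<close> and \<open>p\<close> after bounded length by (B1), so a point of it reaches a geodesic \<open>H\<close> from
  \<open>s\<close> to \<open>T t\<close>. By \<open>out_close\<close> the triangle of \<open>s\<close>, \<open>w\<close> and \<open>T t\<close> leads on to a geodesic from \<open>s\<close> to \<open>w\<close>,
  because the side on \<open>T\<close> is too far from \<open>s\<close>. Hence \<open>p\<close> reaches \<open>w\<close>, and (B1) bounds the distance.\<close>
lemma anchored_quasi_ray:
  assumes s: "s \<in> X" and T: "quasi_ray X d T"
  shows "anchored X d s \<sigma> T"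
proof -
  define \<Sigma> where "\<Sigma> = \<sigma> + f (\<sigma> + \<delta>) + 5 * \<delta> + 2"
  obtain N where N: "0 \<le> N" and far: "\<And>i j. N \<le> i \<Longrightarrow> i \<le> j \<Longrightarrow> far X d s (\<Sigma> + 1) (T i) (T j)"
    using quasi_ray_far[OF T s, of "\<Sigma> + 1"] by blast
  show ?thesis
  proof (cases "\<exists>M\<ge>N. \<exists>r. W s (T M) r")
    case False
    have "\<not> W p (T t) r" if "N \<le> t" "W s p \<sigma>" for p t r
      using False that W_trans by blast
    then show ?thesis unfolding anchored_def using s by blast
  next
    case True
    then obtain M r0 where M: "N \<le> M" and r0: "W s (T M) r0" by blast
    let ?w = "T M"
    have "W p ?w (f (max \<sigma> r0))" if t: "M \<le> t" and sp: "W s p \<sigma>" and py: "W p (T t) r" for p t r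
    proof -
      let ?y = "T t"
      have \<sigma>0: "0 \<le> \<sigma>" and f0: "0 \<le> f (\<sigma> + \<delta>)" using W_D[OF sp] f_nonneg[OF s] delta by auto
      obtain P where P: "sg p ?y P" using seg_ex py by blast
      obtain S where S: "sg s p S" using seg_ex sp by blast
      obtain H where H: "sg s ?y H" using seg_ex W_trans[OF sp py] by blast
      obtain H0 where H0: "sg s ?w H0" using seg_ex r0 by blast
      obtain Y where Y: "sg ?w ?y Y" using far[OF M t] by (auto simp: far_def)
      have av: "avoids X d s (\<Sigma> + 1) Y" using far[OF M t] Y by (auto simp: far_def)
      obtain g D where g: "isom_geod X d g D" "0 \<le> D" "g 0 = p" "g D = ?y" "P = g ` {0..D}"
        using P by (rule segE)
      define a where "a = min D (f (\<sigma> + \<delta>) + 1)"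
      have a: "0 \<le> a" "a \<le> D" using g f0 by (auto simp: a_def)
      have pa: "W p (g a) a" using isom_W[OF g(1), of 0 a] a g by auto
      have "\<exists>h\<in>H. W (g a) h \<delta>"
      proof -
        have "g a \<in> P" using g a by auto
        moreover have "sd p s S" "sd ?y s H" using S H by (auto simp: side_def)
        ultimately consider q where "q \<in> S" "W q (g a) \<delta>" | "\<exists>h\<in>H. W (g a) h \<delta>"
          using thin[OF P] by blast
        then show ?thesis
        proof cases
          case 1
          then have "W s (g a) (\<sigma> + \<delta>)" using seg_W[OF S 1(1) sp] W_trans by blast
          moreover have "W s p (\<sigma> + \<delta>)" using sp delta W_mono by auto
          ultimately have "W p (g a) (f (\<sigma> + \<delta>))" using B1 pa W_D by blast
          then have "a \<le> f (\<sigma> + \<delta>)" using isom_le[OF g(1), of 0 a] a g by auto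
          then have "a = D" by (auto simp: a_def)
          then have "g a = ?y" using g by simp
          then show ?thesis using seg_ends[OF H] W_refl delta W_D py by metis
        qed
      qed
      then obtain h where h: "h \<in> H" "W (g a) h \<delta>" by blast
      have ph: "W p h (a + \<delta>)" using W_trans pa h by blast
      obtain u where u: "u \<in> H0 \<union> Y" "W h u (4 * \<delta> + 1)"
        using out_close[OF H H0 _ h(1), of Y 1] Y by (auto simp: side_def)
      have pu: "W p u (a + \<delta> + (4 * \<delta> + 1))" using W_trans ph u by blast
      have "u \<notin> Y"
      proof
        assume "u \<in> Y"
        moreover have "W s u (\<sigma> + (a + \<delta> + (4 * \<delta> + 1)))" using W_trans sp pu by blast
        ultimately have "\<Sigma> + 1 \<le> \<sigma> + (a + \<delta> + (4 * \<delta> + 1))" using av unfolding avoids_def by blast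
        then show False by (auto simp: \<Sigma>_def a_def)
      qed
      then have "u \<in> H0" using u by blast
      then have "\<exists>r. W u ?w r" using seg_W_ex[OF H0] by blast
      then have "\<exists>r. W p ?w r" using pu W_trans by blast
      moreover have "W s p (max \<sigma> r0)" "W s ?w (max \<sigma> r0)" using sp r0 W_mono by auto
      ultimately show ?thesis using B1 W_D by blast
    qed
    moreover have "?w \<in> X" using r0 W_D by blast
    ultimately show ?thesis unfolding anchored_def by blast
  qed
qed

text \<open>A point and an anti-ray reach a fixed point from all parameters, for a ray this is the preceding lemma.\<close>
lemma anchored_point_or_ideal:
  assumes s: "s \<in> X" and T: "point_or_ideal X d T"
  shows "anchored X d s \<sigma> T"
  using T unfolding point_or_ideal_def
proof (elim disjE bexE)
  fix x assume "x \<in> X" "T = (\<lambda>_. x)"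
  then show ?thesis using anchored_if_reaching[OF s, of x 0 T] W_refl[of x 0] by auto
next
  assume T: "quasi_ray X (reversed d) T"
  have "T 0 \<in> X" using T by (auto simp: quasi_ray_def)
  then show ?thesis using anchored_if_reaching[OF s, of "T 0" 0 T] quasi_ray_reversed_reach[OF T, of 0] by auto
qed (rule anchored_quasi_ray[OF s])

lemma backward_reach:
  assumes "point_or_ideal X d R" "\<not> quasi_ray X d R" "0 \<le> i" "i \<le> j"
  shows "\<exists>r. W (R j) (R i) r"
  using assms W_refl quasi_ray_reversed_reach unfolding point_or_ideal_def by fastforce

lemma forward_reach:
  assumes "point_or_ideal X d R" "\<not> quasi_ray X (reversed d) R" "0 \<le> i" "i \<le> j"
  shows "\<exists>r. W (R i) (R j) r"
  using assms W_refl quasi_ray_reach unfolding point_or_ideal_def by fastforce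

text \<open>The parameters \<open>i\<close> for which \<open>R i\<close> reaches \<open>R i0\<close>: all later ones, unless \<open>R\<close> is a ray and only \<open>i0\<close> is safe.\<close>
definition start_index :: "(real \<Rightarrow> 'a) \<Rightarrow> real \<Rightarrow> real \<Rightarrow> bool" where
  "start_index R i0 i \<longleftrightarrow> i = i0 \<or> i0 \<le> i \<and> \<not> quasi_ray X d R"

text \<open>The parameters \<open>k\<close> for which \<open>T k0\<close> reaches \<open>T k\<close>: all later ones, unless \<open>T\<close> is an anti-ray and only \<open>k0\<close> is safe.\<close>
definition end_index :: "(real \<Rightarrow> 'a) \<Rightarrow> real \<Rightarrow> real \<Rightarrow> bool" where
  "end_index T k0 k \<longleftrightarrow> k = k0 \<or> k0 \<le> k \<and> \<not> quasi_ray X (reversed d) T"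

lemma start_index_reach:
  assumes "point_or_ideal X d R" "start_index R i0 i" "0 \<le> i0" "W (R i0) y r"
  shows "\<exists>r. W (R i) y r"
  using assms backward_reach[OF assms(1), of i0 i] W_trans unfolding start_index_def by blast

lemma end_index_reach:
  assumes "point_or_ideal X d T" "end_index T k0 k" "0 \<le> k0" "W x (T k0) r"
  shows "\<exists>r. W x (T k) r"
  using assms forward_reach[OF assms(1), of k0 k] W_trans unfolding end_index_def by blast

text \<open>Choose connections from \<open>R i0\<close> to \<open>Q j\<close>, from \<open>Q j\<close> to \<open>Q' l\<close> and from \<open>Q' l\<close> to \<open>T k0\<close>, all of them far from \<open>s\<close>.
  They form a transitive quadrangle, and two applications of \<open>far_trans\<close> cost \<open>8\<delta>\<close>. For a point of \<open>X\<close>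
  in the middle, \<open>Q j\<close> and \<open>Q' l\<close> coincide and the quadrangle is a triangle.\<close>
lemma long_sides_far:
  assumes s: "s \<in> X" and R: "point_or_ideal X d R" and T: "point_or_ideal X d T"
    and QQ': "common_limit X d Q Q'"
    and j1: "joined X d R Q" and j2: "joined X d Q' T"
    and e1: "eventually_avoids X d s m R Q" and e2: "eventually_avoids X d s m Q' T"
  shows "\<exists>i0\<ge>N. \<exists>k0\<ge>N. \<forall>i k. start_index R i0 i \<longrightarrow> end_index T k0 k \<longrightarrow> far X d s (m - 8 * \<delta>) (R i) (T k)"
proof -
  obtain N1 where N1: "\<And>i j A. N1 \<le> i \<Longrightarrow> N1 \<le> j \<Longrightarrow> sg (R i) (Q j) A \<Longrightarrow> avoids X d s m A"
    using e1 unfolding eventually_avoids_def by blast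
  obtain N2 where N2: "\<And>i j A. N2 \<le> i \<Longrightarrow> N2 \<le> j \<Longrightarrow> sg (Q' i) (T j) A \<Longrightarrow> avoids X d s m A"
    using e2 unfolding eventually_avoids_def by blast
  define N' where "N' = max (max N 0) (max N1 N2)"
  define J where "J = {j. N' \<le> j \<and> (\<exists>i\<ge>N'. \<exists>r. W (R i) (Q j) r)}"
  define L where "L = {l. N' \<le> l \<and> (\<exists>k\<ge>N'. \<exists>r. W (Q' l) (T k) r)}"
  have uJ: "unbounded_above J"
    unfolding unbounded_above_def
  proof
    fix n
    obtain i j r where "max n N' \<le> i" "max n N' \<le> j" "W (R i) (Q j) r" using j1 unfolding joined_def by blast
    then show "\<exists>j\<in>J. n \<le> j" unfolding J_def by (intro bexI[of _ j]) auto
  qed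
  have uL: "unbounded_above L"
    unfolding unbounded_above_def
  proof
    fix n
    obtain l k r where "max n N' \<le> l" "max n N' \<le> k" "W (Q' l) (T k) r" using j2 unfolding joined_def by blast
    then show "\<exists>l\<in>L. n \<le> l" unfolding L_def by (intro bexI[of _ l]) auto
  qed
  have "\<exists>j\<in>J. \<exists>l\<in>L. Q j = Q' l \<or> far X d s m (Q j) (Q' l)"
  proof -
    consider z where "Q = (\<lambda>_. z)" "Q' = (\<lambda>_. z)"
      | V where "ideal X d Q" "ideal X d Q'" "ideal X d V" "near X d Q V" "near X d V Q'"
      using QQ' unfolding common_limit_def by blast
    then show ?thesis
    proof cases
      case 1
      obtain j l where "j \<in> J" "l \<in> L" using uJ uL unfolding unbounded_above_def by blast
      then show ?thesis using 1 by auto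
    next
      case V: 2
      have "linked X d s Q Q' UNIV UNIV"
        using linked_trans[OF V(3) s near_linked[OF V(3) s V(4)] near_linked[OF V(2) s V(5)]] .
      from linked_right[OF V(2) s linked_left[OF V(1) s this uJ] uL] have "linked X d s Q Q' J L" .
      then show ?thesis unfolding linked_def by blast
    qed
  qed
  then obtain j l where jl: "j \<in> J" "l \<in> L" "Q j = Q' l \<or> far X d s m (Q j) (Q' l)" by blast
  obtain i0 r1 where i0: "N' \<le> i0" "W (R i0) (Q j) r1" and j: "N' \<le> j" using jl(1) by (auto simp: J_def)
  obtain k0 r2 where k0: "N' \<le> k0" "W (Q' l) (T k0) r2" and l: "N' \<le> l" using jl(2) by (auto simp: L_def)
  have "far X d s (m - 8 * \<delta>) (R i) (T k)" if i: "start_index R i0 i" and k: "end_index T k0 k" for i k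
  proof -
    have "i0 \<le> i" "k0 \<le> k" using i k by (auto simp: start_index_def end_index_def)
    have "\<exists>r. W (R i) (Q j) r" using start_index_reach[OF R i _ i0(2)] i0(1) by (auto simp: N'_def)
    then have f1: "far X d s m (R i) (Q j)"
      unfolding far_def using N1[of i j] seg_ex \<open>i0 \<le> i\<close> i0(1) j by (auto simp: N'_def)
    have "\<exists>r. W (Q' l) (T k) r" using end_index_reach[OF T k _ k0(2)] k0(1) by (auto simp: N'_def)
    then have f2: "far X d s m (Q' l) (T k)"
      unfolding far_def using N2[of l k] seg_ex \<open>k0 \<le> k\<close> k0(1) l by (auto simp: N'_def)
    show ?thesis
    proof (cases "Q j = Q' l")
      case True
      then show ?thesis using far_trans[OF f1] f2 far_mono delta by fastforce
    next
      case False
      then have "far X d s m (Q j) (Q' l)" using jl by blast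
      from far_trans[OF f1 this] far_mono[OF f2, of "m - 4 * \<delta>"] delta
      show ?thesis using far_trans[of s "m - 4 * \<delta>" "R i" "Q' l" "T k"] by simp
    qed
  qed
  moreover have "N \<le> i0" "N \<le> k0" using i0 k0 by (auto simp: N'_def)
  ultimately show ?thesis by blast
qed

text \<open>Let \<open>p\<close> lie on a geodesic from \<open>R i\<close> to \<open>T k\<close>, with \<open>s\<close> reaching \<open>p\<close> within \<open>r\<close>. If \<open>R\<close> is a ray, then the geodesic is a
  side of the triangle with the vertex \<open>R i0\<close>, and thinness yields a point \<open>h\<close> on the side from \<open>R i0\<close> to \<open>T k\<close>
  that is reached from \<open>p\<close>. The other possibility is a point \<open>q\<close> on the side along \<open>R\<close> that reaches \<open>p\<close>; then \<open>q\<close>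
  reaches the anchor \<open>w\<close> of \<open>T\<close> within a distance that does not depend on \<open>i0\<close>, and is too far out for that.
  If \<open>T\<close> is an anti-ray, then \<open>out_close\<close> in the triangle with the vertex \<open>T k0\<close> leads to the side that ends
  at \<open>T k0\<close>, since the side along \<open>T\<close> is far. The sides obtained in the end are those of \<open>long_sides_far\<close>.
  The total cost is at most \<open>\<delta> + 4\<delta> + 8\<delta>\<close>.\<close>
lemma avoid_transfer:
  assumes s: "s \<in> X" and R: "point_or_ideal X d R" and T: "point_or_ideal X d T"
    and QQ': "common_limit X d Q Q'"
    and j1: "joined X d R Q" and j2: "joined X d Q' T"
    and e1: "eventually_avoids X d s m R Q" and e2: "eventually_avoids X d s m Q' T"
  shows "eventually_avoids X d s (m - 13 * \<delta>) R T" and "joined X d R T"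
proof -
  note long = long_sides_far[OF assms]
  show "joined X d R T"
    unfolding joined_def
  proof
    fix N
    obtain i0 k0 where "N \<le> i0" "N \<le> k0" "far X d s (m - 8 * \<delta>) (R i0) (T k0)"
      using long[of N] unfolding start_index_def end_index_def by blast
    then show "\<exists>i j r. N \<le> i \<and> N \<le> j \<and> W (R i) (T j) r" unfolding far_def using seg_W_ends by blast
  qed
  \<comment> \<open>the order of choices matters: the anchor depends only on \<open>s\<close>, \<open>T\<close> and \<open>\<sigma>\<close>, and \<open>i0\<close> is chosen afterwards\<close>
  define \<sigma> where "\<sigma> = m - 13 * \<delta>"
  obtain w A M where w: "w \<in> X" and anchor: "\<And>p t r. M \<le> t \<Longrightarrow> W s p \<sigma> \<Longrightarrow> W p (T t) r \<Longrightarrow> W p w A"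
    using anchored_point_or_ideal[OF s T, of \<sigma>] unfolding anchored_def by blast
  have "\<exists>N\<ge>0. quasi_ray X d R \<longrightarrow> (\<forall>i j B u. N \<le> i \<longrightarrow> N \<le> j \<longrightarrow> sg (R i) (R j) B \<longrightarrow> u \<in> B \<longrightarrow> \<not> W u w (\<delta> + A))"
  proof (cases "quasi_ray X d R")
    case True
    show ?thesis using quasi_ray_tail_far[OF True w, of "\<delta> + A"] by blast
  qed auto
  then obtain N1 where N1: "0 \<le> N1" "\<And>i j B u. quasi_ray X d R \<Longrightarrow> N1 \<le> i \<Longrightarrow> N1 \<le> j \<Longrightarrow> sg (R i) (R j) B \<Longrightarrow> u \<in> B \<Longrightarrow> \<not> W u w (\<delta> + A)" by blast
  have "\<exists>N\<ge>0. quasi_ray X (reversed d) T \<longrightarrow> (\<forall>i j. N \<le> i \<longrightarrow> i \<le> j \<longrightarrow> far X d s (m - 8 * \<delta>) (T j) (T i))"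
  proof (cases "quasi_ray X (reversed d) T")
    case True
    show ?thesis using quasi_ray_reversed_far[OF True s, of "m - 8 * \<delta>"] by blast
  qed auto
  then obtain N2 where N2: "0 \<le> N2" "\<And>i j. quasi_ray X (reversed d) T \<Longrightarrow> N2 \<le> i \<Longrightarrow> i \<le> j \<Longrightarrow> far X d s (m - 8 * \<delta>) (T j) (T i)" by blast
  obtain i0 k0 where i0: "max N1 N2 \<le> i0" and k0: "max N1 N2 \<le> k0"
    and G: "\<And>i k. start_index R i0 i \<Longrightarrow> end_index T k0 k \<Longrightarrow> far X d s (m - 8 * \<delta>) (R i) (T k)"
    using long[of "max N1 N2"] by blast
  have "\<sigma> \<le> r" if i: "max i0 (max k0 M) \<le> i" and k: "max i0 (max k0 M) \<le> k" and P: "sg (R i) (T k) P"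
    and p: "p \<in> P" and spr: "W s p r" for i k P p r
  proof (rule ccontr)
    assume "\<not> ?thesis"
    then have r\<sigma>: "r < \<sigma>" by simp
    have sp: "W s p \<sigma>" using W_mono[OF spr] r\<sigma> by simp
    obtain r' where py: "W p (T k) r'" using seg_W_ex[OF P p] by blast
    obtain i' H h where i': "start_index R i0 i'" and H: "sg (R i') (T k) H" and h: "h \<in> H" "W s h (r + \<delta>)"
    proof (cases "quasi_ray X d R")
      case False
      then have "start_index R i0 i" using i by (simp add: start_index_def)
      moreover have "W s p (r + \<delta>)" using W_mono[OF spr] delta by simp
      ultimately show ?thesis using that[of i P p] P p by blast
    next
      case True
      have "\<exists>r. W (R i0) (R i) r" using quasi_ray_reach[OF True, of i0 i] i i0 N1(1) by simp
      then obtain r2 where r2: "W (R i0) (R i) r2" by blast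
      then obtain B where B: "sg (R i0) (R i) B" using seg_ex by blast
      have "\<exists>r. W (R i0) (T k) r" using r2 seg_W_ends[OF P] W_trans by blast
      then obtain H where H: "sg (R i0) (T k) H" using seg_ex by blast
      have "sd (R i) (R i0) B" "sd (T k) (R i0) H" using B H by (auto simp: side_def)
      from thin[OF P this p] consider q where "q \<in> B" "W q p \<delta>" | h where "h \<in> H" "W p h \<delta>" by blast
      then show ?thesis
      proof cases
        case 1
        have "W p w A" using anchor[OF _ sp py] k by simp
        then have "W q w (\<delta> + A)" using 1 W_trans by blast
        then show ?thesis using N1(2)[OF True _ _ B 1(1)] i i0 by auto
      next
        case 2
        have "start_index R i0 i0" by (simp add: start_index_def)
        then show ?thesis using that[of i0 H h] H 2 W_trans[OF spr] by blast
      qed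
    qed
    have "m - 13 * \<delta> \<le> r"
    proof (cases "quasi_ray X (reversed d) T")
      case False
      then have "end_index T k0 k" using k by (simp add: end_index_def)
      from G[OF i' this] have "m - 8 * \<delta> \<le> r + \<delta>" using H h unfolding far_def avoids_def by blast
      then show ?thesis using delta by simp
    next
      case True
      have "far X d s (m - 8 * \<delta>) (T k) (T k0)" using N2(2)[OF True] k0 k by simp
      then obtain Y where Y: "sg (T k) (T k0) Y" "avoids X d s (m - 8 * \<delta>) Y" unfolding far_def by blast
      have "end_index T k0 k0" by (simp add: end_index_def)
      from G[OF i' this] obtain G' where G': "sg (R i') (T k0) G'" "avoids X d s (m - 8 * \<delta>) G'"
        unfolding far_def by blast
      have "avoids X d s (m - 8 * \<delta> - 4 * \<delta>) H"
        using avoids_close[OF H G'(1) _ G'(2) Y(2)] Y(1) by (simp add: side_def)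
      then have "m - 8 * \<delta> - 4 * \<delta> \<le> r + \<delta>" using h unfolding avoids_def by blast
      then show ?thesis by simp
    qed
    then show False using r\<sigma> by (simp add: \<sigma>_def)
  qed
  then show "eventually_avoids X d s (m - 13 * \<delta>) R T"
    unfolding eventually_avoids_def avoids_def \<sigma>_def by blast
qed

text \<open>Reversal of the distance interchanges \<open>R\<close> with \<open>T\<close> and \<open>Q\<close> with \<open>Q'\<close>.\<close>
lemma avoid_transfer_in:
  assumes s: "s \<in> X" and R: "point_or_ideal X d R" and T: "point_or_ideal X d T"
    and QQ': "common_limit X d Q Q'"
    and j1: "joined X d R Q" and j2: "joined X d Q' T"
    and e1: "eventually_avoids X (reversed d) s m Q R" and e2: "eventually_avoids X (reversed d) s m T Q'"
  shows "eventually_avoids X (reversed d) s (m - 13 * \<delta>) T R"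
proof (rule thin_space.avoid_transfer(1)[OF reversed s])
  show "common_limit X (reversed d) Q' Q" using QQ' by (simp add: common_limit_reversed)
qed (use assms in simp_all)

lemma ideal_self:
  assumes r: "ideal X d r" and s: "s \<in> X"
  shows "eventually_avoids X d s m r r" "eventually_avoids X (reversed d) s m r r" "joined X d r r"
proof -
  obtain N where N: "\<forall>i j A u. N \<le> i \<longrightarrow> N \<le> j \<longrightarrow> sg (r i) (r j) A \<longrightarrow> u \<in> A \<longrightarrow> \<not> W s u m \<and> \<not> W u s m"
    using ideal_tail_far[OF r s, of m] by blast
  show "eventually_avoids X d s m r r"
    unfolding eventually_avoids_def
  proof (intro exI[of _ N] allI impI not_W_avoids)
    fix i j A u assume "N \<le> i" "N \<le> j" "sg (r i) (r j) A" "u \<in> A"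
    then show "\<not> W s u m" using N by blast
  qed
  show "eventually_avoids X (reversed d) s m r r"
    unfolding eventually_avoids_def
  proof (intro exI[of _ N] allI impI thin_space.not_W_avoids[OF reversed])
    fix i j A u assume "N \<le> i" "N \<le> j" "seg X (reversed d) (r i) (r j) A" "u \<in> A"
    then show "\<not> reaches X (reversed d) s u m" using N by simp
  qed
  show "joined X d r r"
    unfolding joined_def
  proof
    fix N :: real
    have "max N 0 \<in> {0..}" by simp
    moreover have "r (max N 0) \<in> X" using r by (auto simp: quasi_ray_def)
    ultimately show "\<exists>i j \<rho>. N \<le> i \<and> N \<le> j \<and> W (r i) (r j) \<rho>"
      using W_refl[of "r (max N 0)" 0] by (intro exI[of _ "max N 0"] exI[of _ 0]) auto
  qed
qed

text \<open>The initial part of length \<open>\<delta> + 1\<close> of the geodesic lies in an out-ball of this radius.\<close>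
lemma f_ge_if_long_geodesic:
  assumes "W x y r" "\<not> W x y (\<delta> + 1)"
  shows "\<delta> + 1 \<le> f (\<delta> + 1)"
proof -
  obtain A where "sg x y A" using assms seg_ex by blast
  then obtain g D where g: "isom_geod X d g D" "0 \<le> D" "g 0 = x" "g D = y"
    by (rule segE)
  have D: "\<delta> + 1 < D"
  proof (rule ccontr)
    assume "\<not> ?thesis"
    then have "W (g 0) (g D) (\<delta> + 1)" using isom_W[OF g(1), of 0 D] g(2) by (auto elim!: W_mono)
    then show False using assms g by simp
  qed
  have 1: "W x (g (\<delta> + 1)) (\<delta> + 1)" using isom_W[OF g(1), of 0 "\<delta> + 1"] D delta g by auto
  have "W x x (\<delta> + 1)" using W_refl delta W_D assms by simp
  with 1 have "W x (g (\<delta> + 1)) (f (\<delta> + 1))" using B1 W_D by blast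
  then show ?thesis using isom_le[OF g(1), of 0 "\<delta> + 1"] D delta g by auto
qed

lemma f_ge_if_quasi_ray:
  assumes "quasi_ray X d r"
  shows "\<delta> + 1 \<le> f (\<delta> + 1)"
proof -
  have "r 0 \<in> X" using assms by (auto simp: quasi_ray_def)
  from quasi_ray_leaves_out[OF assms this, of "\<delta> + 1"] obtain t where t: "0 \<le> t" "\<not> W (r 0) (r t) (\<delta> + 1)" by blast
  obtain \<rho> where "W (r 0) (r t) \<rho>" using quasi_ray_reach[OF assms, of 0 t] t by auto
  then show ?thesis using f_ge_if_long_geodesic t by blast
qed

lemma f_ge_if_ideal: "ideal X d r \<Longrightarrow> \<delta> + 1 \<le> f (\<delta> + 1)"
  using f_ge_if_quasi_ray thin_space.f_ge_if_quasi_ray[OF reversed] by blast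

end

section \<open>Points of the boundary\<close>

lemma qg_subdivision:
  assumes ps: "pseudo_semimetric X d" and g: "one_sided_cont_on I X d g" and I: "{s..t} \<subseteq> I" and st: "s \<le> t"
    and nn: "0 \<le> \<gamma>" "0 \<le> c"
    and qg: "\<And>s' t'. s \<le> s' \<Longrightarrow> s' < t' \<Longrightarrow> t' \<le> t \<Longrightarrow>
      path_len d (DPath s' t' g) \<le> ennreal \<gamma> * d (g s') (g t') + ennreal c"
  shows "\<exists>n u a. u 0 = s \<and> u n = t \<and> (\<forall>k\<le>n. s \<le> u k \<and> u k \<le> t) \<and>
    qg_chain X d \<gamma> c 2 (\<lambda>k. g (u k)) a n"
proof -
  obtain n u where u0: "u 0 = s" "u n = t"
    and step: "\<And>l. l < n \<Longrightarrow> u l \<le> u (Suc l) \<and> d (g (u l)) (g (u (Suc l))) \<le> ennreal 2"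
    using short_steps[OF ps g I st] by blast
  have mono: "u l \<le> u m" if "l \<le> m" "m \<le> n" for l m
    using that
  proof (induction m rule: dec_induct)
    case (step m)
    then show ?case using \<open>\<And>l. l < n \<Longrightarrow> u l \<le> u (Suc l) \<and> _\<close>[of m] by simp
  qed simp
  have u_in: "s \<le> u k \<and> u k \<le> t" if "k \<le> n" for k using mono[of 0 k] mono[of k n] that u0 by simp
  have X: "g (u k) \<in> X" if "k \<le> n" for k
  proof -
    have "u k \<in> I" using u_in[OF that] I by auto
    then show ?thesis using g unfolding one_sided_cont_on_def by blast
  qed
  define a where "a k = enn2real (d (g (u k)) (g (u (Suc k))))" for k
  have a: "d (g (u k)) (g (u (Suc k))) = ennreal (a k)" if "k < n" for k
  proof -
    have "d (g (u k)) (g (u (Suc k))) \<le> ennreal 2" using step that by simp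
    then have "d (g (u k)) (g (u (Suc k))) < top" by (rule le_less_trans) simp
    then show ?thesis by (simp add: a_def)
  qed
  have a0: "0 \<le> a k" for k by (simp add: a_def)
  have "sum a {k..<l} \<le> \<gamma> * r + c" if kl: "k \<le> l" "l \<le> n" and W: "reaches X d (g (u k)) (g (u l)) r" for k l r
  proof -
    have r0: "0 \<le> r" and dr: "d (g (u k)) (g (u l)) \<le> ennreal r" using W by (auto simp: reaches_def)
    have sum_eq: "ennreal (sum a {k..<l}) = (\<Sum>i<l - k. d (g (u (k + i))) (g (u (k + Suc i))))"
    proof -
      have "sum a {k..<l} = (\<Sum>i<l - k. a (k + i))"
        by (rule sum.reindex_bij_witness[where i = "\<lambda>i. k + i" and j = "\<lambda>i. i - k"]) auto
      then have "ennreal (sum a {k..<l}) = (\<Sum>i<l - k. ennreal (a (k + i)))"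
        using a0 by (simp add: sum_ennreal)
      also have "\<dots> = (\<Sum>i<l - k. d (g (u (k + i))) (g (u (k + Suc i))))"
        by (rule sum.cong) (use a kl in auto)
      finally show ?thesis .
    qed
    show ?thesis
    proof (cases "u k < u l")
      case True
      have ukl: "s \<le> u k" "u l \<le> t" using u_in kl by auto
      have "one_sided_cont_on {u k..u l} X d g" by (rule one_sided_cont_on_subset[OF g]) (use ukl I in auto)
      then have "(\<Sum>i<l - k. d (g (u (k + i))) (g (u (k + Suc i)))) \<le> path_len d (DPath (u k) (u l) g)"
        using partition_sum_le_path_len[OF ps _ True, of g "\<lambda>i. u (k + i)" "l - k"] mono kl by simp
      also have "\<dots> \<le> ennreal \<gamma> * d (g (u k)) (g (u l)) + ennreal c" using qg True ukl by simp
      also have "\<dots> \<le> ennreal \<gamma> * ennreal r + ennreal c" using dr by (intro add_right_mono mult_left_mono) auto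
      also have "\<dots> = ennreal (\<gamma> * r + c)" using nn r0 by (simp add: ennreal_mult)
      finally have "ennreal (sum a {k..<l}) \<le> ennreal (\<gamma> * r + c)" unfolding sum_eq .
      then show ?thesis using nn r0 by (subst (asm) ennreal_le_iff) auto
    next
      case False
      have "a i = 0" if i: "i \<in> {k..<l}" for i
      proof -
        have "u i = u k" "u (Suc i) = u k" using mono[of k i] mono[of i l] mono[of k "Suc i"] mono[of "Suc i" l] i kl False by auto
        then show ?thesis using ps X[of k] kl by (simp add: a_def pseudo_semimetric_def)
      qed
      then have "sum a {k..<l} = 0" by (rule sum.neutral[rule_format])
      then show ?thesis using nn r0 by simp
    qed
  qed
  moreover have "reaches X d (g (u k)) (g (u (Suc k))) (a k) \<and> a k \<le> 2" if "k < n" for k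
  proof -
    have "ennreal (a k) \<le> ennreal 2" using step[OF that] unfolding a[OF that] by (rule conjunct2)
    then have "a k \<le> 2" by (subst (asm) ennreal_le_iff) auto
    then show ?thesis using a[OF that] a0[of k] X[of k] X[of "Suc k"] that by (simp add: reaches_def)
  qed
  ultimately have "qg_chain X d \<gamma> c 2 (\<lambda>k. g (u k)) a n"
    using X unfolding qg_chain_def by blast
  then show ?thesis using u0 u_in by blast
qed

text \<open>The partition of the path at one interior point bounds both distances by the length of the path.\<close>
lemma path_bounded:
  assumes ps: "pseudo_semimetric X d" and g: "one_sided_cont_on I X d g" and I: "{s..t} \<subseteq> I" and st: "s \<le> t"
    and qg: "s < t \<Longrightarrow> path_len d (DPath s t g) \<le> ennreal \<gamma> * d (g s) (g t) + ennreal c"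
  shows "\<exists>\<rho>. \<forall>v. s \<le> v \<and> v \<le> t \<longrightarrow> reaches X d (g s) (g v) \<rho> \<and> reaches X d (g v) (g t) \<rho>"
proof (cases "s < t")
  case True
  have X: "g v \<in> X" if "s \<le> v" "v \<le> t" for v
  proof -
    have "v \<in> I" using that I by auto
    then show ?thesis using g unfolding one_sided_cont_on_def by blast
  qed
  have g': "one_sided_cont_on {s..t} X d g" using one_sided_cont_on_subset[OF g I] .
  define B where "B = ennreal \<gamma> * d (g s) (g t) + ennreal c"
  have "d (g s) (g t) < \<infinity>" by (rule path_dist_finite[OF ps g I st])
  then have B: "B < top" by (simp add: B_def ennreal_mult_less_top)
  have le: "d (g s) (g v) + d (g v) (g t) \<le> B" if v: "s \<le> v" "v \<le> t" for v
  proof -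
    define u where "u l = (if l = 0 then s else if l = 1 then v else t)" for l :: nat
    have "(\<Sum>l<2. d (g (u l)) (g (u (Suc l)))) \<le> path_len d (DPath s t g)"
      by (rule partition_sum_le_path_len[OF ps g' True]) (use v in \<open>auto simp: u_def\<close>)
    also have "\<dots> \<le> B" unfolding B_def using qg True .
    finally show ?thesis by (simp add: u_def eval_nat_numeral)
  qed
  have "reaches X d (g s) (g v) (enn2real B) \<and> reaches X d (g v) (g t) (enn2real B)" if v: "s \<le> v" "v \<le> t" for v
  proof -
    have "d (g s) (g v) \<le> B" by (rule order_trans[OF _ le[OF v]]) simp
    moreover have "d (g v) (g t) \<le> B" by (rule order_trans[OF _ le[OF v]]) simp
    ultimately show ?thesis using X[OF v] X[of s] X[of t] st B by (simp add: reaches_def)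
  qed
  then show ?thesis by blast
next
  case False
  with st have "t = s" by simp
  have "s \<in> I" using I st by auto
  then have "g s \<in> X" using g unfolding one_sided_cont_on_def by blast
  then have "reaches X d (g s) (g s) 0" using ps by (simp add: reaches_def pseudo_semimetric_def)
  then show ?thesis using \<open>t = s\<close> by (intro exI[of _ 0]) auto
qed

lemma ideal_in: "ideal X d r \<Longrightarrow> 0 \<le> t \<Longrightarrow> r t \<in> X"
  by (auto simp: quasi_ray_def)

lemma semiray_points_at: "y \<in> semiray_points R \<longleftrightarrow> (\<exists>j\<ge>0. y = semiray_at R j)"
proof (cases R)
  case (Ray g)
  then show ?thesis by (auto simp: semiray_points_def)
next
  case (Anti_Ray g)
  have "(\<exists>j\<ge>0. y = g (- j)) \<longleftrightarrow> (\<exists>t\<le>0. y = g t)"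
  proof
    assume "\<exists>t\<le>0. y = g t"
    then obtain t where "t \<le> 0" "y = g t" by blast
    then show "\<exists>j\<ge>0. y = g (- j)" by (intro exI[of _ "- t"]) auto
  qed (metis neg_le_0_iff_le)
  then show ?thesis using Anti_Ray by (auto simp: semiray_points_def)
qed

lemma semiray_ideal:
  assumes ps: "pseudo_semimetric X d" and R: "R \<in> quasi_geodesic_semirays X d"
  shows "ideal X d (semiray_at R)"
proof -
  have semi: "is_semiray X d R" using R by (simp add: quasi_geodesic_semirays_def)
  have "\<exists>\<gamma>\<ge>1. \<exists>c\<ge>0. \<forall>s\<in>semiray_dom R. \<forall>t\<in>semiray_dom R. s < t \<longrightarrow>
            quasi_geodesic X d \<gamma> c (DPath s t (semiray_map R))"
    using R unfolding quasi_geodesic_semirays_def by blast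
  then obtain \<gamma> c where \<gamma>: "1 \<le> \<gamma>" and c: "0 \<le> c"
    and qg: "\<And>s t. s \<in> semiray_dom R \<Longrightarrow> t \<in> semiray_dom R \<Longrightarrow> s < t \<Longrightarrow>
            quasi_geodesic X d \<gamma> c (DPath s t (semiray_map R))" by blast
  let ?g = "semiray_map R"
  have len: "path_len d (DPath s t ?g) \<le> ennreal \<gamma> * d (?g s) (?g t) + ennreal c"
    if "s \<in> semiray_dom R" "t \<in> semiray_dom R" "s < t" for s t
    using qg[OF that] that(3) unfolding quasi_geodesic_def by simp
  have \<gamma>0: "0 \<le> \<gamma>" using \<gamma> by simp
  show ?thesis
  proof (cases R)
    case (Ray g)
    have ray: "is_ray X d g" using semi Ray by simp
    then have tame: "one_sided_cont_on {0..} X d g" by (simp add: is_ray_def bicontinuous_on_iff[OF ps])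
    have len': "path_len d (DPath s t g) \<le> ennreal \<gamma> * d (g s) (g t) + ennreal c" if "0 \<le> s" "s < t" for s t
      using len[of s t] that Ray by simp
    have leaves: "\<exists>p\<ge>0. \<forall>t\<ge>p. \<not> reaches X d x (g t) \<rho>" if x: "x \<in> X" for x \<rho>
    proof (cases "0 \<le> \<rho>")
      case True
      then obtain p where "0 \<le> p" "g ` {p..} \<inter> out_ball X d \<rho> x = {}" using ray x unfolding is_ray_def by blast
      then show ?thesis by (intro exI[of _ p]) (auto simp: out_ball_def reaches_def)
    next
      case False
      then show ?thesis by (intro exI[of _ 0]) (auto simp: reaches_def)
    qed
    have chained: "chained X d g \<gamma> c 2"
      unfolding chained_def
    proof (intro allI impI)
      fix i j :: real assume ij: "0 \<le> i" "i \<le> j"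
      show "\<exists>n u a. u 0 = i \<and> u n = j \<and> (\<forall>k\<le>n. i \<le> u k \<and> u k \<le> j) \<and> qg_chain X d \<gamma> c 2 (\<lambda>k. g (u k)) a n"
        by (rule qg_subdivision[OF ps tame _ ij(2) \<gamma>0 c]) (use ij len' in auto)
    qed
    have bounded: "\<exists>\<rho>. \<forall>t. 0 \<le> t \<and> t \<le> N \<longrightarrow> reaches X d (g 0) (g t) \<rho> \<and> reaches X d (g t) (g N) \<rho>" if "0 \<le> N" for N
      by (rule path_bounded[OF ps tame _ that, where \<gamma> = \<gamma> and c = c]) (use len' in auto)
    have X: "\<forall>t\<ge>0. g t \<in> X" using tame by (auto simp: one_sided_cont_on_def)
    have "quasi_ray X d g" unfolding quasi_ray_def
    proof (intro conjI)
      show "\<exists>\<gamma>\<ge>0. \<exists>c\<ge>0. \<exists>\<beta>\<ge>0. chained X d g \<gamma> c \<beta>"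
        using \<gamma>0 c chained by (intro exI[of _ \<gamma>] exI[of _ c] exI[of _ 2] conjI) auto
    qed (use X leaves bounded in blast)+
    moreover have "semiray_at R = g" using Ray by (simp add: fun_eq_iff)
    ultimately show ?thesis by simp
  next
    case (Anti_Ray g)
    let ?r = "\<lambda>i. g (- i)"
    have ray: "is_anti_ray X d g" using semi Anti_Ray by simp
    then have tame: "one_sided_cont_on {..0} X d g" by (simp add: is_anti_ray_def bicontinuous_on_iff[OF ps])
    have len': "path_len d (DPath s t g) \<le> ennreal \<gamma> * d (g s) (g t) + ennreal c" if "t \<le> 0" "s < t" for s t
      using len[of s t] that Anti_Ray by simp
    have leaves: "\<exists>p\<ge>0. \<forall>t\<ge>p. \<not> reaches X (reversed d) x (?r t) \<rho>" if x: "x \<in> X" for x \<rho>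
    proof (cases "0 \<le> \<rho>")
      case True
      then obtain p where "p \<le> 0" "g ` {..p} \<inter> in_ball X d \<rho> x = {}" using ray x unfolding is_anti_ray_def by blast
      have "\<not> reaches X d (g (- t)) x \<rho>" if "- p \<le> t" for t
      proof
        assume "reaches X d (g (- t)) x \<rho>"
        then have "g (- t) \<in> in_ball X d \<rho> x" by (simp add: in_ball_def reaches_def)
        moreover have "g (- t) \<in> g ` {..p}" using that by simp
        ultimately show False using \<open>g ` {..p} \<inter> in_ball X d \<rho> x = {}\<close> by blast
      qed
      with \<open>p \<le> 0\<close> show ?thesis by (intro exI[of _ "- p"]) simp
    next
      case False
      then show ?thesis by (intro exI[of _ 0]) (auto simp: reaches_def)
    qed
    have chained: "chained X (reversed d) ?r \<gamma> c 2"
      unfolding chained_def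
    proof (intro allI impI)
      fix i j :: real assume ij: "0 \<le> i" "i \<le> j"
      have "\<exists>n u a. u 0 = - j \<and> u n = - i \<and> (\<forall>k\<le>n. - j \<le> u k \<and> u k \<le> - i) \<and> qg_chain X d \<gamma> c 2 (\<lambda>k. g (u k)) a n"
        by (rule qg_subdivision[OF ps tame _ _ \<gamma>0 c]) (use ij len' in auto)
      then obtain n u a where u: "u 0 = - j" "u n = - i" "\<And>k. k \<le> n \<Longrightarrow> - j \<le> u k \<and> u k \<le> - i"
        and ch: "qg_chain X d \<gamma> c 2 (\<lambda>k. g (u k)) a n" by blast
      show "\<exists>n u a. u 0 = i \<and> u n = j \<and> (\<forall>k\<le>n. i \<le> u k \<and> u k \<le> j) \<and> qg_chain X (reversed d) \<gamma> c 2 (\<lambda>k. ?r (u k)) a n"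
      proof (intro exI conjI allI impI)
        show "qg_chain X (reversed d) \<gamma> c 2 (\<lambda>k. ?r (- u (n - k))) (\<lambda>k. a (n - Suc k)) n"
          using qg_chain_reversed[OF ch] by simp
        show "i \<le> - u (n - k)" "- u (n - k) \<le> j" for k using u(3)[of "n - k"] by auto
      qed (use u in auto)
    qed
    have bounded: "\<exists>\<rho>. \<forall>t. 0 \<le> t \<and> t \<le> N \<longrightarrow> reaches X (reversed d) (?r 0) (?r t) \<rho> \<and> reaches X (reversed d) (?r t) (?r N) \<rho>"
      if N: "0 \<le> N" for N
    proof -
      have "\<exists>\<rho>. \<forall>v. - N \<le> v \<and> v \<le> 0 \<longrightarrow> reaches X d (g (- N)) (g v) \<rho> \<and> reaches X d (g v) (g 0) \<rho>"
        by (rule path_bounded[OF ps tame, where \<gamma> = \<gamma> and c = c]) (use N len' in auto)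
      then obtain \<rho> where \<rho>: "\<forall>v. - N \<le> v \<and> v \<le> 0 \<longrightarrow> reaches X d (g (- N)) (g v) \<rho> \<and> reaches X d (g v) (g 0) \<rho>" ..
      show ?thesis
      proof (intro exI[of _ \<rho>] allI impI)
        fix t assume "0 \<le> t \<and> t \<le> N"
        then show "reaches X (reversed d) (?r 0) (?r t) \<rho> \<and> reaches X (reversed d) (?r t) (?r N) \<rho>"
          using \<rho>[rule_format, of "- t"] by simp
      qed
    qed
    have X: "\<forall>t\<ge>0. ?r t \<in> X" using tame by (auto simp: one_sided_cont_on_def)
    have "quasi_ray X (reversed d) ?r" unfolding quasi_ray_def
    proof (intro conjI)
      show "\<exists>\<gamma>\<ge>0. \<exists>c\<ge>0. \<exists>\<beta>\<ge>0. chained X (reversed d) ?r \<gamma> c \<beta>"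
        using \<gamma>0 c chained by (intro exI[of _ \<gamma>] exI[of _ c] exI[of _ 2] conjI) auto
      show "\<forall>x\<in>X. \<forall>\<rho>. \<exists>p\<ge>0. \<forall>t\<ge>p. \<not> reaches X (reversed d) x (?r t) \<rho>"
        by (intro ballI allI leaves)
      show "\<forall>N\<ge>0. \<exists>\<rho>. \<forall>t. 0 \<le> t \<and> t \<le> N \<longrightarrow> reaches X (reversed d) (?r 0) (?r t) \<rho> \<and> reaches X (reversed d) (?r t) (?r N) \<rho>"
        by (intro allI impI bounded)
    qed (rule X)
    moreover have "semiray_at R = ?r" using Anti_Ray by (simp add: fun_eq_iff)
    ultimately show ?thesis by simp
  qed
qed

context thin_space
begin

text \<open>The connections avoid large balls around \<open>Q 0\<close>, so they start far out on \<open>Q\<close>. If they ended in a bounded part of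
  \<open>R\<close>, then points far out on \<open>Q\<close> would reach a fixed point within bounded distance, but \<open>Q\<close> leaves all
  in-balls.\<close>
lemma near_if_linked_far_out:
  assumes Q: "ideal X d Q" and R: "ideal X d R"
    and link: "\<And>\<rho>. 0 \<le> \<rho> \<Longrightarrow> \<exists>j\<ge>0. \<exists>k\<ge>0. W (Q j) (R k) M \<and> \<not> W (Q 0) (Q j) \<rho> \<and> \<not> W (Q j) (Q 0) \<rho>"
  shows "near X d Q R"
  unfolding near_def
proof (rule exI[of _ M], rule allI)
  fix N0 :: real
  define N where "N = max N0 0"
  have N: "0 \<le> N" by (simp add: N_def)
  \<comment> \<open>take \<open>w = R N\<close> on a ray and \<open>w = R 0\<close> on an anti-ray\<close>
  have "\<exists>w\<in>X. \<exists>\<rho>. \<forall>t. 0 \<le> t \<and> t \<le> N \<longrightarrow> W (R t) w \<rho>"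
    using R
  proof
    assume R: "quasi_ray X d R"
    then obtain \<rho> where "\<forall>t. 0 \<le> t \<and> t \<le> N \<longrightarrow> W (R 0) (R t) \<rho> \<and> W (R t) (R N) \<rho>"
      using N unfolding quasi_ray_def by blast
    moreover have "R N \<in> X" using R N by (auto simp: quasi_ray_def)
    ultimately show ?thesis by blast
  next
    assume R: "quasi_ray X (reversed d) R"
    then obtain \<rho> where "\<forall>t. 0 \<le> t \<and> t \<le> N \<longrightarrow> reaches X (reversed d) (R 0) (R t) \<rho> \<and> reaches X (reversed d) (R t) (R N) \<rho>"
      using N unfolding quasi_ray_def by blast
    moreover have "R 0 \<in> X" using R by (auto simp: quasi_ray_def)
    ultimately show ?thesis by auto
  qed
  then obtain w \<rho>1 where w: "w \<in> X" and \<rho>1: "\<And>t. 0 \<le> t \<Longrightarrow> t \<le> N \<Longrightarrow> W (R t) w \<rho>1" by blast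
  obtain p where p: "\<And>t. p \<le> t \<Longrightarrow> \<not> W (Q t) w (M + \<rho>1)" using ideal_leaves[OF Q w] by blast
  define N' where "N' = max N p"
  have N': "0 \<le> N'" using N by (simp add: N'_def)
  have "\<exists>\<rho>. \<forall>t. 0 \<le> t \<and> t \<le> N' \<longrightarrow> W (Q 0) (Q t) \<rho> \<or> W (Q t) (Q 0) \<rho>"
    using Q
  proof
    assume "quasi_ray X d Q"
    then obtain \<rho> where "\<forall>t. 0 \<le> t \<and> t \<le> N' \<longrightarrow> W (Q 0) (Q t) \<rho> \<and> W (Q t) (Q N') \<rho>"
      using N' unfolding quasi_ray_def by blast
    then show ?thesis by blast
  next
    assume "quasi_ray X (reversed d) Q"
    then obtain \<rho> where "\<forall>t. 0 \<le> t \<and> t \<le> N' \<longrightarrow> reaches X (reversed d) (Q 0) (Q t) \<rho> \<and> reaches X (reversed d) (Q t) (Q N') \<rho>"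
      using N' unfolding quasi_ray_def by blast
    then show ?thesis by auto
  qed
  then obtain \<rho>2 where \<rho>2: "\<And>t. 0 \<le> t \<Longrightarrow> t \<le> N' \<Longrightarrow> W (Q 0) (Q t) \<rho>2 \<or> W (Q t) (Q 0) \<rho>2" by blast
  obtain j k where jk: "0 \<le> j" "0 \<le> k" "W (Q j) (R k) M" "\<not> W (Q 0) (Q j) (max \<rho>2 0)" "\<not> W (Q j) (Q 0) (max \<rho>2 0)"
    using link[of "max \<rho>2 0"] by auto
  have "N' < j"
  proof (rule ccontr)
    assume "\<not> N' < j"
    then have "W (Q 0) (Q j) \<rho>2 \<or> W (Q j) (Q 0) \<rho>2" using \<rho>2 jk(1) by simp
    then show False using jk(4,5) W_mono by (meson max.cobounded1)
  qed
  moreover have "N < k"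
  proof (rule ccontr)
    assume "\<not> N < k"
    then have "W (Q j) w (M + \<rho>1)" using \<rho>1[of k] jk W_trans by auto
    then show False using p[of j] \<open>N' < j\<close> by (simp add: N'_def)
  qed
  ultimately have "N0 \<le> j" "N0 \<le> k" by (auto simp: N_def N'_def)
  then show "\<exists>j k. N0 \<le> j \<and> N0 \<le> k \<and> W (Q j) (R k) M" using jk by blast
qed

lemma semiray_le_near:
  assumes Q: "Q \<in> quasi_geodesic_semirays X d" and R: "R \<in> quasi_geodesic_semirays X d"
    and le: "semiray_le X d Q R"
  shows "near X d (semiray_at Q) (semiray_at R)"
proof -
  obtain M where M: "\<And>\<rho> x. 0 \<le> \<rho> \<Longrightarrow> x \<in> X \<Longrightarrow> \<exists>P. directed_path X d P \<and>
        start_point P \<in> semiray_points Q \<and> end_point P \<in> semiray_points R \<and>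
        path_len d P \<le> ennreal M \<and> points_of P \<inter> (out_ball X d \<rho> x \<union> in_ball X d \<rho> x) = {}" and M0: "0 \<le> M"
    using le unfolding semiray_le_def by blast
  have iQ: "ideal X d (semiray_at Q)" and iR: "ideal X d (semiray_at R)" using semiray_ideal[OF ps] Q R by blast+
  show ?thesis
  proof (rule near_if_linked_far_out[OF iQ iR, where M = M])
    fix \<rho> :: real assume \<rho>: "0 \<le> \<rho>"
    let ?x = "semiray_at Q 0"
    have x: "?x \<in> X" using ideal_in[OF iQ order_refl] .
    obtain P where P: "directed_path X d P" "start_point P \<in> semiray_points Q" "end_point P \<in> semiray_points R"
      "path_len d P \<le> ennreal M" "points_of P \<inter> (out_ball X d \<rho> ?x \<union> in_ball X d \<rho> ?x) = {}"
      using M[OF \<rho> x] by blast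
    obtain j where j: "0 \<le> j" "start_point P = semiray_at Q j" using P(2) unfolding semiray_points_at by blast
    obtain k where k: "0 \<le> k" "end_point P = semiray_at R k" using P(3) unfolding semiray_points_at by blast
    obtain a b c where Pe: "P = DPath a b c" by (cases P)
    have ab: "a < b" and tame: "one_sided_cont_on {a..b} X d c"
      using P(1) by (auto simp: Pe directed_path_def bicontinuous_on_iff[OF ps])
    have cX: "c a \<in> X" "c b \<in> X" using tame ab by (auto simp: one_sided_cont_on_def)
    have "d (c a) (c b) \<le> ennreal M" using dist_le_path_len[OF ps tame ab] P(4) Pe by (simp add: order_trans)
    then have "W (semiray_at Q j) (semiray_at R k) M"
      using j k cX M0 by (simp add: Pe start_point_def end_point_def reaches_def)
    moreover have "c a \<in> points_of P" using ab by (simp add: Pe points_of_def)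
    then have "semiray_at Q j \<in> points_of P" using j by (simp add: Pe start_point_def)
    then have "semiray_at Q j \<notin> out_ball X d \<rho> ?x" "semiray_at Q j \<notin> in_ball X d \<rho> ?x" using P(5) by blast+
    then have "\<not> W ?x (semiray_at Q j) \<rho>" "\<not> W (semiray_at Q j) ?x \<rho>"
      by (auto simp: reaches_def out_ball_def in_ball_def)
    ultimately show "\<exists>j\<ge>0. \<exists>k\<ge>0. W (semiray_at Q j) (semiray_at R k) M \<and>
        \<not> W ?x (semiray_at Q j) \<rho> \<and> \<not> W (semiray_at Q j) ?x \<rho>" using j k by blast
  qed
qed

lemma semiray_le_refl:
  assumes R: "R \<in> quasi_geodesic_semirays X d"
  shows "semiray_le X d R R"
  unfolding semiray_le_def
proof (intro exI[of _ 0] conjI allI impI ballI)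
  fix r :: real and x assume r: "0 \<le> r" and x: "x \<in> X"
  have iR: "ideal X d (semiray_at R)" using semiray_ideal[OF ps R] .
  obtain p where p: "0 \<le> p" "\<not> W x (semiray_at R p) r" "\<not> W (semiray_at R p) x r"
    using ideal_leaves[OF iR x, of r] by blast
  let ?y = "semiray_at R p" and ?P = "DPath 0 1 (\<lambda>_. semiray_at R p)"
  have y: "?y \<in> X" using ideal_in[OF iR p(1)] .
  have "points_of ?P = {?y}" by (simp add: points_of_def image_constant_conv)
  moreover have "?y \<notin> out_ball X d r x" "?y \<notin> in_ball X d r x"
    using p(2,3) x y r by (auto simp: reaches_def out_ball_def in_ball_def)
  moreover have "?y \<in> semiray_points R" unfolding semiray_points_at using p(1) by blast
  moreover have "start_point ?P = ?y" "end_point ?P = ?y" by (simp_all add: start_point_def end_point_def)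
  ultimately have "directed_path X d ?P \<and> start_point ?P \<in> semiray_points R \<and>
        end_point ?P \<in> semiray_points R \<and> path_len d ?P \<le> ennreal 0 \<and>
        points_of ?P \<inter> (out_ball X d r x \<union> in_ball X d r x) = {}"
    using const_path[OF ps y] by simp
  then show "\<exists>P. directed_path X d P \<and> start_point P \<in> semiray_points R \<and>
        end_point P \<in> semiray_points R \<and> path_len d P \<le> ennreal 0 \<and>
        points_of P \<inter> (out_ball X d r x \<union> in_ball X d r x) = {}" ..
qed simp

lemma boundary_representatives:
  assumes E: "E \<in> qg_boundary X d"
  shows "representatives (Inr E) \<noteq> {}"
    and "Q \<in> representatives (Inr E) \<Longrightarrow> ideal X d Q"
    and "Q \<in> representatives (Inr E) \<Longrightarrow> R \<in> representatives (Inr E) \<Longrightarrow> common_limit X d Q R"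
proof -
  obtain R0 where R0: "R0 \<in> quasi_geodesic_semirays X d" and E_eq: "E = semiray_equiv X d `` {R0}"
    using E unfolding qg_boundary_def by (auto elim: quotientE)
  have mem: "A \<in> E \<longleftrightarrow> A \<in> quasi_geodesic_semirays X d \<and> semiray_le X d R0 A \<and> semiray_le X d A R0" for A
    using R0 by (auto simp: E_eq semiray_equiv_def)
  have "R0 \<in> E" using mem R0 semiray_le_refl by blast
  then show "representatives (Inr E) \<noteq> {}" by auto
  show *: "ideal X d Q" if "Q \<in> representatives (Inr E)" for Q
    using that mem semiray_ideal[OF ps] by auto
  show "common_limit X d Q R" if QR: "Q \<in> representatives (Inr E)" "R \<in> representatives (Inr E)"
  proof -
    obtain A B where A: "A \<in> E" "Q = semiray_at A" and B: "B \<in> E" "R = semiray_at B" using QR by auto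
    have "near X d Q (semiray_at R0)" unfolding A(2) by (rule semiray_le_near) (use A mem R0 in auto)
    moreover have "near X d (semiray_at R0) R" unfolding B(2) by (rule semiray_le_near) (use B mem R0 in auto)
    moreover have "ideal X d (semiray_at R0)" using semiray_ideal[OF ps R0] .
    ultimately show ?thesis unfolding common_limit_def using *[OF QR(1)] *[OF QR(2)] by blast
  qed
qed

end

section \<open>The quasi-ultrametric inequality\<close>

text \<open>The decreasing bijection from the extended reals to \<open>[0,\<infinity>]\<close> that turns \<open>\<rho>\<^sub>S\<close> into \<open>\<rho>\<^sub>S\<^sup>\<epsilon>\<close>.\<close>
definition visual_scale :: "real \<Rightarrow> ereal \<Rightarrow> ennreal" where
  "visual_scale \<epsilon> x = epowr (exp 1) (- (ereal \<epsilon> * x))"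

lemma epowr_infinity: "epowr a \<infinity> = \<infinity>" "epowr a (- \<infinity>) = 0"
  by (metis epowr.simps(2) infinity_ereal_def, metis epowr.simps(3) MInfty_eq_minfinity)

lemma visual_scale_simps:
  assumes "0 < \<epsilon>"
  shows "visual_scale \<epsilon> (ereal x) = ennreal (exp (- \<epsilon> * x))"
    "visual_scale \<epsilon> \<infinity> = 0" "visual_scale \<epsilon> (- \<infinity>) = \<infinity>"
  using assms by (simp_all add: visual_scale_def powr_def epowr_infinity)

text \<open>The adjoint is the inverse function, a logarithm. The connection gives monotonicity and the behaviour
  under suprema at once.\<close>
lemma visual_scale_galois:
  assumes \<epsilon>: "0 < \<epsilon>"
  shows "\<exists>\<psi>. \<forall>x y. y \<le> visual_scale \<epsilon> x \<longleftrightarrow> x \<le> \<psi> y"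
proof -
  define \<psi> :: "ennreal \<Rightarrow> ereal" where
    "\<psi> y = (if y = 0 then \<infinity> else if y = \<infinity> then - \<infinity> else ereal (- ln (enn2real y) / \<epsilon>))" for y
  have "y \<le> visual_scale \<epsilon> x \<longleftrightarrow> x \<le> \<psi> y" for x y
  proof (cases x)
    case (real r)
    show ?thesis
    proof (cases y)
      case (real v)
      show ?thesis
      proof (cases "v = 0")
        case True
        then show ?thesis using real by (simp add: \<psi>_def)
      next
        case False
        with real have v: "0 < v" by simp
        have "v \<le> exp (- \<epsilon> * r) \<longleftrightarrow> ln v \<le> - \<epsilon> * r" using v by (metis exp_le_cancel_iff exp_ln)
        also have "\<dots> \<longleftrightarrow> r * \<epsilon> \<le> - ln v" by (auto simp: mult.commute)
        also have "\<dots> \<longleftrightarrow> r \<le> - ln v / \<epsilon>" by (rule pos_le_divide_eq[OF \<epsilon>, symmetric])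
        finally show ?thesis using real v \<open>x = ereal r\<close> \<epsilon>
          by (simp add: \<psi>_def visual_scale_simps ennreal_le_iff ennreal_eq_0_iff)
      qed
    next
      case top
      then show ?thesis using real \<epsilon> by (simp add: \<psi>_def visual_scale_simps top_unique)
    qed
  next
    case PInf
    then show ?thesis using \<epsilon> by (auto simp: \<psi>_def visual_scale_simps)
  next
    case MInf
    then show ?thesis using \<epsilon> by (auto simp: visual_scale_simps)
  qed
  then show ?thesis by blast
qed

lemma visual_scale_antimono:
  assumes "0 < \<epsilon>" "x \<le> y"
  shows "visual_scale \<epsilon> y \<le> visual_scale \<epsilon> x"
proof -
  obtain \<psi> where \<psi>: "\<And>x y. y \<le> visual_scale \<epsilon> x \<longleftrightarrow> x \<le> \<psi> y" using visual_scale_galois[OF assms(1)] by blast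
  show ?thesis using \<psi> assms(2) by (meson order_refl order_trans)
qed

lemma visual_scale_SUP:
  assumes "0 < \<epsilon>"
  shows "(INF a\<in>A. visual_scale \<epsilon> (g a)) = visual_scale \<epsilon> (SUP a\<in>A. g a)"
proof -
  obtain \<psi> where \<psi>: "\<And>x y. y \<le> visual_scale \<epsilon> x \<longleftrightarrow> x \<le> \<psi> y" using visual_scale_galois[OF assms(1)] by blast
  have "y \<le> (INF a\<in>A. visual_scale \<epsilon> (g a)) \<longleftrightarrow> y \<le> visual_scale \<epsilon> (SUP a\<in>A. g a)" for y
    unfolding le_INF_iff \<psi> SUP_le_iff ..
  then show ?thesis by (meson order_antisym order_refl)
qed

lemma visual_scale_shift:
  assumes \<epsilon>: "0 < \<epsilon>"
  shows "visual_scale \<epsilon> (x - ereal k) \<le> ennreal (exp (\<epsilon> * k)) * visual_scale \<epsilon> x"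
proof (cases x)
  case (real r)
  have "exp (- \<epsilon> * (r - k)) = exp (\<epsilon> * k) * exp (- \<epsilon> * r)" by (simp add: algebra_simps flip: exp_add)
  then show ?thesis using real \<epsilon> by (simp add: visual_scale_simps flip: ennreal_mult)
next
  case PInf
  then show ?thesis using \<epsilon> by (simp add: visual_scale_simps)
next
  case MInf
  then show ?thesis using \<epsilon> by (simp add: visual_scale_simps ennreal_mult_top)
qed

lemma rho_eps_pt_eq:
  assumes "0 < \<epsilon>"
  shows "rho_eps_pt X d \<epsilon> s \<eta> \<mu> = visual_scale \<epsilon> (rho_pt X d s \<eta> \<mu>)"
proof (cases "\<exists>x. \<eta> = Inl x \<and> \<mu> = Inl x")
  case True
  then show ?thesis using assms by (simp add: rho_eps_pt_def rho_pt_def visual_scale_simps)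
next
  case False
  show ?thesis
    unfolding rho_eps_pt_def rho_pt_def if_not_P[OF False] visual_scale_def[symmetric] visual_scale_SUP[OF assms] ..
qed

lemma rho_eps_eq:
  assumes "0 < \<epsilon>" "finite S" "S \<noteq> {}"
  shows "rho_eps X d S \<epsilon> \<eta> \<mu> = visual_scale \<epsilon> (rho X d S \<eta> \<mu>)"
  unfolding rho_eps_def rho_def rho_eps_pt_eq[OF assms(1)]
proof (rule Max_eqI)
  let ?r = "\<lambda>s. rho_pt X d s \<eta> \<mu>"
  have "Min (?r ` S) \<in> ?r ` S" using assms by (intro Min_in) auto
  then show "visual_scale \<epsilon> (Min (?r ` S)) \<in> (\<lambda>s. visual_scale \<epsilon> (?r s)) ` S" by auto
  fix y assume "y \<in> (\<lambda>s. visual_scale \<epsilon> (?r s)) ` S"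
  then obtain s where "s \<in> S" "y = visual_scale \<epsilon> (?r s)" by auto
  then show "y \<le> visual_scale \<epsilon> (Min (?r ` S))"
    using assms by (auto intro!: visual_scale_antimono Min_le)
qed (use assms in simp)

lemma ereal_le_sub_if:
  fixes x y :: ereal
  assumes "\<And>m. ereal m < x \<Longrightarrow> ereal (m - k) \<le> y"
  shows "x - ereal k \<le> y"
proof (rule dense_le)
  fix z assume z: "z < x - ereal k"
  show "z \<le> y"
  proof (cases z)
    case (real r)
    have "ereal (r + k) < x" using z real by (cases x) auto
    from assms[OF this] show ?thesis using real by simp
  next
    case PInf
    then show ?thesis using z by simp
  qed simp
qed


context thin_space
begin

text \<open>The connections of \<open>R\<close> with \<open>Q\<close> far out ensure that the convention \<open>L = -\<infinity>\<close> does not apply.\<close>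
lemma L_base_ge:
  assumes sep: "semimetric X d" and s: "s \<in> X" and "joined X d R Q"
    and e1: "eventually_avoids X d s m R Q" and e2: "eventually_avoids X (reversed d) s m Q R"
  shows "ereal m \<le> L_base X d s R Q"
proof -
  obtain N1 where N1: "\<And>i j A. N1 \<le> i \<Longrightarrow> N1 \<le> j \<Longrightarrow> sg (R i) (Q j) A \<Longrightarrow> avoids X d s m A"
    using e1 unfolding eventually_avoids_def by blast
  obtain N2 where N2: "\<And>i j A. N2 \<le> i \<Longrightarrow> N2 \<le> j \<Longrightarrow> sg (R j) (Q i) A \<Longrightarrow> avoids X (reversed d) s m A"
    using e2 unfolding eventually_avoids_def seg_reversed by blast
  have ne: "geodesic_dists X d s R Q n \<noteq> {}" for n
  proof -
    obtain i j r where ij: "real n \<le> i" "real n \<le> j" "W (R i) (Q j) r"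
      using assms(3) unfolding joined_def by blast
    then obtain A where "sg (R i) (Q j) A" using seg_ex by blast
    then obtain P where "geodesic_from_to X d (R i) (Q j) P" using seg_geodesic[OF ps] by blast
    then show ?thesis using ij unfolding geodesic_dists_def by blast
  qed
  define n where "n = nat \<lceil>max N1 N2\<rceil>"
  have n: "N1 \<le> real n" "N2 \<le> real n" unfolding n_def by linarith+
  have "ereal m \<le> Inf (geodesic_dists X d s R Q n)"
  proof (rule Inf_greatest)
    fix x assume "x \<in> geodesic_dists X d s R Q n"
    then obtain P i j where x: "x = enn2ereal (sym_dist_path d s P)" and ij: "real n \<le> i" "real n \<le> j"
      and P: "geodesic_from_to X d (R i) (Q j) P" unfolding geodesic_dists_def by blast
    have A: "sg (R i) (Q j) (points_of P)" using geodesic_seg[OF sep P] .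
    have av: "avoids X d s m (points_of P)" "avoids X (reversed d) s m (points_of P)"
      using N1[OF _ _ A] N2[OF _ _ A] ij n by auto
    have "ennreal m \<le> sym_dist_path d s P"
      unfolding sym_dist_path_def
    proof (rule INF_greatest)
      fix u assume u: "u \<in> points_of P"
      have uX: "u \<in> X" using seg_subset[OF A u] .
      have "ennreal m \<le> d s u"
      proof (cases "d s u < \<infinity>")
        case True
        then have "W s u (enn2real (d s u))" using s uX by (simp add: reaches_def)
        then have "m \<le> enn2real (d s u)" using av(1) u unfolding avoids_def by blast
        then show ?thesis using True by (metis ennreal_enn2real ennreal_leI infinity_ennreal_def)
      next
        case False
        then show ?thesis by (simp add: less_top[symmetric])
      qed
      moreover have "ennreal m \<le> d u s"
      proof (cases "d u s < \<infinity>")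
        case True
        then have "reaches X (reversed d) s u (enn2real (d u s))" using s uX by (simp add: reaches_def reversed_def)
        then have "m \<le> enn2real (d u s)" using av(2) u unfolding avoids_def by blast
        then show ?thesis using True by (metis ennreal_enn2real ennreal_leI infinity_ennreal_def)
      next
        case False
        then show ?thesis by (simp add: less_top[symmetric])
      qed
      ultimately show "ennreal m \<le> sym_dist d s u" by (simp add: sym_dist_def)
    qed
    then have "enn2ereal (ennreal m) \<le> x" unfolding x by (simp add: less_eq_ennreal.rep_eq)
    moreover have "ereal m \<le> enn2ereal (ennreal m)"
    proof (cases "0 \<le> m")
      case False
      then have "ereal m \<le> 0" by simp
      also have "0 \<le> enn2ereal (ennreal m)" by (rule enn2ereal_nonneg)
      finally show ?thesis .
    qed (simp add: enn2ereal_ennreal)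
    ultimately show "ereal m \<le> x" by (rule order_trans[rotated])
  qed
  also have "\<dots> \<le> (SUP n. Inf (geodesic_dists X d s R Q n))" by (rule SUP_upper) simp
  finally show ?thesis using ne by (simp add: L_base_def)
qed

lemma L_base_gt:
  assumes sep: "semimetric X d" and L: "ereal m < L_base X d s R Q"
  shows "joined X d R Q" "eventually_avoids X d s m R Q" "eventually_avoids X (reversed d) s m Q R"
proof -
  have ne: "geodesic_dists X d s R Q n \<noteq> {}" for n
    using L by (auto simp: L_base_def split: if_splits)
  show "joined X d R Q"
    unfolding joined_def
  proof
    fix N :: real
    obtain P i j where ij: "real (nat \<lceil>N\<rceil>) \<le> i" "real (nat \<lceil>N\<rceil>) \<le> j" "geodesic_from_to X d (R i) (Q j) P"
      using ne[of "nat \<lceil>N\<rceil>"] unfolding geodesic_dists_def by blast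
    have "\<exists>r. W (R i) (Q j) r" using seg_W_ends[OF geodesic_seg[OF sep ij(3)]] .
    moreover have "N \<le> i" "N \<le> j" using ij by linarith+
    ultimately show "\<exists>i j r. N \<le> i \<and> N \<le> j \<and> W (R i) (Q j) r" by blast
  qed
  have "ereal m < (SUP n. Inf (geodesic_dists X d s R Q n))" using L ne by (simp add: L_base_def)
  then obtain n where n: "ereal m < Inf (geodesic_dists X d s R Q n)" by (auto simp: less_SUP_iff)
  have le: "m \<le> r" if ij: "real n \<le> i" "real n \<le> j" and A: "sg (R i) (Q j) A" and u: "u \<in> A"
    and su: "W s u r \<or> W u s r" for i j A u r
  proof -
    obtain P where P: "geodesic_from_to X d (R i) (Q j) P" "points_of P = A" using seg_geodesic[OF ps A] by blast
    have r0: "0 \<le> r" using su W_D by blast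
    have "enn2ereal (sym_dist_path d s P) \<in> geodesic_dists X d s R Q n"
      unfolding geodesic_dists_def using ij P by blast
    then have "ereal m \<le> enn2ereal (sym_dist_path d s P)" using n Inf_lower by (meson less_imp_le order_less_le_trans)
    also have "sym_dist_path d s P \<le> sym_dist d s u" unfolding sym_dist_path_def using u P by (intro INF_lower) simp
    then have "enn2ereal (sym_dist_path d s P) \<le> enn2ereal (sym_dist d s u)" by (simp add: less_eq_ennreal.rep_eq)
    also have "sym_dist d s u \<le> ennreal r" using su by (auto simp: sym_dist_def reaches_def min_le_iff_disj)
    then have "enn2ereal (sym_dist d s u) \<le> enn2ereal (ennreal r)" by (simp add: less_eq_ennreal.rep_eq)
    also have "enn2ereal (ennreal r) = ereal r" using r0 by (simp add: enn2ereal_ennreal)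
    finally show ?thesis by simp
  qed
  show "eventually_avoids X d s m R Q"
    unfolding eventually_avoids_def avoids_def using le by blast
  show "eventually_avoids X (reversed d) s m Q R"
    unfolding eventually_avoids_def avoids_def seg_reversed reaches_reversed using le by blast
qed

lemma avoid_transfer_points:
  assumes j1: "joined X d (\<lambda>_. x) (\<lambda>_. z)" and j2: "joined X d (\<lambda>_. z) (\<lambda>_. y)"
    and e1: "eventually_avoids X d s m (\<lambda>_. x) (\<lambda>_. z)" and e2: "eventually_avoids X d s m (\<lambda>_. z) (\<lambda>_. y)"
  shows "eventually_avoids X d s (m - 4 * \<delta>) (\<lambda>_. x) (\<lambda>_. y)" "joined X d (\<lambda>_. x) (\<lambda>_. y)"
proof -
  have "far X d s m x z" "far X d s m z y"
    using assms seg_ex unfolding far_def joined_def eventually_avoids_def by blast+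
  then have "far X d s (m - 4 * \<delta>) x y" by (rule far_trans)
  then show "eventually_avoids X d s (m - 4 * \<delta>) (\<lambda>_. x) (\<lambda>_. y)" "joined X d (\<lambda>_. x) (\<lambda>_. y)"
    unfolding far_def joined_def eventually_avoids_def using seg_W_ends by blast+
qed

lemma eventually_avoids_mono:
  "eventually_avoids X d' s m R Q \<Longrightarrow> m' \<le> m \<Longrightarrow> eventually_avoids X d' s m' R Q"
  unfolding eventually_avoids_def avoids_def by (meson order_trans)

lemma representatives_point_or_ideal:
  assumes "\<eta> \<in> bordification X d" "R \<in> representatives \<eta>"
  shows "point_or_ideal X d R"
proof (cases \<eta>)
  case (Inl x)
  then show ?thesis using assms by (auto simp: bordification_def point_or_ideal_def)
next
  case (Inr E)
  then show ?thesis using assms boundary_representatives(2)[of E R]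
    unfolding bordification_def point_or_ideal_def by auto
qed

lemma representatives_common_limit:
  assumes "\<eta> \<in> bordification X d" "Q \<in> representatives \<eta>" "R \<in> representatives \<eta>"
  shows "common_limit X d Q R"
proof (cases \<eta>)
  case (Inl x)
  then show ?thesis using assms by (auto simp: bordification_def common_limit_def)
next
  case (Inr E)
  then show ?thesis using assms boundary_representatives(3)[of E Q R]
    unfolding bordification_def by auto
qed

text \<open>This is \<open>2 (6\<delta> + 2\<delta> f(\<delta>+1))\<close>, so that \<open>\<epsilon>'\<close> is the exponential of \<open>\<epsilon>\<close> times the defect.\<close>
definition defect :: real where "defect = 12 * \<delta> + 4 * \<delta> * f (\<delta> + 1)"

text \<open>If one of the three points is a boundary point, then a ray or anti-ray contains arbitrarily long
  geodesics, so \<open>f(\<delta>+1) \<ge> 1\<close> and the loss of \<open>13\<delta>\<close> is at most the defect. Three points of \<open>X\<close> only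
  need one triangle, which costs \<open>4\<delta>\<close>.\<close>
lemma L_base_quasi_ultrametric:
  assumes sep: "semimetric X d" and s: "s \<in> X"
    and bord: "\<eta> \<in> bordification X d" "\<nu> \<in> bordification X d" "\<mu> \<in> bordification X d"
    and reps: "R \<in> representatives \<eta>" "Q \<in> representatives \<nu>" "Q' \<in> representatives \<nu>" "T \<in> representatives \<mu>"
    and L1: "ereal m < L_base X d s R Q" and L2: "ereal m < L_base X d s Q' T"
  shows "ereal (m - defect) \<le> L_base X d s R T"
proof -
  note 1 = L_base_gt[OF sep L1] and 2 = L_base_gt[OF sep L2]
  have f0: "0 \<le> f (\<delta> + 1)" using f_nonneg[OF s] delta by simp
  show ?thesis
  proof (cases "ideal X d R \<or> ideal X d Q \<or> ideal X d T")
    case True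
    then have "1 \<le> f (\<delta> + 1)" using f_ge_if_ideal delta by (meson add_increasing order_refl order_trans)
    then have "4 * \<delta> * 1 \<le> 4 * \<delta> * f (\<delta> + 1)" using delta by (intro mult_left_mono) auto
    then have k: "m - defect \<le> m - 13 * \<delta>" using delta by (simp add: defect_def)
    note pR = representatives_point_or_ideal[OF bord(1) reps(1)]
      and pT = representatives_point_or_ideal[OF bord(3) reps(4)]
      and QQ' = representatives_common_limit[OF bord(2) reps(2,3)]
    note tr = avoid_transfer[OF s pR pT QQ' 1(1) 2(1) 1(2) 2(2)]
      and tr' = avoid_transfer_in[OF s pR pT QQ' 1(1) 2(1) 1(3) 2(3)]
    show ?thesis
      by (rule L_base_ge[OF sep s tr(2) eventually_avoids_mono[OF tr(1) k] eventually_avoids_mono[OF tr' k]])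
  next
    case False
    have const: "\<exists>x\<in>X. V = (\<lambda>_. x)" if "point_or_ideal X d V" "\<not> ideal X d V" for V
      using that unfolding point_or_ideal_def by blast
    obtain x where x: "x \<in> X" "R = (\<lambda>_. x)"
      using const[OF representatives_point_or_ideal[OF bord(1) reps(1)]] False by blast
    obtain y where y: "y \<in> X" "T = (\<lambda>_. y)"
      using const[OF representatives_point_or_ideal[OF bord(3) reps(4)]] False by blast
    have "\<exists>z. Q = (\<lambda>_. z) \<and> Q' = (\<lambda>_. z)"
      using representatives_common_limit[OF bord(2) reps(2,3)] False unfolding common_limit_def by blast
    then obtain z where z: "Q = (\<lambda>_. z)" "Q' = (\<lambda>_. z)" by blast
    have "0 \<le> 4 * \<delta> * f (\<delta> + 1)" using f0 delta by simp
    then have k: "m - defect \<le> m - 4 * \<delta>" using delta by (simp add: defect_def)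
    note tr = avoid_transfer_points[OF 1(1)[unfolded x z] 2(1)[unfolded y z] 1(2)[unfolded x z] 2(2)[unfolded y z]]
    have "joined X (reversed d) (\<lambda>_. y) (\<lambda>_. z)" "joined X (reversed d) (\<lambda>_. z) (\<lambda>_. x)"
      using 1(1) 2(1) x y z by auto
    note tr' = thin_space.avoid_transfer_points(1)[OF reversed this 2(3)[unfolded y z] 1(3)[unfolded x z]]
    show ?thesis unfolding x y
      by (rule L_base_ge[OF sep s tr(2) eventually_avoids_mono[OF tr(1) k] eventually_avoids_mono[OF tr' k]])
  qed
qed

lemma rho_pt_quasi_ultrametric:
  assumes sep: "semimetric X d" and s: "s \<in> X"
    and bord: "\<eta> \<in> bordification X d" "\<nu> \<in> bordification X d" "\<mu> \<in> bordification X d"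
    and m1: "ereal m < rho_pt X d s \<eta> \<nu>" and m2: "ereal m < rho_pt X d s \<nu> \<mu>"
  shows "ereal (m - defect) \<le> rho_pt X d s \<eta> \<mu>"
proof -
  have "0 \<le> defect"
    using f_nonneg[OF s, of "\<delta> + 1"] delta by (simp add: defect_def)
  then have le: "ereal (m - defect) \<le> ereal m" by simp
  consider "\<exists>x. \<eta> = Inl x \<and> \<mu> = Inl x" | "\<exists>x. \<eta> = Inl x \<and> \<nu> = Inl x" | "\<exists>x. \<nu> = Inl x \<and> \<mu> = Inl x"
    | "\<nexists>x. \<eta> = Inl x \<and> \<mu> = Inl x" "\<nexists>x. \<eta> = Inl x \<and> \<nu> = Inl x" "\<nexists>x. \<nu> = Inl x \<and> \<mu> = Inl x" by blast
  then show ?thesis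
  proof cases
    case 1
    then show ?thesis by (simp add: rho_pt_def)
  next
    case 2
    then have "\<eta> = \<nu>" by auto
    then show ?thesis using m2 le by (meson less_imp_le order_trans)
  next
    case 3
    then have "\<nu> = \<mu>" by auto
    then show ?thesis using m1 le by (meson less_imp_le order_trans)
  next
    case 4
    obtain R Q where RQ: "R \<in> representatives \<eta>" "Q \<in> representatives \<nu>" "ereal m < L_base X d s R Q"
      using m1 4(2) by (auto simp: rho_pt_def less_SUP_iff)
    obtain Q' T where QT: "Q' \<in> representatives \<nu>" "T \<in> representatives \<mu>" "ereal m < L_base X d s Q' T"
      using m2 4(3) by (auto simp: rho_pt_def less_SUP_iff)
    have "ereal (m - defect) \<le> L_base X d s R T"
      by (rule L_base_quasi_ultrametric[OF sep s bord RQ(1,2) QT(1,2) RQ(3) QT(3)])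
    also have "\<dots> \<le> (SUP T\<in>representatives \<mu>. L_base X d s R T)" by (rule SUP_upper[OF QT(2)])
    also have "\<dots> \<le> (SUP R\<in>representatives \<eta>. SUP T\<in>representatives \<mu>. L_base X d s R T)"
      by (rule SUP_upper[OF RQ(1)])
    finally show ?thesis using 4(1) by (simp add: rho_pt_def)
  qed
qed

text \<open>For a boundary point, geodesics between points far out on one representative are far from \<open>s\<close>.\<close>
lemma rho_pt_self:
  assumes sep: "semimetric X d" and s: "s \<in> X" and bord: "\<eta> \<in> bordification X d"
  shows "rho_pt X d s \<eta> \<eta> = \<infinity>"
proof (cases \<eta>)
  case (Inl x)
  then show ?thesis by (simp add: rho_pt_def)
next
  case (Inr E)
  then have E: "E \<in> qg_boundary X d" using bord by (auto simp: bordification_def)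
  obtain R where R: "R \<in> representatives \<eta>" using boundary_representatives(1)[OF E] Inr by blast
  then have "ideal X d R" using boundary_representatives(2)[OF E] Inr by blast
  have "ereal m \<le> rho_pt X d s \<eta> \<eta>" for m
  proof -
    note R' = \<open>ideal X d R\<close>
    have "ereal m \<le> L_base X d s R R"
      by (rule L_base_ge[OF sep s ideal_self(3)[OF R' s] ideal_self(1)[OF R' s] ideal_self(2)[OF R' s]])
    also have "\<dots> \<le> (SUP T\<in>representatives \<eta>. L_base X d s R T)" by (rule SUP_upper[OF R])
    also have "\<dots> \<le> (SUP R\<in>representatives \<eta>. SUP T\<in>representatives \<eta>. L_base X d s R T)"
      by (rule SUP_upper[OF R])
    finally show ?thesis using Inr by (simp add: rho_pt_def)
  qed
  then show ?thesis by (metis ereal_top)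
qed

lemma rho_quasi_ultrametric:
  assumes sep: "semimetric X d" and S: "finite S" "S \<noteq> {}" "S \<subseteq> X"
    and bord: "\<eta> \<in> bordification X d" "\<nu> \<in> bordification X d" "\<mu> \<in> bordification X d"
  shows "min (rho X d S \<eta> \<nu>) (rho X d S \<nu> \<mu>) - ereal defect \<le> rho X d S \<eta> \<mu>"
proof (rule ereal_le_sub_if)
  fix m assume "ereal m < min (rho X d S \<eta> \<nu>) (rho X d S \<nu> \<mu>)"
  then have "\<And>s. s \<in> S \<Longrightarrow> ereal m < rho_pt X d s \<eta> \<nu>" "\<And>s. s \<in> S \<Longrightarrow> ereal m < rho_pt X d s \<nu> \<mu>"
    using S by (auto simp: rho_def)
  then have "ereal (m - defect) \<le> rho_pt X d s \<eta> \<mu>" if "s \<in> S" for s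
    using rho_pt_quasi_ultrametric[OF sep _ bord] S that by blast
  then show "ereal (m - defect) \<le> rho X d S \<eta> \<mu>"
    using S by (auto simp: rho_def)
qed

lemma rho_self:
  assumes "semimetric X d" "finite S" "S \<noteq> {}" "S \<subseteq> X" "\<eta> \<in> bordification X d"
  shows "rho X d S \<eta> \<eta> = \<infinity>"
proof -
  have "(\<lambda>s. rho_pt X d s \<eta> \<eta>) ` S = (\<lambda>_. \<infinity>) ` S"
    by (rule image_cong) (use assms rho_pt_self in auto)
  then have "(\<lambda>s. rho_pt X d s \<eta> \<eta>) ` S = {\<infinity>}" using \<open>S \<noteq> {}\<close> by auto
  then show ?thesis by (simp add: rho_def)
qed

end


section \<open>The chain distance\<close>

lemma chain_dist_triangle:
  "chain_dist X d S \<epsilon> \<eta> \<mu> \<le> chain_dist X d S \<epsilon> \<eta> \<nu> + chain_dist X d S \<epsilon> \<nu> \<mu>"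
proof -
  let ?\<rho> = "rho_eps X d S \<epsilon>" and ?B = "bordification X d"
  define C where "C x y = {\<Sum>i<n. ?\<rho> (c i) (c (Suc i)) | (n::nat) c. c 0 = x \<and> c n = y \<and> (\<forall>i\<le>n. c i \<in> ?B)}" for x y
  have Inf: "chain_dist X d S \<epsilon> x y = Inf (C x y)" for x y by (simp add: chain_dist_def C_def)
  have concat: "a + b \<in> C \<eta> \<mu>" if a: "a \<in> C \<eta> \<nu>" and b: "b \<in> C \<nu> \<mu>" for a b
  proof -
    obtain n c where c: "a = (\<Sum>i<n. ?\<rho> (c i) (c (Suc i)))" "c 0 = \<eta>" "c n = \<nu>" "\<And>i. i \<le> n \<Longrightarrow> c i \<in> ?B"
      using a unfolding C_def by blast
    obtain m e where e: "b = (\<Sum>i<m. ?\<rho> (e i) (e (Suc i)))" "e 0 = \<nu>" "e m = \<mu>" "\<And>i. i \<le> m \<Longrightarrow> e i \<in> ?B"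
      using b unfolding C_def by blast
    define g where "g i = (if i \<le> n then c i else e (i - n))" for i
    have g_add: "g (n + i) = e i" for i using c e by (cases i) (auto simp: g_def)
    have "(\<Sum>i<n + m. ?\<rho> (g i) (g (Suc i))) = (\<Sum>i<n. ?\<rho> (g i) (g (Suc i))) + (\<Sum>i<m. ?\<rho> (g (n + i)) (g (n + Suc i)))"
      by (induction m) (simp_all add: add.assoc)
    also have "(\<Sum>i<n. ?\<rho> (g i) (g (Suc i))) = a" unfolding c(1) by (rule sum.cong) (auto simp: g_def)
    also have "(\<Sum>i<m. ?\<rho> (g (n + i)) (g (n + Suc i))) = b" unfolding e(1) g_add ..
    finally have "a + b = (\<Sum>i<n + m. ?\<rho> (g i) (g (Suc i)))" ..
    moreover have "g 0 = \<eta>" "g (n + m) = \<mu>" using c e g_add by (auto simp: g_def)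
    moreover have "\<forall>i\<le>n + m. g i \<in> ?B" using c e by (auto simp: g_def)
    ultimately show ?thesis unfolding C_def by blast
  qed
  have close: "\<exists>a\<in>A. a < Inf A + ennreal e" if "Inf A < top" "0 < e" for A :: "ennreal set" and e
  proof -
    obtain \<alpha> where "0 \<le> \<alpha>" "Inf A = ennreal \<alpha>" using \<open>Inf A < top\<close> by (cases "Inf A") auto
    then have "Inf A < Inf A + ennreal e" using \<open>0 < e\<close> by (simp add: ennreal_less_iff flip: ennreal_plus)
    then show ?thesis by (simp add: Inf_less_iff)
  qed
  show ?thesis
    unfolding Inf
  proof (rule ennreal_le_epsilon)
    fix e :: real assume fin: "Inf (C \<eta> \<nu>) + Inf (C \<nu> \<mu>) < top" and e: "0 < e"
    then have "Inf (C \<eta> \<nu>) < top" "Inf (C \<nu> \<mu>) < top" by auto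
    then obtain a b where a: "a \<in> C \<eta> \<nu>" "a < Inf (C \<eta> \<nu>) + ennreal (e / 2)"
      and b: "b \<in> C \<nu> \<mu>" "b < Inf (C \<nu> \<mu>) + ennreal (e / 2)"
      using close[of "C \<eta> \<nu>" "e / 2"] close[of "C \<nu> \<mu>" "e / 2"] e by auto
    have "Inf (C \<eta> \<mu>) \<le> a + b" by (rule Inf_lower[OF concat[OF a(1) b(1)]])
    also have "\<dots> \<le> (Inf (C \<eta> \<nu>) + ennreal (e / 2)) + (Inf (C \<nu> \<mu>) + ennreal (e / 2))"
      using a b by (intro add_mono less_imp_le)
    also have "\<dots> = Inf (C \<eta> \<nu>) + Inf (C \<nu> \<mu>) + (ennreal (e / 2) + ennreal (e / 2))" by (simp only: ac_simps)
    also have "ennreal (e / 2) + ennreal (e / 2) = ennreal e" using e by (simp flip: ennreal_plus)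
    finally show "Inf (C \<eta> \<mu>) \<le> Inf (C \<eta> \<nu>) + Inf (C \<nu> \<mu>) + ennreal e" .
  qed
qed

lemma chain_dist_self: "\<eta> \<in> bordification X d \<Longrightarrow> chain_dist X d S \<epsilon> \<eta> \<eta> = 0"
proof -
  assume \<eta>: "\<eta> \<in> bordification X d"
  have "0 \<in> {\<Sum>i<n. rho_eps X d S \<epsilon> (c i) (c (Suc i)) | (n::nat) c.
            c 0 = \<eta> \<and> c n = \<eta> \<and> (\<forall>i\<le>n. c i \<in> bordification X d)}"
    using \<eta> by (intro CollectI exI[of _ 0] exI[of _ "\<lambda>_. \<eta>"]) simp
  then show ?thesis unfolding chain_dist_def by (metis (no_types, lifting) Inf_lower le_zero_eq)
qed

lemma chain_dist_le:
  assumes "\<eta> \<in> bordification X d" "\<mu> \<in> bordification X d"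
  shows "chain_dist X d S \<epsilon> \<eta> \<mu> \<le> rho_eps X d S \<epsilon> \<eta> \<mu>"
  unfolding chain_dist_def
proof (rule Inf_lower)
  show "rho_eps X d S \<epsilon> \<eta> \<mu> \<in> {\<Sum>i<n. rho_eps X d S \<epsilon> (c i) (c (Suc i)) | (n::nat) c.
            c 0 = \<eta> \<and> c n = \<mu> \<and> (\<forall>i\<le>n. c i \<in> bordification X d)}"
    using assms by (intro CollectI exI[of _ 1] exI[of _ "\<lambda>i. if i = 0 then \<eta> else \<mu>"]) auto
qed


theorem theorem8p2:
  fixes X S :: "'a set" and d :: "'a \<Rightarrow> 'a \<Rightarrow> ennreal"
    and f :: "real \<Rightarrow> real" and \<delta> \<epsilon> \<epsilon>' :: real
  assumes "0 \<le> \<delta>"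
    and "semimetric X d" and "geodesic_space X d" and "hyperbolic X d \<delta>"
    and "is_base X d S" and "finite S"
    and "B1 X d f" and "B2 X d f"
    and "0 < \<epsilon>"
    and "\<epsilon>' = exp (2 * \<epsilon> * (6 * \<delta> + 2 * \<delta> * f (\<delta> + 1)))" and "\<epsilon>' < sqrt 2"
  shows "pseudo_semimetric (bordification X d) (chain_dist X d S \<epsilon>) \<and>
    (\<exists>a>1. visual X d S a (chain_dist X d S \<epsilon>)) \<and>
    (\<forall>\<eta>\<in>bordification X d. \<forall>\<mu>\<in>bordification X d.
       ennreal (3 - 2 * \<epsilon>') * rho_eps X d S \<epsilon> \<eta> \<mu> \<le> chain_dist X d S \<epsilon> \<eta> \<mu> \<and>
       chain_dist X d S \<epsilon> \<eta> \<mu> \<le> rho_eps X d S \<epsilon> \<eta> \<mu>)"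
proof -
  interpret thin_space X d \<delta> f
    by (rule thin_space_of_hyperbolic) (fact assms)+
  note sep = \<open>semimetric X d\<close> and \<epsilon> = \<open>0 < \<epsilon>\<close>
  let ?B = "bordification X d"
  have pseudo: "pseudo_semimetric ?B (chain_dist X d S \<epsilon>)"
    unfolding pseudo_semimetric_def using chain_dist_self chain_dist_triangle by blast
  show ?thesis
  proof (cases "?B = {}")
    case True
    then have "visual X d S 2 (chain_dist X d S \<epsilon>)"
      using pseudo by (auto simp: visual_def intro: exI[of _ 1])
    then show ?thesis using pseudo True by (auto intro: exI[of _ 2])
  next
    case False
    obtain x where x: "x \<in> X"
    proof -
      obtain \<eta> where \<eta>: "\<eta> \<in> ?B" using False by blast
      show ?thesis
      proof (cases \<eta>)
        case (Inl x)
        then show ?thesis using \<eta> that by (auto simp: bordification_def)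
      next
        case (Inr E)
        then have E: "E \<in> qg_boundary X d" using \<eta> by (auto simp: bordification_def)
        then obtain R where "ideal X d R" using boundary_representatives(1,2)[OF E] by blast
        then have "R 0 \<in> X" by (auto simp: quasi_ray_def)
        then show ?thesis by (rule that)
      qed
    qed
    then have S: "finite S" "S \<noteq> {}" "S \<subseteq> X" using assms(5,6) by (auto simp: is_base_def)
    have defect0: "0 \<le> defect" using f_nonneg[OF x, of "\<delta> + 1"] delta by (simp add: defect_def)
    have \<epsilon>': "\<epsilon>' = exp (\<epsilon> * defect)" using assms(10) by (simp add: defect_def algebra_simps)
    have K1: "1 \<le> \<epsilon>'" unfolding \<epsilon>' using defect0 \<epsilon> by simp
    have K2: "\<epsilon>'\<^sup>2 \<le> 2"
    proof -
      have "\<epsilon>'\<^sup>2 \<le> (sqrt 2)\<^sup>2" using assms(11) K1 by (intro power_mono) auto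
      then show ?thesis by simp
    qed
    have K3: "0 < 3 - 2 * \<epsilon>'"
    proof (rule ccontr)
      assume "\<not> ?thesis"
      then have "(3 / 2)\<^sup>2 \<le> \<epsilon>'\<^sup>2" by (intro power_mono) auto
      then show False using K2 by (simp add: power2_eq_square)
    qed
    note rho_eps = rho_eps_eq[OF \<epsilon> S(1,2)]
    have quasi: "rho_eps X d S \<epsilon> \<eta> \<mu> \<le> ennreal \<epsilon>' * max (rho_eps X d S \<epsilon> \<eta> \<nu>) (rho_eps X d S \<epsilon> \<nu> \<mu>)"
      if "\<eta> \<in> ?B" "\<nu> \<in> ?B" "\<mu> \<in> ?B" for \<eta> \<nu> \<mu>
    proof -
      let ?m = "min (rho X d S \<eta> \<nu>) (rho X d S \<nu> \<mu>)"
      have "rho_eps X d S \<epsilon> \<eta> \<mu> \<le> visual_scale \<epsilon> (?m - ereal defect)"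
        unfolding rho_eps by (rule visual_scale_antimono[OF \<epsilon> rho_quasi_ultrametric[OF sep S that]])
      also have "\<dots> \<le> ennreal \<epsilon>' * visual_scale \<epsilon> ?m" unfolding \<epsilon>' by (rule visual_scale_shift[OF \<epsilon>])
      also have "visual_scale \<epsilon> ?m = max (rho_eps X d S \<epsilon> \<eta> \<nu>) (rho_eps X d S \<epsilon> \<nu> \<mu>)"
        unfolding rho_eps using visual_scale_antimono[OF \<epsilon>] by (auto simp: min_def max_def antisym)
      finally show ?thesis .
    qed
    have lower: "ennreal (3 - 2 * \<epsilon>') * rho_eps X d S \<epsilon> \<eta> \<mu> \<le> chain_dist X d S \<epsilon> \<eta> \<mu>"
      if "\<eta> \<in> ?B" "\<mu> \<in> ?B" for \<eta> \<mu>
      unfolding chain_dist_def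
    proof (rule Inf_greatest)
      fix v assume "v \<in> {\<Sum>i<n. rho_eps X d S \<epsilon> (c i) (c (Suc i)) | (n::nat) c.
            c 0 = \<eta> \<and> c n = \<mu> \<and> (\<forall>i\<le>n. c i \<in> ?B)}"
      then obtain n c where c: "v = (\<Sum>i<n. rho_eps X d S \<epsilon> (c i) (c (Suc i)))"
        "c 0 = \<eta>" "c n = \<mu>" "\<And>i. i \<le> n \<Longrightarrow> c i \<in> ?B" by blast
      have self: "rho_eps X d S \<epsilon> \<nu> \<nu> = 0" if "\<nu> \<in> ?B" for \<nu>
        using rho_self[OF sep S that] \<epsilon> by (simp add: rho_eps visual_scale_simps)
      show "ennreal (3 - 2 * \<epsilon>') * rho_eps X d S \<epsilon> \<eta> \<mu> \<le> v"
        using quasi_ultrametric_chain[OF K1 K2, of ?B "rho_eps X d S \<epsilon>" n c] self quasi c by blast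
    qed
    have "visual X d S (exp \<epsilon>) (chain_dist X d S \<epsilon>)"
      unfolding visual_def
    proof (intro conjI exI[of _ "1 / (3 - 2 * \<epsilon>')"] ballI)
      show "1 < exp \<epsilon>" "0 < 1 / (3 - 2 * \<epsilon>')" using \<epsilon> K3 by auto
      fix \<eta> \<mu> assume \<eta>\<mu>: "\<eta> \<in> ?B" "\<mu> \<in> ?B"
      have scale: "epowr (exp \<epsilon>) (- rho X d S \<eta> \<mu>) = rho_eps X d S \<epsilon> \<eta> \<mu>"
        unfolding rho_eps using \<epsilon>
        by (cases "rho X d S \<eta> \<mu>")
          (simp_all add: visual_scale_simps powr_def epowr_infinity mult.commute)
      show "ennreal (1 / (1 / (3 - 2 * \<epsilon>'))) * epowr (exp \<epsilon>) (- rho X d S \<eta> \<mu>) \<le> chain_dist X d S \<epsilon> \<eta> \<mu>"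
        unfolding scale using lower[OF \<eta>\<mu>] by simp
      have "1 * rho_eps X d S \<epsilon> \<eta> \<mu> \<le> ennreal (1 / (3 - 2 * \<epsilon>')) * rho_eps X d S \<epsilon> \<eta> \<mu>"
      proof (rule mult_right_mono)
        have "1 \<le> 1 / (3 - 2 * \<epsilon>')" using K1 K3 by (simp add: pos_le_divide_eq)
        then show "1 \<le> ennreal (1 / (3 - 2 * \<epsilon>'))" by (metis ennreal_1 ennreal_leI)
      qed simp
      then show "chain_dist X d S \<epsilon> \<eta> \<mu> \<le> ennreal (1 / (3 - 2 * \<epsilon>')) * epowr (exp \<epsilon>) (- rho X d S \<eta> \<mu>)"
        unfolding scale using chain_dist_le[OF \<eta>\<mu>, of S \<epsilon>] by (simp add: order_trans)
    qed (rule pseudo)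
    then show ?thesis using pseudo lower chain_dist_le \<epsilon> by (metis one_less_exp_iff)
  qed
qed

end
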